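(* Let $\mathbb F$ be an algebraically closed field. Let $H(s)\in\mathbb F[s]^{m\times n}$ be a matrix pencil with Weyr characteristic $(\mathbf W,\mathbf r_*,\mathbf s_* )$, and let $P(s)=u\,v(s)^T$ be a matrix pencil with $u\in\mathbb F^{m\times 1}$ and $v(s)\in\mathbb F[s]^{n\times 1}$. Let $(\widehat{\mathbf W},\widehat{\mathbf r}_*,\widehat{\mathbf s}_* )$ be the Weyr characteristic of $H(s)+P(s)$. Then: 1. If $\operatorname{rank}(H(s)+P(s))=\operatorname{rank}(H(s))$, then - $-1\le \widehat w_i(\lambda)-w_i(\lambda)\le 1$ for all $i\ge 1$, $\lambda\in\overline{\mathbb F}$; - if $\mathbf r=(0)$, then $0\le \widehat r_i-r_i\le 2$ for all $i\ge 0$; if $\mathbf r\ne(0)$, then $-\left[\sqrt{|\mathbf r|}\right]-1\le \widehat r_i-r_i\le \left[\sqrt{|\mathbf r|-1}\right]+2$ for all $i\ge 0$; - if $\mathbf s=(0)$, then $0\le \widehat s_i-s_i\le 1$ for all $i\ge 0$; if $\mathbf s\neq(0)$, then $-\left[\sqrt{|\mathbf s_*|}\right]\le \widehat s_i-s_i\le \left[\sqrt{|\mathbf s_*|}\right]$ for all $i\ge 0$. 2. If $\operatorname{rank}(H(s)+P(s))=\operatorname{rank}(H(s))-1$, then - $-2\le \widehat w_i(\lambda)-w_i(\lambda)\le 0$ for all $i\ge 1$, $\lambda\in\overline{\mathbb F}$; - $-\left[\sqrt{|\mathbf r|}\right]\le \widehat r_i-r_i\le 1$ for all $i\ge 0$;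 - $1-\left[\sqrt{|\mathbf s_*|+1}\right]\le \widehat s_i-s_i\le 1$ for all $i\ge 0$. 3. If $\operatorname{rank}(H(s)+P(s))=\operatorname{rank}(H(s))+1$, then - $0\le \widehat w_i(\lambda)-w_i(\lambda)\le 2$ for all $i\ge 1$, $\lambda\in\overline{\mathbb F}$; - $-1\le \widehat r_i-r_i\le \left[\sqrt{|\mathbf r|+1}\right]$ for all $i\ge 0$; - $-1\le \widehat s_i-s_i\le -1+\left[\sqrt{|\mathbf s_*|}\right]$ for all $i\ge 0$.
   Context: Notation. $\overline{\mathbb F}=\mathbb F\cup\{\infty\}$; $[x]$ is the integer part of a real number $x$. A matrix pencil is a polynomial matrix $H(s)=H_0+sH_1\in\mathbb F[s]^{m\times n}$ of degree at most one; its rank is its normal rank (order of the largest minor that is not identically zero). Partitions. A partition is an infinite nonincreasing sequence of nonnegative integers, almost all zero; $|\mathbf a|$ is the sum of the components of $\mathbf a$; $(0)$ is the zero partition. The conjugate of a partition or finite nonincreasing sequence $\mathbf c=(c_1,c_2,\dots)$ of nonnegative integers is the partition $\overline{\mathbf c}=(r_1,r_2,\dots)$, $r_k=\#\{i:c_i\ge k\}$, $k\ge1$. For a partition written with a star and indexed from $0$, $\mathbf r_*=(r_0,r_1,r_2,\dots)$, one writes $\mathbf r=(r_1,r_2,\dots)$, so $|\mathbf r_*|=r_0+|\mathbf r|$. Weyr characteristic. Let $H(s)\in\mathbb F[s]^{m\times n}$ have rank $\rho$, homogeneous invariant factors $\pi_1(s,t)\mid\dots\mid\pi_\rho(s,t)$,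 column minimal indices $\mathbf c=(c_1\ge\dots\ge c_{n-\rho})$ and row minimal indices $\mathbf u=(u_1\ge\dots\ge u_{m-\rho})$ (the Kronecker invariants). The partial multiplicities $\mathbf z(\lambda)=(z_1(\lambda),z_2(\lambda),\dots)$ at $\lambda\in\overline{\mathbb F}$ are defined by $\pi_{\rho-i+1}(s,t)=t^{z_i(\infty)}\prod_{\lambda\in\mathbb F}(s-\lambda t)^{z_i(\lambda)}$ for $1\le i\le\rho$ (up to nonzero constants), and $z_i(\lambda)=0$ for $i>\rho$. The Weyr characteristic at $\lambda$ is $\mathbf w(\lambda)=\overline{\mathbf z(\lambda)}=(w_1(\lambda),w_2(\lambda),\dots)$. The Weyr characteristic of the regular part is the collection $\mathbf W$ of the $\mathbf w(\lambda)$ over the (finitely many) eigenvalues $\lambda\in\overline{\mathbb F}$ ($\mathbf w(\lambda)=(0)$ at all other $\lambda$). The column Brunovsky partition is $\mathbf r_*=(r_0,r_1,\dots)$ with $r_0=n-\rho$, $(r_1,r_2,\dots)=\overline{\mathbf c}$; the row Brunovsky partition is $\mathbf s_*=(s_0,s_1,\dots)$ with $s_0=m-\rho$, $(s_1,s_2,\dots)=\overline{\mathbf u}$. The Weyr characteristic of $H(s)$ is $(\mathbf W,\mathbf r_*,\mathbf s_* )$; decorated symbols ($\widehat w_i(\lambda)$, $\widehat r_i$, $\widehat s_i$) denote the components of the correspondingly decorated Weyr characteristic. *)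

theory Defs
  imports
    "Jordan_Normal_Form.DL_Submatrix"
    "Jordan_Normal_Form.Determinant"
    "Jordan_Normal_Form.Matrix_Kernel"
    "HOL-Computational_Algebra.Computational_Algebra"
    "HOL-Library.Groups_Big_Fun"
begin

text \<open>Polynomial matrices are matrices over \<^typ>\<open>'a poly\<close>; the pencil H0 + s H1 has the
  entries [:h0, h1:].\<close>

definition matrix_pencil :: "'a::zero poly mat \<Rightarrow> bool" where
  "matrix_pencil H \<longleftrightarrow> (\<forall>i < dim_row H. \<forall>j < dim_col H. degree (H $$ (i, j)) \<le> 1)"

definition minors :: "nat \<Rightarrow> 'b::comm_ring_1 mat \<Rightarrow> 'b set" where
  "minors k A = {det (submatrix A I J) | I J.
     I \<subseteq> {..<dim_row A} \<and> J \<subseteq> {..<dim_col A} \<and> card I = k \<and> card J = k}"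

definition normal_rank :: "'a::comm_ring_1 poly mat \<Rightarrow> nat" where
  "normal_rank H = Max {k. \<exists>d \<in> minors k H. d \<noteq> 0}"

text \<open>The ring F[s,t] is represented by \<^typ>\<open>'a poly poly\<close> with outer variable s and inner
  variable t. The homogenization of H0 + s H1 is t H0 + s H1.\<close>

definition homogenize :: "'a::comm_ring_1 poly mat \<Rightarrow> 'a poly poly mat" where
  "homogenize H = map_mat (\<lambda>h. [:[:0, coeff h 0:], [:coeff h 1:]:]) H"

definition is_gcd_of :: "'b::comm_semiring_1 set \<Rightarrow> 'b \<Rightarrow> bool" where
  "is_gcd_of A d \<longleftrightarrow> (\<forall>a \<in> A. d dvd a) \<and> (\<forall>e. (\<forall>a \<in> A. e dvd a) \<longrightarrow> e dvd d)"

text \<open>The i-th homogeneous invariant factor is the quotient D(i) / D(i-1) of consecutive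
  determinantal divisors, D(k) being a greatest common divisor of the minors of order k of the
  homogenized pencil (so D(0) = 1). Equivalently, the product of the first k factors is D(k).
  The factors are determined up to nonzero constants, which do not affect the partial
  multiplicities. The list entry with index i - 1 is the i-th factor.\<close>

definition homogeneous_invariant_factors :: "'a::field poly mat \<Rightarrow> 'a poly poly list" where
  "homogeneous_invariant_factors H = (SOME ps. length ps = normal_rank H \<and>
     (\<forall>k \<le> normal_rank H. is_gcd_of (minors k (homogenize H)) (prod_list (take k ps))))"

datatype 'a extended = Finite 'a | Infinity

text \<open>The irreducible form that belongs to a point of F extended by infinity: s - x t for a
  finite x, and t for infinity.\<close>

fun linear_form :: "'a::comm_ring_1 extended \<Rightarrow> 'a poly poly" where
  "linear_form (Finite x) = [:[:0, - x:], 1:]"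
| "linear_form Infinity = [:[:0, 1:]:]"

text \<open>The list z(1), ..., z(rho), where z(i) is the exponent of the linear form in the invariant
  factor with number rho - i + 1; the partial multiplicities with i > rho are 0. The exponent is
  written out as in \<^term>\<open>multiplicity\<close>, whose class constraints would exclude
  \<^typ>\<open>'a poly poly\<close> for a general field.\<close>

definition exponent_in :: "'b::comm_semiring_1 \<Rightarrow> 'b \<Rightarrow> nat" where
  "exponent_in p x = Max {k. p ^ k dvd x}"

definition partial_multiplicities :: "'a::field poly mat \<Rightarrow> 'a extended \<Rightarrow> nat list" where
  "partial_multiplicities H l =
     map (exponent_in (linear_form l)) (rev (homogeneous_invariant_factors H))"

text \<open>A polynomial basis is a basis over F(s) of the right null space of H that consists of
  polynomial vectors. The column minimal indices are the degrees of the vectors of a polynomial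
  basis of least order, the order being the sum of the degrees; they do not depend on the choice
  of that basis.\<close>

definition vec_degree :: "'a::zero poly vec \<Rightarrow> nat" where
  "vec_degree x = Max (insert 0 {degree (x $ i) | i. i < dim_vec x})"

definition polynomial_null_basis :: "'a::field poly mat \<Rightarrow> 'a poly vec set \<Rightarrow> bool" where
  "polynomial_null_basis H B \<longleftrightarrow>
     kernel.basis (dim_col H) (map_mat to_fract H) (map_vec to_fract ` B)"

definition minimal_null_basis :: "'a::field poly mat \<Rightarrow> 'a poly vec set \<Rightarrow> bool" where
  "minimal_null_basis H = is_arg_min (\<lambda>B. \<Sum>b\<in>B. vec_degree b) (polynomial_null_basis H)"

definition column_minimal_indices :: "'a::field poly mat \<Rightarrow> nat list" where
  "column_minimal_indices H =
     rev (sorted_list_of_multiset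
       (image_mset vec_degree (mset_set (SOME B. minimal_null_basis H B))))"

definition row_minimal_indices :: "'a::field poly mat \<Rightarrow> nat list" where
  "row_minimal_indices H = column_minimal_indices (transpose_mat H)"

text \<open>Partitions are functions on the natural numbers. The components of a conjugate partition,
  and hence of a Weyr characteristic at a point, are those with index at least 1 (the value at 0
  has no meaning); the starred Brunovsky partitions are indexed from 0.\<close>

definition conjugate_partition :: "nat list \<Rightarrow> nat \<Rightarrow> nat" where
  "conjugate_partition c k = card {i. i < length c \<and> c ! i \<ge> k}"

definition weyr_regular :: "'a::field poly mat \<Rightarrow> 'a extended \<Rightarrow> nat \<Rightarrow> nat" where
  "weyr_regular H l = conjugate_partition (partial_multiplicities H l)"

definition column_brunovsky :: "'a::field poly mat \<Rightarrow> nat \<Rightarrow> nat" where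
  "column_brunovsky H i =
     (if i = 0 then dim_col H - normal_rank H
      else conjugate_partition (column_minimal_indices H) i)"

definition row_brunovsky :: "'a::field poly mat \<Rightarrow> nat \<Rightarrow> nat" where
  "row_brunovsky H i =
     (if i = 0 then dim_row H - normal_rank H
      else conjugate_partition (row_minimal_indices H) i)"

definition weyr_characteristic ::
  "'a::field poly mat \<Rightarrow> ('a extended \<Rightarrow> nat \<Rightarrow> nat) \<times> (nat \<Rightarrow> nat) \<times> (nat \<Rightarrow> nat)" where
  "weyr_characteristic H = (weyr_regular H, column_brunovsky H, row_brunovsky H)"

text \<open>From the starred partition (r0, r1, ...) to the partition (r1, r2, ...); note the shift:
  its component r1 is at index 0.\<close>

definition unstar :: "(nat \<Rightarrow> nat) \<Rightarrow> nat \<Rightarrow> nat" where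
  "unstar r i = r (Suc i)"

definition partition_size :: "(nat \<Rightarrow> nat) \<Rightarrow> nat" where
  "partition_size a = Sum_any a"

end

theory Submission
  imports Defs "HOL-Library.Function_Algebras"
begin

text \<open>
  The two pencils \<open>H\<close> and \<open>H + u v\<^sup>T\<close> agree modulo the constant vector \<open>u\<close>, so each of the three parts
  of the Weyr characteristic can be compared through an object that both pencils share.

  Column minimal indices. Let \<open>W\<close> be the module of polynomial vectors \<open>x\<close> for which \<open>H x\<close> is a
  multiple of \<open>u\<close> over the rational functions. It contains the right null modules of both pencils, and
  each of them is cut out of \<open>W\<close> by one \<open>F[s]\<close>-linear functional, an entry of \<open>H x\<close> or of
  \<open>(H + u v\<^sup>T) x\<close>, that raises degrees by at most \<open>e = 1\<close>. Let \<open>R i\<close> be the number of minimal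
  indices of a null module that are at most \<open>i\<close>. The space of its vectors of degree less than \<open>k\<close> has
  dimension \<open>R 0 + \<dots> + R (k - 1)\<close> over \<open>F\<close>: the multiples \<open>s\<^sup>a b\<close> of the basis vectors are independent
  (\<open>sum_counts_le\<close>), and leading coefficient vectors that are independent over \<open>F\<close> come from vectors
  that are independent over \<open>F(s)\<close> (\<open>low_degree_spanning_set\<close>). The functional takes its values on these
  vectors in a space of dimension \<open>k + e\<close>. With \<open>Q\<close> the counting function of \<open>W\<close> this gives
  \<open>R \<le> Q\<close> and \<open>Q 0 + \<dots> + Q (k - 1) \<le> R 0 + \<dots> + R (k - 1) + k + e\<close>, which is the content of
  \<open>nested_counts_of_kernels\<close>.

  Row minimal indices. Dually, both left null modules contain the module of left null vectors \<open>y\<close> with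
  \<open>y\<^sup>T u = 0\<close>, and the functional \<open>y\<^sup>T u\<close> does not raise degrees, so \<open>e = 0\<close>.

  The bounds on the Brunovsky partitions follow from these inequalities by counting alone
  (\<open>column_bounds\<close>, \<open>row_bounds\<close>). If the counting function changes by \<open>x\<close> at the index \<open>i\<close>, then \<open>x\<close>
  is at most about \<open>i\<close>, while each of the \<open>i + 1\<close> components of the partition that belong to the indices
  up to \<open>i\<close> has to contribute about \<open>x\<close> to its size; so \<open>x\<^sup>2\<close> is bounded by about the size of the
  partition. This is where the square roots come from.

  Regular part. Let \<open>p\<close> be the linear form that belongs to the point \<open>\<lambda>\<close>. The component
  \<open>w\<^sub>i(\<lambda>)\<close> is the rank of the pencil minus the least rank of a matrix that is congruent to the
  homogenized pencil modulo \<open>p\<^sup>i\<close>, up to a factor prime to \<open>p\<close> (\<open>weyr_count\<close>). A rank one perturbation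
  changes this least rank by at most one (\<open>approximable_rank_one_update\<close>). In one
  direction the description of \<open>w\<^sub>i(\<lambda>)\<close> comes from the bordered minors of a minor of least \<open>p\<close>-order
  (\<open>approximable_of_dvd\<close>), in the other one from a combination of the rows of a minor that is divisible
  by \<open>p\<^sup>i\<close> (\<open>minor_divisibility\<close>).

  The homogeneous invariant factors exist because every nonzero minor of a homogenized pencil is homogeneous
  and hence, over an algebraically closed field, a constant times a product of linear forms; greatest common divisors of such
  products can be read off from the multisets of their factors (\<open>gcd_exists_of_prime_products\<close>).
\<close>

section \<open>Counting functions of nested null modules\<close>

text \<open>
  The relation between the counting functions of two null modules \<open>V \<subseteq> W\<close> of ranks \<open>p\<close> and \<open>q\<close>, where
  \<open>V\<close> is the kernel of a functional on \<open>W\<close> that raises degrees by at most \<open>e\<close>: \<open>Q i\<close> and \<open>R i\<close> count the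
  minimal indices of \<open>W\<close> and \<open>V\<close> that are at most \<open>i\<close>. The condition on sums compares the dimensions of
  the spaces of vectors of degree less than \<open>k\<close>; the last condition reflects
  that modules of equal rank coincide.
\<close>
definition nested_counts :: "nat \<Rightarrow> nat \<Rightarrow> (nat \<Rightarrow> nat) \<Rightarrow> nat \<Rightarrow> (nat \<Rightarrow> nat) \<Rightarrow> bool" where
  "nested_counts e q Q p R \<longleftrightarrow> mono Q \<and> mono R \<and> (\<forall>i. Q i \<le> q) \<and> (\<forall>i. R i \<le> p) \<and>
     (\<exists>i. Q i = q \<and> R i = p) \<and> (\<forall>i. R i \<le> Q i) \<and>
     (\<forall>k. (\<Sum>j<k. Q j) \<le> (\<Sum>j<k. R j) + k + e) \<and> (q = p \<longrightarrow> Q = R)"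

lemma nested_countsD:
  assumes "nested_counts e q Q p R"
  shows "mono Q" "mono R" "Q i \<le> q" "R i \<le> p" "R i \<le> Q i" "\<exists>i. Q i = q \<and> R i = p"
    "(\<Sum>j<k. Q j) \<le> (\<Sum>j<k. R j) + k + e" "q = p \<Longrightarrow> Q = R"
  by (insert assms, unfold nested_counts_def, (elim conjE, (assumption | erule spec | erule (1) mp))+)

text \<open>
  If \<open>Q\<close> eventually exceeded \<open>R\<close> by two, then the difference of the sums of the first \<open>k\<close> terms would grow
  like \<open>2 k\<close> and pass the bound \<open>k + e\<close>.
\<close>
lemma nested_counts_limit:
  assumes "nested_counts e q Q p R"
  shows "p \<le> q" "q \<le> Suc p"
proof -
  obtain i where i: "Q i = q" "R i = p" using nested_countsD(6)[OF assms] by blast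
  note mQ = nested_countsD(1)[OF assms] and le = nested_countsD(5)[OF assms]
    and Rp = nested_countsD(4)[OF assms] and sums = nested_countsD(7)[OF assms]
  show "p \<le> q" using i le[of i] by simp
  show "q \<le> Suc p"
  proof (rule ccontr)
    assume "\<not> q \<le> Suc p"
    then have q: "p + 2 \<le> q" by simp
    \<comment> \<open>From the index \<open>i\<close> on both functions are constant, so every further term adds at least two.\<close>
  have *: "(\<Sum>j<i + k. Q j) \<ge> (\<Sum>j<i + k. R j) + 2 * k" for k
    proof (induction k)
      case 0
      show ?case using sum_mono[of "{..<i}" R Q] le by simp
    next
      case (Suc k)
      have "q \<le> Q (i + k)" using monoD[OF mQ, of i "i + k"] i by simp
      then have "R (i + k) + 2 \<le> Q (i + k)" using Rp[of "i + k"] q by linarith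
      then show ?case using Suc by simp
    qed
    show False using *[of "i + e + 1"] sums[of "i + (i + e + 1)"] by simp
  qed
qed

lemma nested_counts_step:
  assumes "nested_counts e q Q p R"
  shows "Q i \<le> R i + Suc i + e"
proof -
  have "(\<Sum>j<i. R j) \<le> (\<Sum>j<i. Q j)"
    using nested_countsD(5)[OF assms] by (intro sum_mono) blast
  moreover have "(\<Sum>j<Suc i. Q j) \<le> (\<Sum>j<Suc i. R j) + Suc i + e"
    by (rule nested_countsD(7)[OF assms])
  ultimately show ?thesis by simp
qed

lemma mono_defect_sum:
  fixes R :: "nat \<Rightarrow> nat"
  assumes "mono R"
  shows "int (Suc i) * (int p - int (R i)) \<le> (\<Sum>j<Suc i. int p - int (R j))"
proof -
  have "(\<Sum>j<Suc i. int p - int (R i)) \<le> (\<Sum>j<Suc i. int p - int (R j))"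
    using monoD[OF assms] by (intro sum_mono) auto
  then show ?thesis by (simp only: sum_constant card_lessThan)
qed

text \<open>
  Since \<open>p\<close> is at least \<open>q - 1\<close>, at least \<open>t\<close> of the \<open>p\<close> indices counted by \<open>R\<close> exceed \<open>i\<close>. Each of the
  \<open>i + 1\<close> terms of the sum is therefore at least \<open>t\<close>, and \<open>t\<close> itself is at most \<open>i + 1\<close>.
\<close>
lemma increase_bound:
  fixes i :: nat
  assumes A: "nested_counts 1 q Q p R"
  defines "t \<equiv> int (Q i) - int (R i) - 1"
  assumes "0 \<le> t"
  shows "t * t \<le> (\<Sum>j<Suc i. int p - int (R j))"
proof -
  have "Q i \<le> q" by (rule nested_countsD(3)[OF A])
  then have "t \<le> int p - int (R i)" using nested_counts_limit(2)[OF A] by (simp add: t_def)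
  moreover have "t \<le> int (Suc i)" using nested_counts_step[OF A, of i] by (simp add: t_def)
  ultimately have "t * t \<le> int (Suc i) * (int p - int (R i))"
    using \<open>0 \<le> t\<close> by (intro mult_mono) auto
  then show ?thesis using mono_defect_sum[OF nested_countsD(2)[OF A], of i p] by linarith
qed

text \<open>
  Two null modules with counting functions \<open>R\<close> and \<open>R'\<close> lie in the same larger one. For \<open>j \<le> i\<close> monotonicity gives
  \<open>Q j - R' j \<ge> R j - R' i = x - (R i - R j)\<close>. The sum of the left-hand sides is at most \<open>i + 1 + e\<close>, so
  the values \<open>R j\<close> with \<open>j < i\<close> have to stay away from \<open>R i\<close> by the stated amount.
\<close>
lemma decrease_bound:
  fixes i :: nat
  assumes A: "nested_counts e q Q p R" and B: "nested_counts e q Q p' R'"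
  defines "x \<equiv> int (R i) - int (R' i)"
  assumes x: "x \<ge> 1"
  shows "(x - int e) * (x - 1) - int e \<le> (\<Sum>j<Suc i. int p - int (R j))"
    and "int (Suc i) * (x - 1) - int e \<le> (\<Sum>j<Suc i. int (R i) - int (R j))"
proof -
  note m = nested_countsD(2)[OF B] and le = nested_countsD(5)[OF A] and Rp = nested_countsD(4)[OF A]
  have "(\<Sum>j<Suc i. Q j) \<le> (\<Sum>j<Suc i. R' j) + Suc i + e"
    by (rule nested_countsD(7)[OF B])
  then have "(\<Sum>j<Suc i. int (Q j)) - (\<Sum>j<Suc i. int (R' j)) \<le> int (Suc i) + int e"
    unfolding of_nat_sum[symmetric] by linarith
  moreover have "(\<Sum>j<Suc i. int (R j) - int (R' i)) \<le> (\<Sum>j<Suc i. int (Q j) - int (R' j))"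
    using le monoD[OF m] by (intro sum_mono diff_mono) auto
  moreover have "(\<Sum>j<Suc i. int (R j) - int (R' i)) =
      int (Suc i) * x - (\<Sum>j<Suc i. int (R i) - int (R j))"
    unfolding x_def by (simp only: sum_subtractf sum_constant card_lessThan) (simp add: algebra_simps)
  ultimately show *: "int (Suc i) * (x - 1) - int e \<le> (\<Sum>j<Suc i. int (R i) - int (R j))"
    by (simp only: sum_subtractf right_diff_distrib mult_1_right)
  have "(\<Sum>j<Suc i. int (R i) - int (R j)) \<le> (\<Sum>j<Suc i. int p - int (R j))"
    using Rp by (intro sum_mono) auto
  moreover have "x - int e \<le> int (Suc i)"
    using nested_counts_step[OF B, of i] le[of i] unfolding x_def by linarith
  then have "(x - int e) * (x - 1) \<le> int (Suc i) * (x - 1)"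
    using x by (intro mult_right_mono) auto
  ultimately show "(x - int e) * (x - 1) - int e \<le> (\<Sum>j<Suc i. int p - int (R j))"
    using * by linarith
qed

lemma le_floor_sqrt:
  assumes "x * x \<le> z"
  shows "x \<le> \<lfloor>sqrt (real_of_int z)\<rfloor>"
proof -
  have "(real_of_int x)\<^sup>2 \<le> real_of_int z"
    using assms by (metis of_int_le_iff of_int_mult power2_eq_square)
  then show ?thesis by (simp add: le_floor_iff real_le_rsqrt)
qed

text \<open>
  The starred Brunovsky partition of \<open>p\<close> minimal indices with counting function \<open>R\<close>: its component with
  number \<open>i\<close> counts the indices that are at least \<open>i\<close>, that is, greater than \<open>i - 1\<close>.
\<close>
definition brunovsky_of :: "nat \<Rightarrow> (nat \<Rightarrow> nat) \<Rightarrow> nat \<Rightarrow> nat" where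
  "brunovsky_of p R i = (if i = 0 then p else p - R (i - 1))"

lemma partition_size_brunovsky:
  assumes "nested_counts e q Q p R \<or> nested_counts e p R p' R'"
  shows "(\<Sum>j<k. int p - int (R j)) \<le> int (partition_size (unstar (brunovsky_of p R)))"
    and "int p + (\<Sum>j<k. int p - int (R j)) \<le> int (partition_size (brunovsky_of p R))"
proof -
  have facts: "(\<exists>i. R i = p) \<and> mono R \<and> (\<forall>j. R j \<le> p)"
    using assms
  proof
    assume A: "nested_counts e q Q p R"
    show ?thesis using nested_countsD(2,4,6)[OF A] by blast
  next
    assume A: "nested_counts e p R p' R'"
    show ?thesis using nested_countsD(1,3,6)[OF A] by blast
  qed
  then obtain i where i: "R i = p" by blast
  have m: "mono R" and Rp: "\<And>j. R j \<le> p" using facts by blast+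
  have zero: "p - R j = 0" if "i \<le> j" for j using monoD[OF m that] i by simp
  define f where "f = unstar (brunovsky_of p R)"
  have f: "f j = p - R j" for j by (simp add: f_def unstar_def brunovsky_of_def)
  have "{j. f j \<noteq> 0} \<subseteq> {..<i + k}" 
  proof
    fix j assume "j \<in> {j. f j \<noteq> 0}"
    then have "\<not> i \<le> j" using zero[of j] by (auto simp: f)
    then show "j \<in> {..<i + k}" by simp
  qed
  then have pf: "partition_size f = (\<Sum>j<i + k. f j)"
    unfolding partition_size_def by (intro Sum_any.expand_superset) auto
  have "(\<Sum>j<k. f j) \<le> (\<Sum>j<i + k. f j)" by (intro sum_mono2) auto
  moreover have int_f: "(\<Sum>j<k. int p - int (R j)) = int (\<Sum>j<k. f j)" for k
    by (simp add: f of_nat_diff Rp)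
  ultimately show 1: "(\<Sum>j<k. int p - int (R j)) \<le> int (partition_size (unstar (brunovsky_of p R)))"
    using pf f_def by (metis of_nat_le_iff)
  define g where "g = brunovsky_of p R"
  have "{j. g j \<noteq> 0} \<subseteq> {..<Suc (i + k)}"
  proof
    fix j assume "j \<in> {j. g j \<noteq> 0}"
    then have "j = 0 \<or> \<not> i \<le> j - 1"
      using zero[of "j - 1"] by (auto simp: g_def brunovsky_of_def)
    then show "j \<in> {..<Suc (i + k)}" by auto
  qed
  then have "partition_size g = (\<Sum>j<Suc (i + k). g j)"
    unfolding partition_size_def by (intro Sum_any.expand_superset) auto
  also have "\<dots> = p + (\<Sum>j<i + k. f j)"
    unfolding sum.lessThan_Suc_shift by (simp add: g_def f brunovsky_of_def)
  finally show "int p + (\<Sum>j<k. int p - int (R j)) \<le> int (partition_size (brunovsky_of p R))"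
    using 1 pf by (simp add: f_def g_def)
qed

text \<open>
  The increase of \<open>R' j\<close> over \<open>R j\<close> is bounded through \<open>Q j - R j\<close> by \<open>increase_bound\<close>, the decrease by
  \<open>decrease_bound\<close>. If the ranks of the null modules differ, then the larger one has the rank of \<open>W\<close> and
  coincides with it, which fixes the sign of the change of the counting function.
\<close>
lemma column_bounds:
  assumes A: "nested_counts 1 q Q p R" and B: "nested_counts 1 q Q p' R'"
    and r: "r = brunovsky_of p R" and r': "r' = brunovsky_of p' R'"
  shows "p' = p \<Longrightarrow> unstar r = (\<lambda>_. 0) \<Longrightarrow>
      0 \<le> int (r' i) - int (r i) \<and> int (r' i) - int (r i) \<le> 2"
    and "p' = p \<Longrightarrow> unstar r \<noteq> (\<lambda>_. 0) \<Longrightarrow>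
      - \<lfloor>sqrt (real (partition_size (unstar r)))\<rfloor> - 1 \<le> int (r' i) - int (r i) \<and>
      int (r' i) - int (r i) \<le> \<lfloor>sqrt (real (partition_size (unstar r)) - 1)\<rfloor> + 2"
    and "p' = Suc p \<Longrightarrow> - \<lfloor>sqrt (real (partition_size (unstar r)))\<rfloor> \<le> int (r' i) - int (r i) \<and>
      int (r' i) - int (r i) \<le> 1"
    and "p = Suc p' \<Longrightarrow> - 1 \<le> int (r' i) - int (r i) \<and>
      int (r' i) - int (r i) \<le> \<lfloor>sqrt (real (partition_size (unstar r)) + 1)\<rfloor>"
proof -
  define N where "N = int (partition_size (unstar r))"
  have N: "(\<Sum>j<k. int p - int (R j)) \<le> N" for k
    using partition_size_brunovsky(1)[of 1 q Q p R] A unfolding N_def r by blast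
  have N0: "0 \<le> N" by (simp add: N_def)
  have sqrtN: "sqrt (real (partition_size (unstar r))) = sqrt (real_of_int N)"
    "sqrt (real (partition_size (unstar r)) + 1) = sqrt (real_of_int (N + 1))"
    "sqrt (real (partition_size (unstar r)) - 1) = sqrt (real_of_int (N - 1))"
    by (simp_all add: N_def)
  note Rp = nested_countsD(4)[OF A] and Rp' = nested_countsD(4)[OF B]
    and QR = nested_countsD(5)[OF A] and QR' = nested_countsD(5)[OF B]
  have r0: "r 0 = p" and r0': "r' 0 = p'" by (simp_all add: r r' brunovsky_of_def)
  have rS: "int (r (Suc j)) = int p - int (R j)" and rS': "int (r' (Suc j)) = int p' - int (R' j)" for j
    by (simp_all add: r r' brunovsky_of_def of_nat_diff Rp Rp')
  have floor0: "0 \<le> \<lfloor>sqrt (real_of_int N)\<rfloor>" "0 \<le> \<lfloor>sqrt (real_of_int (N + 1))\<rfloor>"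
    using N0 by simp_all
  have inc: "int (R' j) - int (R j) \<le> \<lfloor>sqrt (real_of_int N)\<rfloor> + 1" for j
  proof (cases "int (Q j) - int (R j) - 1 < 0")
    case True
    then show ?thesis using QR'[of j] floor0 by linarith
  next
    case False
    then have "(int (Q j) - int (R j) - 1) * (int (Q j) - int (R j) - 1) \<le> N"
      using increase_bound[OF A, of j] N[of "Suc j"] by linarith
    then show ?thesis using le_floor_sqrt QR'[of j] by fastforce
  qed
  have dec: "(int (R j) - int (R' j) - 1) * (int (R j) - int (R' j) - 1) - 1 \<le> N"
    if "1 \<le> int (R j) - int (R' j)" for j
    using decrease_bound(1)[OF A B that] N[of "Suc j"] by simp
  show "0 \<le> int (r' i) - int (r i) \<and> int (r' i) - int (r i) \<le> 2"
    if "p' = p" and zero: "unstar r = (\<lambda>_. 0)"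
  proof (cases i)
    case (Suc j)
    have all: "int (R j) = int p" for j using zero rS[of j] by (metis unstar_def of_nat_0 right_minus_eq)
    show ?thesis
    proof (cases "1 \<le> int (R j) - int (R' j)")
      case True
      have "int (Suc j) * (int (R j) - int (R' j) - 1) - int 1 \<le> 0"
        using decrease_bound(2)[OF A B True] all by simp
      moreover have "1 * (int (R j) - int (R' j) - 1) \<le> int (Suc j) * (int (R j) - int (R' j) - 1)"
        using True by (intro mult_right_mono) auto
      ultimately show ?thesis using Suc rS rS' that Rp'[of j] all[of j] by simp
    qed (use Suc rS rS' that Rp'[of j] all[of j] in simp)
  qed (simp add: r0 r0' that)
  show "- \<lfloor>sqrt (real (partition_size (unstar r)))\<rfloor> - 1 \<le> int (r' i) - int (r i) \<and>
      int (r' i) - int (r i) \<le> \<lfloor>sqrt (real (partition_size (unstar r)) - 1)\<rfloor> + 2"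
    if "p' = p" and nz: "unstar r \<noteq> (\<lambda>_. 0)"
  proof -
    obtain k where "r (Suc k) \<noteq> 0" using nz by (auto simp: unstar_def fun_eq_iff)
    then have "1 \<le> int p - int (R k)" using rS[of k] by linarith
    moreover have "0 \<le> (\<Sum>j<k. int p - int (R j))" using Rp by (intro sum_nonneg) auto
    ultimately have N1: "1 \<le> N" using N[of "Suc k"] by simp
    then have f0: "0 \<le> \<lfloor>sqrt (real_of_int (N - 1))\<rfloor>" by simp
    show ?thesis
    proof (cases i)
      case 0
      show ?thesis unfolding 0 r0 r0' sqrtN using that floor0 f0 by linarith
    next
      case (Suc j)
      have eq: "int (r' i) - int (r i) = int (R j) - int (R' j)" using Suc rS rS' that by simp
      have "int (R j) - int (R' j) \<le> \<lfloor>sqrt (real_of_int (N - 1))\<rfloor> + 2"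
      proof (cases "int (R j) - int (R' j) \<le> 2")
        case False
        define x where "x = int (R j) - int (R' j)"
        have "(x - 1) * (x - 1) - 1 \<le> N" using dec[of j] False by (simp add: x_def)
        moreover have "(x - 2) * (x - 2) + 2 \<le> (x - 1) * (x - 1)"
          using False by (simp add: x_def[symmetric] algebra_simps)
        ultimately have "(x - 2) * (x - 2) \<le> N - 1" by linarith
        then show ?thesis using le_floor_sqrt[of "x - 2" "N - 1"] by (simp add: x_def)
      qed (use f0 in linarith)
      then show ?thesis using inc[of j] unfolding eq sqrtN by linarith
    qed
  qed
  show "- \<lfloor>sqrt (real (partition_size (unstar r)))\<rfloor> \<le> int (r' i) - int (r i) \<and>
      int (r' i) - int (r i) \<le> 1" if p': "p' = Suc p"
  proof -
    have "q = p'" using nested_counts_limit[OF A] nested_counts_limit[OF B] p' by simp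
    then have "Q = R'" by (rule nested_countsD(8)[OF B])
    then have le: "R j \<le> R' j" for j using QR by simp
    show ?thesis
    proof (cases i)
      case (Suc j)
      then show ?thesis using rS[of j] rS'[of j] p' inc[of j] le[of j] sqrtN(1) by simp
    next
      case 0
      show ?thesis unfolding 0 r0 r0' sqrtN using p' floor0 by linarith
    qed
  qed
  show "- 1 \<le> int (r' i) - int (r i) \<and>
      int (r' i) - int (r i) \<le> \<lfloor>sqrt (real (partition_size (unstar r)) + 1)\<rfloor>" if p: "p = Suc p'"
  proof -
    have "q = p" using nested_counts_limit[OF A] nested_counts_limit[OF B] p by simp
    then have "Q = R" by (rule nested_countsD(8)[OF A])
    then have le: "R' j \<le> R j" for j using QR' by simp
    have "int (R j) - int (R' j) - 1 \<le> \<lfloor>sqrt (real_of_int (N + 1))\<rfloor>" for j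
    proof (cases "1 \<le> int (R j) - int (R' j)")
      case True
      show ?thesis using dec[OF True] by (intro le_floor_sqrt) simp
    qed (use floor0 in linarith)
    note bound = this
    show ?thesis
    proof (cases i)
      case (Suc j)
      then show ?thesis using rS[of j] rS'[of j] p bound[of j] le[of j] sqrtN(2) by simp
    next
      case 0
      show ?thesis unfolding 0 r0 r0' sqrtN using p floor0 by linarith
    qed
  qed
qed

text \<open>
  Now the common module is the smaller one. A decrease of \<open>R j\<close> is bounded as for the columns, with \<open>p\<close>
  itself, the component with number zero, making up for the weaker estimate. An increase by \<open>x\<close> means
  that about \<open>x\<close> indices exceed \<open>j\<close>, and \<open>x \<le> j + 1\<close>.
\<close>
lemma row_bounds:
  assumes A: "nested_counts 0 p R q Q" and B: "nested_counts 0 p' R' q Q"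
    and s: "s = brunovsky_of p R" and s': "s' = brunovsky_of p' R'"
  shows "p' = p \<Longrightarrow> unstar s = (\<lambda>_. 0) \<Longrightarrow>
      0 \<le> int (s' i) - int (s i) \<and> int (s' i) - int (s i) \<le> 1"
    and "p' = p \<Longrightarrow> - \<lfloor>sqrt (real (partition_size s))\<rfloor> \<le> int (s' i) - int (s i) \<and>
      int (s' i) - int (s i) \<le> \<lfloor>sqrt (real (partition_size s))\<rfloor>"
    and "p' = Suc p \<Longrightarrow> 1 - \<lfloor>sqrt (real (partition_size s) + 1)\<rfloor> \<le> int (s' i) - int (s i) \<and>
      int (s' i) - int (s i) \<le> 1"
    and "p = Suc p' \<Longrightarrow> - 1 \<le> int (s' i) - int (s i) \<and>
      int (s' i) - int (s i) \<le> - 1 + \<lfloor>sqrt (real (partition_size s))\<rfloor>"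
proof -
  define N where "N = int (partition_size s)"
  have N: "int p + (\<Sum>j<k. int p - int (R j)) \<le> N" for k
    using partition_size_brunovsky(2)[of 0 _ _ p R q Q] A unfolding N_def s by blast
  have N0: "int p \<le> N" using N[of 0] by simp
  have sqrtN: "sqrt (real (partition_size s)) = sqrt (real_of_int N)"
    "sqrt (real (partition_size s) + 1) = sqrt (real_of_int (N + 1))"
    by (simp_all add: N_def)
  note Rp = nested_countsD(3)[OF A] and Rp' = nested_countsD(3)[OF B]
    and QR = nested_countsD(5)[OF A] and QR' = nested_countsD(5)[OF B]
    and m = nested_countsD(1)[OF A] and mQ = nested_countsD(2)[OF A]
  have s0: "s 0 = p" and s0': "s' 0 = p'" by (simp_all add: s s' brunovsky_of_def)
  have sS: "int (s (Suc j)) = int p - int (R j)" and sS': "int (s' (Suc j)) = int p' - int (R' j)" for j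
    by (simp_all add: s s' brunovsky_of_def of_nat_diff Rp Rp')
  have floor0: "0 \<le> \<lfloor>sqrt (real_of_int N)\<rfloor>" "1 \<le> \<lfloor>sqrt (real_of_int (N + 1))\<rfloor>"
    using N0 by (simp_all add: le_floor_iff)
  have dec0: "int (Suc j) * (int (R j) - int (R' j) - 1) \<le> (\<Sum>l<Suc j. int (R j) - int (R l))" for j
  proof -
    have "(\<Sum>l<Suc j. R l) \<le> (\<Sum>l<Suc j. Q l) + Suc j + 0"
      by (rule nested_countsD(7)[OF A])
    then have "(\<Sum>l<Suc j. int (R l)) \<le> (\<Sum>l<Suc j. int (Q l)) + int (Suc j)"
      unfolding of_nat_sum[symmetric] by linarith
    moreover have "(\<Sum>l<Suc j. int (Q l)) \<le> (\<Sum>l<Suc j. int (R' j))"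
    proof (intro sum_mono)
      fix l assume "l \<in> {..<Suc j}"
      then have "Q l \<le> Q j" by (intro monoD[OF mQ]) simp
      then show "int (Q l) \<le> int (R' j)" using QR'[of j] by linarith
    qed
    ultimately show ?thesis
      by (simp only: sum_subtractf sum_constant card_lessThan) (simp add: algebra_simps)
  qed
  have dec: "int (R j) - int (R' j) \<le> \<lfloor>sqrt (real_of_int N)\<rfloor>" for j
  proof (cases "int (R j) - int (R' j) \<ge> 1")
    case True
    define x where "x = int (R j) - int (R' j)"
    have "x \<le> int (Suc j)"
      using nested_counts_step[OF A, of j] QR'[of j] unfolding x_def by linarith
    then have "x * (x - 1) \<le> int (Suc j) * (x - 1)"
      using True by (intro mult_right_mono) (auto simp: x_def)
    also have "\<dots> \<le> (\<Sum>l<Suc j. int (R j) - int (R l))" using dec0[of j] by (simp only: x_def)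
    also have "\<dots> \<le> (\<Sum>l<Suc j. int p - int (R l))" using Rp by (intro sum_mono) auto
    finally have "x * (x - 1) + x \<le> N" using N[of "Suc j"] Rp[of j] unfolding x_def by linarith
    then have "x * x \<le> N" by (simp add: algebra_simps)
    then show ?thesis using le_floor_sqrt by (simp add: x_def)
  qed (use floor0 in linarith)
  have inc: "int (R' j) - int (R j) \<le> int (Suc j)" for j
    using nested_counts_step[OF B, of j] QR[of j] by linarith
  have def: "int (Suc j) * (int p - int (R j)) + int p \<le> N" for j
    using N[of "Suc j"] mono_defect_sum[OF m, of j p] by linarith
  show "0 \<le> int (s' i) - int (s i) \<and> int (s' i) - int (s i) \<le> 1"
    if "p' = p" and zero: "unstar s = (\<lambda>_. 0)"
  proof (cases i)
    case (Suc j)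
    have all: "int (R j) = int p" for j using zero sS[of j] by (metis unstar_def of_nat_0 right_minus_eq)
    have "int (Suc j) * (int (R j) - int (R' j) - 1) \<le> 0" using dec0[of j] all by simp
    then have "int (R j) - int (R' j) - 1 \<le> 0" by (simp add: mult_le_0_iff)
    then show ?thesis using Suc sS sS' that Rp'[of j] all[of j] by simp
  qed (simp add: s0 s0' that)
  show "- \<lfloor>sqrt (real (partition_size s))\<rfloor> \<le> int (s' i) - int (s i) \<and>
      int (s' i) - int (s i) \<le> \<lfloor>sqrt (real (partition_size s))\<rfloor>" if "p' = p"
  proof (cases i)
    case 0
    show ?thesis unfolding 0 s0 s0' sqrtN using that floor0 by linarith
  next
    case (Suc j)
    have "int (R' j) - int (R j) \<le> \<lfloor>sqrt (real_of_int N)\<rfloor>"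
    proof (cases "int (R' j) - int (R j) \<ge> 0")
      case True
      then have "(int (R' j) - int (R j)) * (int (R' j) - int (R j)) \<le> int (Suc j) * (int p - int (R j))"
        using inc[of j] Rp'[of j] that by (intro mult_mono) auto
      then show ?thesis using def[of j] by (intro le_floor_sqrt) linarith
    qed (use floor0 in linarith)
    then show ?thesis using dec[of j] Suc sS sS' that by (simp add: sqrtN)
  qed
  show "1 - \<lfloor>sqrt (real (partition_size s) + 1)\<rfloor> \<le> int (s' i) - int (s i) \<and>
      int (s' i) - int (s i) \<le> 1" if p': "p' = Suc p"
  proof -
    have "p = q" using nested_counts_limit[OF A] nested_counts_limit[OF B] p' by simp
    then have "R = Q" by (rule nested_countsD(8)[OF A])
    then have le: "R j \<le> R' j" for j using QR' by simp
    have "int (R' j) - int (R j) \<le> \<lfloor>sqrt (real_of_int (N + 1))\<rfloor>" for j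
    proof (cases "int (R' j) - int (R j) \<ge> 1")
      case True
      define y where "y = int (R' j) - int (R j)"
      have "y * (y - 1) \<le> int (Suc j) * (int p - int (R j))"
        using True inc[of j] Rp'[of j] p' unfolding y_def by (intro mult_mono) auto
      moreover have "y - 1 \<le> int p" using Rp'[of j] p' by (simp add: y_def)
      ultimately have "y * (y - 1) + (y - 1) \<le> N" using def[of j] by linarith
      then have "y * y \<le> N + 1" by (simp add: algebra_simps)
      then show ?thesis using le_floor_sqrt by (simp only: y_def)
    qed (use floor0 in linarith)
    note bound = this
    show ?thesis
    proof (cases i)
      case (Suc j)
      then show ?thesis using sS[of j] sS'[of j] p' bound[of j] le[of j] sqrtN(2) by simp
    next
      case 0
      show ?thesis unfolding 0 s0 s0' sqrtN using p' floor0 by linarith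
    qed
  qed
  show "- 1 \<le> int (s' i) - int (s i) \<and>
      int (s' i) - int (s i) \<le> - 1 + \<lfloor>sqrt (real (partition_size s))\<rfloor>" if p: "p = Suc p'"
  proof -
    have "p' = q" using nested_counts_limit[OF A] nested_counts_limit[OF B] p by simp
    then have "R' = Q" by (rule nested_countsD(8)[OF B])
    then have le: "R' j \<le> R j" for j using QR by simp
    have "1 \<le> \<lfloor>sqrt (real_of_int N)\<rfloor>" using N0 p by (simp add: le_floor_iff)
    note floor1 = this
    show ?thesis
    proof (cases i)
      case (Suc j)
      then show ?thesis using sS[of j] sS'[of j] p dec[of j] le[of j] sqrtN(1) by simp
    next
      case 0
      show ?thesis unfolding 0 s0 s0' sqrtN using p floor1 by linarith
    qed
  qed
qed

section \<open>Linear independence over a field and over its rational functions\<close>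

lemma sum_fun_apply: "(\<Sum>x\<in>S. f x) i = (\<Sum>x\<in>S. f x i)"
  by (induction S rule: infinite_finite_induct) auto

text \<open>
  For a finite indexed family the absence of relations yields injectivity as well; this turns the number of
  indices into a number of vectors.
\<close>
lemma (in vector_space) independent_family:
  assumes P: "finite P"
    and ind: "\<And>u. (\<Sum>p\<in>P. u p *s f p) = 0 \<Longrightarrow> \<forall>p\<in>P. u p = 0"
  shows "inj_on f P" and "independent (f ` P)"
proof -
  show inj: "inj_on f P"
  proof (rule inj_onI, rule ccontr)
    fix x y assume xy: "x \<in> P" "y \<in> P" "f x = f y" "x \<noteq> y"
    define u where "u = (\<lambda>p. if p = x then 1 else if p = y then - 1 else (0 :: 'a))"
    have "(\<Sum>p\<in>P. u p *s f p) = (\<Sum>p\<in>{x, y}. u p *s f p)"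
      using xy P by (intro sum.mono_neutral_right) (auto simp: u_def)
    also have "\<dots> = 0" using xy by (simp add: u_def)
    finally have "u x = 0" using ind xy by blast
    then show False by (simp add: u_def)
  qed
  show "independent (f ` P)"
  proof (rule independent_if_scalars_zero)
    fix u x assume "(\<Sum>x\<in>f ` P. u x *s x) = 0" and x: "x \<in> f ` P"
    then have "(\<Sum>p\<in>P. u (f p) *s f p) = 0" by (simp add: sum.reindex[OF inj])
    then show "u x = 0" using ind[of "u \<circ> f"] x by auto
  qed (use P in simp)
qed

text \<open>
  Each functional lowers the dimension by at most one, expressed through generating sets: one vector on
  which the functional does not vanish generates the space together with the kernel.
\<close>
lemma (in vector_space) span_of_common_kernel:
  assumes "finite L"
    and "\<And>l x y. l \<in> L \<Longrightarrow> f l (x + y) = f l x + f l y"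
    and "\<And>l c x. l \<in> L \<Longrightarrow> f l (c *s x) = c * f l x"
    and "subspace V" and "{x \<in> V. \<forall>l\<in>L. f l x = 0} \<subseteq> span C"
  shows "\<exists>D. finite D \<and> card D \<le> card L \<and> V \<subseteq> span (C \<union> D)"
  using assms
proof (induction L arbitrary: V rule: finite_induct)
  case empty
  then show ?case by (intro exI[of _ "{}"]) auto
next
  case (insert l L)
  define V' where "V' = {x \<in> V. f l x = 0}"
  have f0: "f l 0 = 0" using insert.prems(2)[of l 0 0] by simp
  have sub: "subspace V'"
    using insert.prems(1,2)[of l] insert.prems(3) f0 by (auto simp: V'_def subspace_def)
  have "\<exists>D. finite D \<and> card D \<le> card L \<and> V' \<subseteq> span (C \<union> D)"
    using insert.prems sub by (intro insert.IH) (auto simp: V'_def)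
  then obtain D where D: "finite D" "card D \<le> card L" "V' \<subseteq> span (C \<union> D)" by blast
  show ?case
  proof (cases "V \<subseteq> V'")
    case True
    then show ?thesis using D insert.hyps by (intro exI[of _ D]) auto
  next
    case False
    then obtain y where y: "y \<in> V" "f l y \<noteq> 0" by (auto simp: V'_def)
    have "V \<subseteq> span (C \<union> insert y D)"
    proof
      fix x assume x: "x \<in> V"
      define c where "c = f l x / f l y"
      have eq: "(x - c *s y) + c *s y = x" by simp
      have "x - c *s y \<in> V" using insert.prems(3) x y by (simp add: subspace_diff subspace_scale)
      moreover have "f l (x - c *s y) = 0"
        using insert.prems(1)[of l "x - c *s y" "c *s y"] insert.prems(2)[of l c y] y(2)
        unfolding eq by (simp add: c_def)
      ultimately have "x - c *s y \<in> span (C \<union> D)" using D by (auto simp: V'_def)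
      then have "x - c *s y \<in> span (C \<union> insert y D)" using span_mono[of "C \<union> D" "C \<union> insert y D"] by blast
      moreover have "c *s y \<in> span (C \<union> insert y D)" by (intro span_scale span_base) simp
      ultimately show "x \<in> span (C \<union> insert y D)" using span_add eq by metis
    qed
    moreover have "card (insert y D) \<le> card (insert l L)"
      using D insert.hyps by (simp add: card_insert_if)
    ultimately show ?thesis using D by (intro exI[of _ "insert y D"]) auto
  qed
qed

lemma (in vector_space) span_eq_of_card:
  assumes "independent S" "S \<subseteq> span T" "finite T" "card T \<le> card S"
  shows "T \<subseteq> span S"
proof
  fix x assume x: "x \<in> T"
  show "x \<in> span S"
  proof (rule ccontr)
    assume n: "x \<notin> span S"
    then have "independent (insert x S)" by (simp add: assms independent_insertI)
    moreover have "insert x S \<subseteq> span T" using assms x span_base by auto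
    ultimately have "card (insert x S) \<le> card T" "finite S"
      using independent_span_bound[of T] assms by auto
    moreover have "x \<notin> S" using n span_base by auto
    ultimately show False using assms by simp
  qed
qed

definition scale_fun :: "'b::field \<Rightarrow> (nat \<Rightarrow> 'b) \<Rightarrow> nat \<Rightarrow> 'b" where
  "scale_fun c x = (\<lambda>i. c * x i)"

interpretation vs: vector_space "scale_fun :: 'b::field \<Rightarrow> _"
  by unfold_locales (auto simp: scale_fun_def fun_eq_iff algebra_simps)

definition scale_poly_fun :: "'a::field \<Rightarrow> (nat \<Rightarrow> 'a poly) \<Rightarrow> nat \<Rightarrow> 'a poly" where
  "scale_poly_fun c x = (\<lambda>i. smult c (x i))"

interpretation pvs: vector_space "scale_poly_fun :: 'a::field \<Rightarrow> _"
  by unfold_locales (auto simp: scale_poly_fun_def fun_eq_iff algebra_simps smult_add_right smult_add_left)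

text \<open>
  Vectors of length \<open>n\<close> are represented by functions on the natural numbers that vanish from \<open>n\<close> on, so
  that all vectors belong to one vector space over \<open>F\<close> and, after this embedding, over \<open>F(s)\<close>.
\<close>
definition embed :: "(nat \<Rightarrow> 'a::field poly) \<Rightarrow> nat \<Rightarrow> 'a poly fract" where
  "embed x = (\<lambda>i. to_fract (x i))"

lemma embed_inj: "inj embed"
  by (auto intro!: injI simp: embed_def fun_eq_iff)

lemma common_denominator:
  fixes f :: "'c \<Rightarrow> 'b::idom fract"
  assumes "finite S"
  shows "\<exists>d g. d \<noteq> 0 \<and> (\<forall>x\<in>S. to_fract d * f x = to_fract (g x))"
  using assms
proof induction
  case empty
  show ?case by (intro exI[of _ 1]) auto
next
  case (insert x S)
  then obtain d g where d: "d \<noteq> 0" "\<forall>x\<in>S. to_fract d * f x = to_fract (g x)" by blast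
  obtain a b where ab: "f x = Fract a b" "b \<noteq> 0" by (cases "f x")
  have x: "to_fract b * f x = to_fract a" using ab by (simp add: Fract_conv_to_fract)
  define g' where "g' y = (if y = x then d * a else b * g y)" for y
  have "to_fract (d * b) * f y = to_fract (g' y)" if "y \<in> insert x S" for y
  proof (cases "y = x")
    case True
    then show ?thesis using x by (simp add: g'_def to_fract_mult mult.assoc)
  next
    case False
    then have "to_fract d * f y = to_fract (g y)" using that d by auto
    then show ?thesis using False by (simp add: g'_def to_fract_mult mult.assoc mult.left_commute)
  qed
  then show ?case using d ab by (intro exI[of _ "d * b"] exI[of _ g']) auto
qed

text \<open>
  After clearing denominators only the relations with polynomial coefficients have to be excluded.
\<close>
lemma embed_independent_family:
  assumes P: "finite P"
    and ind: "\<And>q. (\<And>j. (\<Sum>p\<in>P. q p * f p j) = 0) \<Longrightarrow> \<forall>p\<in>P. q p = 0"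
  shows "inj_on (embed \<circ> f) P" and "vs.independent ((embed \<circ> f) ` P)"
proof -
  have *: "\<forall>p\<in>P. u p = 0" if sum: "(\<Sum>p\<in>P. scale_fun (u p) ((embed \<circ> f) p)) = 0" for u
  proof -
    obtain d g where d: "d \<noteq> 0" "\<forall>p\<in>P. to_fract d * u p = to_fract (g p)"
      using common_denominator[OF P, of u] by blast
    have "(\<Sum>p\<in>P. g p * f p j) = 0" for j
    proof -
      have "(\<Sum>p\<in>P. u p * to_fract (f p j)) = 0"
        using fun_cong[OF sum, of j] by (simp add: sum_fun_apply scale_fun_def embed_def)
      then have "(\<Sum>p\<in>P. to_fract d * (u p * to_fract (f p j))) = 0"
        by (simp flip: sum_distrib_left)
      then have "to_fract (\<Sum>p\<in>P. g p * f p j) = 0"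
        unfolding to_fract_sum to_fract_mult
        using d by (simp flip: mult.assoc)
      then show ?thesis by (simp only: to_fract_eq_0_iff)
    qed
    then have "\<forall>p\<in>P. g p = 0" by (rule ind)
    then show ?thesis using d by auto
  qed
  show "inj_on (embed \<circ> f) P" and "vs.independent ((embed \<circ> f) ` P)"
    using vs.independent_family[OF P] * by blast+
qed

lemma embed_independentD:
  assumes B: "finite B" "vs.independent (embed ` B)"
    and sum: "\<And>j. (\<Sum>b\<in>B. q b * b j) = 0"
  shows "\<forall>b\<in>B. q b = 0"
proof -
  have inj: "inj_on embed B" using embed_inj by (rule inj_on_subset) simp
  define u where "u y = to_fract (q (the_inv_into B embed y))" for y
  have u: "u (embed b) = to_fract (q b)" if "b \<in> B" for b
    using that by (simp add: u_def the_inv_into_f_f[OF inj])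
  have "(\<Sum>y\<in>embed ` B. scale_fun (u y) y) = 0"
  proof
    fix j
    have "(\<Sum>y\<in>embed ` B. scale_fun (u y) y) j = (\<Sum>b\<in>B. to_fract (q b * b j))"
      unfolding sum_fun_apply sum.reindex[OF inj]
      by (intro sum.cong refl) (simp add: scale_fun_def u, simp add: embed_def)
    also have "\<dots> = to_fract (\<Sum>b\<in>B. q b * b j)" by (simp add: to_fract_sum)
    finally show "(\<Sum>y\<in>embed ` B. scale_fun (u y) y) j = 0 j" by (simp add: sum)
  qed
  then have "\<forall>y\<in>embed ` B. u y = 0"
    using B vs.dependent_finite[of "embed ` B"] by auto
  then show ?thesis using u by auto
qed

text \<open>
  The degree bound is strict, so that the bound zero is met by the zero vector only.
\<close>
definition degree_below :: "nat \<Rightarrow> (nat \<Rightarrow> 'a::zero poly) \<Rightarrow> bool" where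
  "degree_below k x \<longleftrightarrow> (\<forall>j l. k \<le> l \<longrightarrow> coeff (x j) l = 0)"

definition count_below :: "(nat \<Rightarrow> 'a::zero poly) set \<Rightarrow> nat \<Rightarrow> nat" where
  "count_below B i = card {b \<in> B. degree_below (Suc i) b}"

lemma degree_below_mono: "degree_below k x \<Longrightarrow> k \<le> l \<Longrightarrow> degree_below l x"
  by (auto simp: degree_below_def)

lemma coeff_mult_top:
  fixes p q :: "'a::comm_semiring_0 poly"
  assumes "\<And>l. d < l \<Longrightarrow> coeff p l = 0" "\<And>l. k < l \<Longrightarrow> coeff q l = 0"
  shows "coeff (p * q) (d + k) = coeff p d * coeff q k"
proof -
  have "coeff p i * coeff q (d + k - i) = 0" if "i \<noteq> d" for i
    using that assms(1)[of i] assms(2)[of "d + k - i"] by (cases "i < d") auto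
  then have "(\<Sum>i\<le>d + k. coeff p i * coeff q (d + k - i)) =
      (\<Sum>i\<in>{d}. coeff p i * coeff q (d + k - i))"
    by (intro sum.mono_neutral_right) auto
  then show ?thesis by (simp add: coeff_mult)
qed

text \<open>
  The vectors \<open>s\<^sup>a b\<close> with \<open>a + degree b < k\<close> are independent over \<open>F\<close>, since a relation between them is a
  relation between the \<open>b\<close> with polynomial coefficients. A vector \<open>b\<close> of degree \<open>d\<close> contributes \<open>k - d\<close> of
  them, as many as there are \<open>j < k\<close> with \<open>d \<le> j\<close>.
\<close>
lemma sum_counts_le:
  fixes B :: "(nat \<Rightarrow> 'a::field poly) set"
  assumes B: "finite B" "vs.independent (embed ` B)"
    and C: "finite C"
    and span: "\<And>b a. b \<in> B \<Longrightarrow> a < k \<Longrightarrow> degree_below (k - a) b \<Longrightarrow> (\<lambda>j. monom 1 a * b j) \<in> pvs.span C"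
  shows "(\<Sum>j<k. count_below B j) \<le> card C"
proof -
  \<comment> \<open>\<open>P\<close> indexes the multiples \<open>s\<^sup>a b\<close> of degree less than \<open>k\<close>.\<close>
  define P where "P = (SIGMA a:{..<k}. {b \<in> B. degree_below (k - a) b})"
  define f :: "nat \<times> (nat \<Rightarrow> 'a poly) \<Rightarrow> nat \<Rightarrow> 'a poly"
    where "f = (\<lambda>(a, b) j. monom 1 a * b j)"
  have P: "finite P" using B by (simp add: P_def)
  have "\<forall>p\<in>P. u p = 0" if sum: "(\<Sum>p\<in>P. scale_poly_fun (u p) (f p)) = 0" for u
  proof -
    \<comment> \<open>\<open>q b\<close> collects the multiples of \<open>b\<close> in the relation.\<close>
    define q where "q b = (\<Sum>a<k. if (a, b) \<in> P then monom (u (a, b)) a else 0)" for b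
    have "(\<Sum>b\<in>B. q b * b j) = 0" for j
    proof -
      have "(\<Sum>b\<in>B. q b * b j) = (\<Sum>b\<in>B. \<Sum>a<k. if (a, b) \<in> P then monom (u (a, b)) a * b j else 0)"
        unfolding q_def sum_distrib_right by (intro sum.cong refl) auto
      also have "\<dots> = (\<Sum>a<k. \<Sum>b\<in>B. if (a, b) \<in> P then monom (u (a, b)) a * b j else 0)"
        by (rule sum.swap)
      also have "\<dots> = (\<Sum>a<k. \<Sum>b\<in>{b \<in> B. degree_below (k - a) b}. monom (u (a, b)) a * b j)"
        using B by (intro sum.cong refl sum.mono_neutral_cong_right) (auto simp: P_def)
      also have "\<dots> = (\<Sum>(a, b)\<in>P. monom (u (a, b)) a * b j)"
        unfolding P_def using B by (intro sum.Sigma) auto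
      also have "\<dots> = (\<Sum>p\<in>P. scale_poly_fun (u p) (f p)) j"
        unfolding sum_fun_apply
        by (intro sum.cong refl) (auto simp: scale_poly_fun_def f_def smult_monom simp flip: mult_smult_left)
      finally show ?thesis by (simp add: sum)
    qed
    then have q0: "\<forall>b\<in>B. q b = 0" by (rule embed_independentD[OF B])
    show ?thesis
    proof clarify
      fix a b assume ab: "(a, b) \<in> P"
      then have "a < k" "b \<in> B" by (auto simp: P_def)
      have "coeff (q b) a = (\<Sum>a'<k. if a' = a then u (a, b) else 0)"
        unfolding q_def coeff_sum using ab by (intro sum.cong refl) auto
      also have "\<dots> = u (a, b)" using \<open>a < k\<close> by simp
      finally show "u (a, b) = 0" using q0 \<open>b \<in> B\<close> by simp
    qed
  qed
  then have "inj_on f P" "pvs.independent (f ` P)"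
    using pvs.independent_family[OF P, of f] by blast+
  moreover have "f ` P \<subseteq> pvs.span C" using span by (auto simp: P_def f_def)
  ultimately have "card P \<le> card C"
    using pvs.independent_span_bound[OF C] card_image by metis
  moreover have "card P = (\<Sum>a<k. card {b \<in> B. degree_below (k - a) b})"
    unfolding P_def using B by (intro card_SigmaI) auto
  moreover have "\<dots> = (\<Sum>a<k. count_below B (k - Suc a))"
    by (intro sum.cong refl) (simp add: count_below_def Suc_diff_Suc)
  moreover have "\<dots> = (\<Sum>j<k. count_below B j)" by (rule sum.nat_diff_reindex)
  ultimately show ?thesis by simp
qed

section \<open>Minimal bases and dimension counts\<close>

definition lin_form :: "nat \<Rightarrow> (nat \<Rightarrow> 'b::comm_semiring_0) \<Rightarrow> (nat \<Rightarrow> 'b) \<Rightarrow> 'b" where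
  "lin_form n a x = (\<Sum>j<n. a j * x j)"

lemma lin_form_add: "lin_form n a (x + y) = lin_form n a x + lin_form n a (y :: nat \<Rightarrow> 'b::comm_semiring_0)"
  by (simp add: lin_form_def algebra_simps sum.distrib)

lemma lin_form_scale_poly_fun: "lin_form n a (scale_poly_fun c x) = smult c (lin_form n a x)"
  by (intro poly_eqI) (simp add: lin_form_def scale_poly_fun_def coeff_sum sum_distrib_left)

lemma lin_form_scale_fun: "lin_form n a (scale_fun c x) = c * lin_form n a x"
  by (simp add: lin_form_def scale_fun_def sum_distrib_left mult.left_commute)

lemma lin_form_emb: "lin_form n (embed a) (embed x) = to_fract (lin_form n a x)"
  by (simp add: lin_form_def embed_def)

text \<open>
  The characteristic property of a minimal basis is the last but one condition: vectors of low degree are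
  combinations, over \<open>F(s)\<close>, of the basis vectors of equally low degree.
\<close>
definition minimal_basis :: "(nat \<Rightarrow> 'a::field poly) set \<Rightarrow> (nat \<Rightarrow> 'a poly) set \<Rightarrow> bool" where
  "minimal_basis V B \<longleftrightarrow> pvs.subspace V \<and> finite B \<and> B \<subseteq> V \<and> vs.independent (embed ` B) \<and>
     (\<forall>b\<in>B. \<exists>k. degree_below k b) \<and>
     (\<forall>x\<in>V. embed x \<in> vs.span (embed ` B)) \<and>
     (\<forall>k. \<forall>x\<in>V. degree_below k x \<longrightarrow> embed x \<in> vs.span (embed ` {b \<in> B. degree_below k b})) \<and>
     (\<forall>x\<in>V. \<forall>c. (\<lambda>j. c * x j) \<in> V)"

lemma minimal_basisD:
  assumes "minimal_basis V B"
  shows "pvs.subspace V" "finite B" "B \<subseteq> V" "vs.independent (embed ` B)"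
    "b \<in> B \<Longrightarrow> \<exists>k. degree_below k b" "x \<in> V \<Longrightarrow> embed x \<in> vs.span (embed ` B)"
    "x \<in> V \<Longrightarrow> degree_below k x \<Longrightarrow> embed x \<in> vs.span (embed ` {b \<in> B. degree_below k b})"
    "x \<in> V \<Longrightarrow> (\<lambda>j. c * x j) \<in> V"
  using assms by (simp_all add: minimal_basis_def)

lemma card_emb: "card (embed ` B) = card B"
  using embed_inj by (intro card_image) (auto intro: inj_on_subset)

lemma subspace_below:
  "pvs.subspace V \<Longrightarrow> pvs.subspace {x \<in> V. degree_below k x}"
  by (auto simp: pvs.subspace_def degree_below_def scale_poly_fun_def)

text \<open>
  Together with \<open>sum_counts_le\<close> this determines the dimension of the space of vectors of degree less than
  \<open>k\<close>. Passing from degree less than \<open>k\<close> to degree at most \<open>k\<close> adds as many dimensions as there are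
  independent vectors of coefficients of \<open>s\<^sup>k\<close>. Vectors with such coefficients are independent over \<open>F(s)\<close>:
  in a relation with polynomial coefficients of maximal degree \<open>d\<close>, compare the coefficients of
  \<open>s\<close> to the power \<open>d + k\<close>. So their number is at most the number of basis vectors of degree at most \<open>k\<close>.
\<close>
lemma low_degree_spanning_set:
  assumes B: "minimal_basis V B"
  shows "\<exists>C. finite C \<and> card C \<le> (\<Sum>j<k. count_below B j) \<and> {x \<in> V. degree_below k x} \<subseteq> pvs.span C"
proof (induction k)
  case 0
  have "x = 0" if "degree_below 0 x" for x :: "nat \<Rightarrow> 'a poly"
    using that by (auto simp: degree_below_def fun_eq_iff poly_eq_iff)
  then show ?case by (intro exI[of _ "{}"]) auto
next
  case (Suc k)
  then obtain C where C: "finite C" "card C \<le> (\<Sum>j<k. count_below B j)"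
    "{x \<in> V. degree_below k x} \<subseteq> pvs.span C" by blast
  define N where "N = {x \<in> V. degree_below (Suc k) x}"
  define lead :: "(nat \<Rightarrow> 'a poly) \<Rightarrow> nat \<Rightarrow> 'a" where "lead x = (\<lambda>j. coeff (x j) k)" for x
  obtain E where E: "E \<subseteq> lead ` N" "vs.independent E" "lead ` N \<subseteq> vs.span E"
    by (rule vs.maximal_independent_subset)
  have "\<forall>e\<in>E. \<exists>x. x \<in> N \<and> lead x = e" using E(1) by blast
  then obtain g where g: "\<And>e. e \<in> E \<Longrightarrow> g e \<in> N \<and> lead (g e) = e" by metis
  have finB: "finite B" using B by (simp add: minimal_basis_def)
  have bound: "card T \<le> count_below B k" if T: "T \<subseteq> E" "finite T" for T
  proof -
    have "\<forall>e\<in>T. q e = 0" if rel: "\<And>j. (\<Sum>e\<in>T. q e * g e j) = 0" for q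
    proof (rule ccontr)
      assume "\<not> (\<forall>e\<in>T. q e = 0)"
      then obtain e0 where e0: "e0 \<in> T" "q e0 \<noteq> 0" by blast
      define d where "d = Max ((degree \<circ> q) ` {e \<in> T. q e \<noteq> 0})"
      have fin: "finite ((degree \<circ> q) ` {e \<in> T. q e \<noteq> 0})" using T by simp
      have "d \<in> (degree \<circ> q) ` {e \<in> T. q e \<noteq> 0}"
        unfolding d_def using fin e0 by (intro Max_in) auto
      then obtain e1 where e1: "e1 \<in> T" "q e1 \<noteq> 0" "degree (q e1) = d" by auto
      have deg: "coeff (q e) l = 0" if "e \<in> T" "d < l" for e l
      proof (cases "q e = 0")
        case False
        then have "degree (q e) \<le> d" unfolding d_def using that fin by (intro Max_ge) auto
        then show ?thesis using that by (intro coeff_eq_0) simp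
      qed simp
      have "(\<Sum>e\<in>T. scale_fun (coeff (q e) d) e) = 0"
      proof
        fix j
        have "coeff (q e * g e j) (d + k) = coeff (q e) d * e j" if "e \<in> T" for e
        proof -
          have "e \<in> E" using that T by blast
          then have "degree_below (Suc k) (g e)" "lead (g e) = e" using g by (auto simp: N_def)
          then show ?thesis
            using coeff_mult_top[of d "q e" k "g e j"] deg[OF that]
            by (auto simp: degree_below_def lead_def dest: fun_cong[of _ _ j])
        qed
        then have "(\<Sum>e\<in>T. coeff (q e) d * e j) = coeff (\<Sum>e\<in>T. q e * g e j) (d + k)"
          by (simp add: coeff_sum)
        then show "(\<Sum>e\<in>T. scale_fun (coeff (q e) d) e) j = 0 j"
          by (simp add: sum_fun_apply scale_fun_def rel)
      qed
      moreover have "vs.independent T" using E(2) T(1) vs.independent_mono by blast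
      moreover have "vs.dependent T"
        if "(\<Sum>e\<in>T. scale_fun (coeff (q e) d) e) = 0" "coeff (q e1) d \<noteq> 0"
        unfolding vs.dependent_finite[OF T(2)] using that e1(1)
        by (intro exI[of _ "\<lambda>e. coeff (q e) d"]) blast
      ultimately have "coeff (q e1) d = 0" by blast
      then show False using e1 by auto
    qed
    then have ind: "inj_on (embed \<circ> g) T" "vs.independent ((embed \<circ> g) ` T)"
      using embed_independent_family[OF T(2), of g] by blast+
    have "(embed \<circ> g) ` T \<subseteq> vs.span (embed ` {b \<in> B. degree_below (Suc k) b})"
    proof
      fix y assume "y \<in> (embed \<circ> g) ` T"
      then obtain e where e: "e \<in> T" "y = embed (g e)" by auto
      then have "g e \<in> V" "degree_below (Suc k) (g e)" using g T by (auto simp: N_def)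
      then show "y \<in> vs.span (embed ` {b \<in> B. degree_below (Suc k) b})"
        using B e by (auto simp: minimal_basis_def)
    qed
    then have "card ((embed \<circ> g) ` T) \<le> card (embed ` {b \<in> B. degree_below (Suc k) b})"
      using vs.independent_span_bound[OF _ ind(2)] finB by simp
    then show ?thesis unfolding card_image[OF ind(1)] card_emb count_below_def .
  qed
  have finE: "finite E"
  proof (rule ccontr)
    assume "infinite E"
    then obtain T where "T \<subseteq> E" "finite T" "card T = Suc (count_below B k)"
      using infinite_arbitrarily_large by blast
    then show False using bound[of T] by simp
  qed
  define C' where "C' = C \<union> g ` E"
  have "card C' \<le> card C + card (g ` E)" unfolding C'_def by (rule card_Un_le)
  also have "\<dots> \<le> (\<Sum>j<k. count_below B j) + count_below B k"
    using C(2) card_image_le[OF finE, of g] bound[of E] finE by simp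
  finally have "card C' \<le> (\<Sum>j<Suc k. count_below B j)" by simp
  moreover have "N \<subseteq> pvs.span C'"
  proof
    fix x assume x: "x \<in> N"
    then have "lead x \<in> vs.span E" using E(3) by blast
    then obtain u where u: "lead x = (\<Sum>e\<in>E. scale_fun (u e) e)"
      using vs.span_finite[OF finE] by auto
    define y where "y = (\<Sum>e\<in>E. scale_poly_fun (u e) (g e))"
    have y: "y \<in> pvs.span C'" unfolding y_def
      by (intro pvs.span_sum pvs.span_scale pvs.span_base) (auto simp: C'_def)
    have subN: "pvs.subspace N" using B subspace_below[of V "Suc k"] by (simp add: minimal_basis_def N_def)
    have "y \<in> N" unfolding y_def using g by (intro pvs.subspace_sum pvs.subspace_scale subN) auto
    then have "x - y \<in> N" using x subN by (simp add: pvs.subspace_diff)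
    moreover have "degree_below k (x - y)"
      unfolding degree_below_def
    proof (intro allI impI)
      fix j l assume "k \<le> l"
      show "coeff ((x - y) j) l = 0"
      proof (cases "l = k")
        case True
        have "coeff (y j) k = (\<Sum>e\<in>E. u e * lead (g e) j)"
          by (simp add: y_def sum_fun_apply coeff_sum scale_poly_fun_def lead_def)
        also have "\<dots> = (\<Sum>e\<in>E. u e * e j)" using g by (intro sum.cong) auto
        also have "\<dots> = lead x j" by (simp add: u sum_fun_apply scale_fun_def)
        finally show ?thesis using True by (simp add: lead_def fun_diff_def)
      next
        case False
        then have "Suc k \<le> l" using \<open>k \<le> l\<close> by simp
        then show ?thesis using \<open>x - y \<in> N\<close> by (auto simp: N_def degree_below_def)
      qed
    qed
    ultimately have "x - y \<in> pvs.span C" using C(3) by (auto simp: N_def)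
    then have "x - y \<in> pvs.span C'" using pvs.span_mono[of C C'] by (auto simp: C'_def)
    then have "(x - y) + y \<in> pvs.span C'" using y by (rule pvs.span_add)
    then show "x \<in> pvs.span C'" by simp
  qed
  ultimately show ?case using C(1) finE by (intro exI[of _ C']) (auto simp: C'_def N_def)
qed

text \<open>
  On the vectors of \<open>W\<close> of degree less than \<open>k\<close> the functional is determined by \<open>k + e\<close> coefficients, so
  its kernel has codimension at most \<open>k + e\<close> there. If the ranks agree, then \<open>V\<close> and \<open>W\<close> span the same
  space over \<open>F(s)\<close>, on which the extended functional vanishes, and \<open>V = W\<close>.
\<close>
lemma nested_counts_of_kernels:
  assumes W: "minimal_basis W C" and V: "minimal_basis V B"
    and VW: "V = {x \<in> W. lin_form n a x = 0}"
    and deg: "\<And>k x l. x \<in> W \<Longrightarrow> degree_below k x \<Longrightarrow> k + e \<le> l \<Longrightarrow> coeff (lin_form n a x) l = 0"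
  shows "nested_counts e (card C) (count_below C) (card B) (count_below B)"
proof -
  have finB: "finite B" and finC: "finite C" using minimal_basisD(2)[OF V] minimal_basisD(2)[OF W] by auto
  have mono: "mono (count_below A)" if "finite A" for A :: "(nat \<Rightarrow> 'a poly) set"
    using that degree_below_mono unfolding count_below_def mono_def
    by (intro allI impI card_mono) (auto intro: degree_below_mono)
  have le: "count_below A i \<le> card A" if "finite A" for A :: "(nat \<Rightarrow> 'a poly) set" and i
    unfolding count_below_def using that by (intro card_mono) auto
  have "\<forall>b\<in>B \<union> C. \<exists>k. degree_below k b" using minimal_basisD(5)[OF V] minimal_basisD(5)[OF W] by blast
  then obtain f where f: "\<And>b. b \<in> B \<union> C \<Longrightarrow> degree_below (f b) b" by metis
  define i0 where "i0 = Max (insert 0 (f ` (B \<union> C)))"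
  have all: "degree_below (Suc i0) b" if "b \<in> B \<union> C" for b
  proof -
    have "f b \<le> i0" unfolding i0_def using that finB finC by (intro Max_ge) auto
    then show ?thesis using f[OF that] degree_below_mono le_SucI by blast
  qed
  have top: "count_below C i0 = card C \<and> count_below B i0 = card B"
    unfolding count_below_def using all by (intro conjI arg_cong[where f = card]) auto
  have compare: "count_below A i \<le> count_below A' i"
    if A: "minimal_basis X A" and A': "minimal_basis X' A'" and sub: "A \<subseteq> X'"
    for A A' X X' :: "(nat \<Rightarrow> 'a poly) set" and i
  proof -
    have "vs.independent (embed ` {b \<in> A. degree_below (Suc i) b})"
      by (rule vs.independent_mono[OF minimal_basisD(4)[OF A]]) auto
    moreover have "embed ` {b \<in> A. degree_below (Suc i) b} \<subseteq> vs.span (embed ` {b \<in> A'. degree_below (Suc i) b})"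
      using minimal_basisD(7)[OF A'] sub by auto
    moreover have "finite (embed ` {b \<in> A'. degree_below (Suc i) b})" using minimal_basisD(2)[OF A'] by simp
    ultimately show ?thesis
      using vs.independent_span_bound[of "embed ` {b \<in> A'. degree_below (Suc i) b}"]
      unfolding count_below_def card_emb[symmetric] by blast
  qed
  have BW: "B \<subseteq> W" using minimal_basisD(3)[OF V] VW by auto
  have sums: "(\<Sum>j<k. count_below C j) \<le> (\<Sum>j<k. count_below B j) + k + e" for k
  proof -
    obtain D where D: "finite D" "card D \<le> (\<Sum>j<k. count_below B j)" "{x \<in> V. degree_below k x} \<subseteq> pvs.span D"
      using low_degree_spanning_set[OF V] by blast
    have "\<exists>D'. finite D' \<and> card D' \<le> card {..<k + e} \<and> {x \<in> W. degree_below k x} \<subseteq> pvs.span (D \<union> D')"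
    proof (rule pvs.span_of_common_kernel[where f = "\<lambda>l x. coeff (lin_form n a x) l"])
      show "pvs.subspace {x \<in> W. degree_below k x}" by (rule subspace_below[OF minimal_basisD(1)[OF W]])
      have "lin_form n a x = 0" if "x \<in> W" "degree_below k x" "\<forall>l<k + e. coeff (lin_form n a x) l = 0" for x
      proof (rule poly_eqI)
        fix l show "coeff (lin_form n a x) l = coeff 0 l"
          using deg[OF that(1,2), of l] that(3) by (cases "l < k + e") auto
      qed
      then show "{x \<in> {x \<in> W. degree_below k x}. \<forall>l\<in>{..<k + e}. coeff (lin_form n a x) l = 0} \<subseteq> pvs.span D"
        using D(3) VW by auto
    qed (auto simp: lin_form_add lin_form_scale_poly_fun)
    then obtain D' where D': "finite D'" "card D' \<le> k + e" "{x \<in> W. degree_below k x} \<subseteq> pvs.span (D \<union> D')"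
      by auto
    have "(\<Sum>j<k. count_below C j) \<le> card (D \<union> D')"
    proof (rule sum_counts_le[OF finC])
      show "vs.independent (embed ` C)" by (rule minimal_basisD(4)[OF W])
      fix b i assume b: "b \<in> C" "i < k" "degree_below (k - i) b"
      have "degree_below k (\<lambda>j. monom 1 i * b j)" using b by (auto simp: degree_below_def coeff_monom_mult)
      then show "(\<lambda>j. monom 1 i * b j) \<in> pvs.span (D \<union> D')" using D'(3) minimal_basisD(8)[OF W] minimal_basisD(3)[OF W] b by blast
    qed (use D D' in auto)
    then show ?thesis using D D' card_Un_le[of D D'] by linarith
  qed
  have eq: "count_below C = count_below B" if "card C = card B"
  proof -
    have "embed ` B \<subseteq> vs.span (embed ` C)" using minimal_basisD(6)[OF W] BW by auto
    then have "embed ` C \<subseteq> vs.span (embed ` B)"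
      by (rule vs.span_eq_of_card[OF minimal_basisD(4)[OF V]]) (use finC that in \<open>simp_all only: card_emb finite_imageI\<close>)
    moreover have "vs.span (embed ` B) \<subseteq> {y. lin_form n (embed a) y = 0}"
    proof (rule vs.span_minimal)
      show "embed ` B \<subseteq> {y. lin_form n (embed a) y = 0}"
        using minimal_basisD(3)[OF V] VW by (auto simp: lin_form_emb)
    qed (auto simp: vs.subspace_def lin_form_add lin_form_scale_fun, simp add: lin_form_def)
    ultimately have "lin_form n (embed a) (embed c) = 0" if "c \<in> C" for c using that by blast
    then have "C \<subseteq> V" using minimal_basisD(3)[OF W] VW by (auto simp: lin_form_emb)
    then show ?thesis by (intro ext antisym compare[OF V W BW] compare[OF W V])
  qed
  show ?thesis
    unfolding nested_counts_def
    by (intro conjI allI impI exI[of _ i0] mono finB finC le compare[OF V W BW] sums eq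
        top[THEN conjunct1] top[THEN conjunct2])
qed

section \<open>Minors with indexed rows and columns\<close>

text \<open>
  A minor whose rows and columns are selected by functions, possibly with repetitions and in any order; in
  contrast to index sets, such a selection is extended by one more index without any sorting.
\<close>
definition fminor :: "'b::comm_ring_1 mat \<Rightarrow> nat \<Rightarrow> (nat \<Rightarrow> nat) \<Rightarrow> (nat \<Rightarrow> nat) \<Rightarrow> 'b" where
  "fminor A k f g = det (mat k k (\<lambda>(i, j). A $$ (f i, g j)))"

lemma fminor_cong:
  "(\<And>i. i < k \<Longrightarrow> f i = f' i) \<Longrightarrow> (\<And>j. j < k \<Longrightarrow> g j = g' j) \<Longrightarrow> fminor A k f g = fminor A k f' g'"
  unfolding fminor_def by (intro arg_cong[where f = det] cong_mat) auto

lemma fminor_transpose: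
  assumes "\<And>i. i < k \<Longrightarrow> f i < dim_row A" "\<And>j. j < k \<Longrightarrow> g j < dim_col A"
  shows "fminor (transpose_mat A) k g f = fminor A k f g"
proof -
  have "mat k k (\<lambda>(i, j). transpose_mat A $$ (g i, f j)) =
      transpose_mat (mat k k (\<lambda>(i, j). A $$ (f i, g j)))"
    using assms by (intro eq_matI) auto
  then show ?thesis unfolding fminor_def by (simp add: det_transpose[of _ k])
qed

lemma submatrix_pick:
  assumes "I \<subseteq> {..<dim_row A}" "J \<subseteq> {..<dim_col A}" "card I = k" "card J = k"
  shows "submatrix A I J = mat k k (\<lambda>(i, j). A $$ (pick I i, pick J j))"
proof -
  have "{i. i < dim_row A \<and> i \<in> I} = I" "{j. j < dim_col A \<and> j \<in> J} = J" using assms by auto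
  then show ?thesis using assms by (simp add: submatrix_def)
qed

lemma pick_image:
  assumes "finite I"
  shows "pick I ` {..<card I} = I" "inj_on (pick I) {..<card I}"
proof -
  show inj: "inj_on (pick I) {..<card I}"
    by (rule linorder_inj_onI') (use pick_mono_le[of _ I] in fastforce)
  have "pick I ` {..<card I} \<subseteq> I" using pick_in_set_le[of _ I] by auto
  then show "pick I ` {..<card I} = I"
    using card_image[OF inj] assms by (intro card_subset_eq) auto
qed

lemma minorsE:
  assumes "d \<in> minors k A"
  obtains I J where "d = det (submatrix A I J)" "I \<subseteq> {..<dim_row A}" "J \<subseteq> {..<dim_col A}"
    "card I = k" "card J = k"
  using assms unfolding minors_def mem_Collect_eq by (elim exE conjE)

lemma minor_obtains:
  assumes "d \<in> minors k A"
  obtains f g where "d = fminor A k f g" "f ` {..<k} \<subseteq> {..<dim_row A}" "g ` {..<k} \<subseteq> {..<dim_col A}"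
    "inj_on f {..<k}" "inj_on g {..<k}"
proof -
  from assms obtain I J where IJ: "d = det (submatrix A I J)" "I \<subseteq> {..<dim_row A}" "J \<subseteq> {..<dim_col A}"
    "card I = k" "card J = k" by (rule minorsE)
  then have "finite I" "finite J" using finite_subset by auto
  then have "pick I ` {..<k} = I" "inj_on (pick I) {..<k}" "pick J ` {..<k} = J" "inj_on (pick J) {..<k}"
    using pick_image[of I] pick_image[of J] IJ by simp_all
  with IJ show ?thesis by (intro that[of "pick I" "pick J"]) (simp_all add: fminor_def submatrix_pick)
qed

text \<open>
  The factor is the sign of the permutation that sorts the rows.
\<close>
lemma sort_rows:
  assumes f: "f ` {..<k} \<subseteq> {..<dim_row A}" "inj_on f {..<k}"
  shows "\<exists>s. fminor A k f g = s * fminor A k (pick (f ` {..<k})) g"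
proof -
  define I where "I = f ` {..<k}"
  have I: "finite I" "card I = k" using f by (auto simp: I_def card_image)
  note pick = pick_image[OF I(1), unfolded I(2)]
  define p where "p i = (if i < k then inv_into {..<k} (pick I) (f i) else i)" for i
  have pI: "pick I (p i) = f i" "p i < k" if "i < k" for i
  proof -
    have "f i \<in> pick I ` {..<k}" using that pick by (auto simp: I_def)
    then show "pick I (p i) = f i" "p i < k"
      using that f_inv_into_f[of "f i" "pick I"] inv_into_into[of "f i" "pick I" "{..<k}"] by (auto simp: p_def)
  qed
  have inj: "inj_on p {0..<k}"
  proof (rule inj_onI)
    fix x y assume "x \<in> {0..<k}" "y \<in> {0..<k}" "p x = p y"
    then show "x = y" using pI(1)[of x] pI(1)[of y] inj_onD[OF f(2), of x y] by auto
  qed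
  have "p ` {0..<k} \<subseteq> {0..<k}" using pI(2) by auto
  then have "bij_betw p {0..<k} {0..<k}"
    using inj by (simp add: bij_betw_def endo_inj_surj)
  then have perm: "p permutes {0..<k}" by (rule bij_imp_permutes) (auto simp: p_def)
  define M where "M = mat k k (\<lambda>(i, j). A $$ (pick I i, g j))"
  have "mat k k (\<lambda>(i, j). A $$ (f i, g j)) = mat k k (\<lambda>(i, j). M $$ (p i, j))"
    using pI by (intro eq_matI) (auto simp: M_def)
  then have "fminor A k f g = signof p * det M"
    using det_permute_rows[of M k p] perm by (simp add: fminor_def M_def)
  then show ?thesis by (auto simp: M_def fminor_def I_def)
qed

lemma fminor_noninj:
  assumes "\<not> inj_on f {..<k}"
  shows "fminor A k f g = 0"
proof -
  obtain x y where "x < k" "y < k" "x \<noteq> y" "f x = f y" using assms by (auto simp: inj_on_def)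
  then show ?thesis unfolding fminor_def
    by (intro det_identical_rows[of _ k x y]) (auto intro!: eq_vecI)
qed

text \<open>
  Such a determinant is zero or, up to sign, a minor in the sense of index sets.
\<close>
lemma dvd_fminor:
  assumes dvd: "\<And>d. d \<in> minors k A \<Longrightarrow> x dvd d"
    and f: "f ` {..<k} \<subseteq> {..<dim_row A}" and g: "g ` {..<k} \<subseteq> {..<dim_col A}"
  shows "x dvd fminor A k f g"
proof -
  consider "\<not> inj_on f {..<k}" | "\<not> inj_on g {..<k}" | "inj_on f {..<k}" "inj_on g {..<k}" by blast
  then show ?thesis
  proof cases
    case 1
    then show ?thesis by (simp add: fminor_noninj)
  next
    case 2
    then have "fminor (transpose_mat A) k g f = 0" by (rule fminor_noninj)
    then show ?thesis using f g by (subst (asm) fminor_transpose) auto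
  next
    case 3
    define I where "I = f ` {..<k}"
    define J where "J = g ` {..<k}"
    have I: "finite I" "card I = k" and J: "finite J" "card J = k"
      using 3 by (auto simp: I_def J_def card_image)
    note pI = pick_image[OF I(1), unfolded I(2)] and pJ = pick_image[OF J(1), unfolded J(2)]
    have rows: "pick I i < dim_row A" if "i < k" for i using pI(1) that f by (auto simp: I_def)
    have cols: "pick J i < dim_col A" if "i < k" for i using pJ(1) that g by (auto simp: J_def)
    obtain s where s: "fminor A k f g = s * fminor A k (pick I) g"
      using sort_rows[OF f 3(1), of g] by (auto simp: I_def)
    obtain t where "fminor (transpose_mat A) k g (pick I) = t * fminor (transpose_mat A) k (pick J) (pick I)"
      using sort_rows[of g k "transpose_mat A" "pick I"] g 3(2) by (auto simp: J_def)
    moreover have "fminor (transpose_mat A) k g (pick I) = fminor A k (pick I) g"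
      using g rows by (intro fminor_transpose) auto
    moreover have "fminor (transpose_mat A) k (pick J) (pick I) = fminor A k (pick I) (pick J)"
      using rows cols by (intro fminor_transpose) auto
    ultimately have t: "fminor A k (pick I) g = t * fminor A k (pick I) (pick J)" by simp
    have "fminor A k (pick I) (pick J) = det (submatrix A I J)"
      using f g I J by (subst submatrix_pick[of I A J k]) (auto simp: I_def J_def fminor_def)
    moreover have "det (submatrix A I J) \<in> minors k A"
      using f g I J by (auto simp: minors_def I_def[symmetric] J_def[symmetric])
    ultimately show ?thesis using dvd by (simp add: s t dvd_mult)
  qed
qed

text \<open>
  Laplace expansion along the added last column: \<open>c l i\<close> is, up to sign, the minor with columns \<open>g\<close> in
  which the row \<open>f l\<close> is replaced by the row \<open>i\<close>; it does not depend on \<open>j\<close>. So the matrix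
  is, up to the factor \<open>fminor A k f g\<close> and the bordered minors, a product through dimension \<open>k\<close>.
\<close>
lemma bordered_minor:
  assumes f: "f ` {..<k} \<subseteq> {..<dim_row A}" and g: "g ` {..<k} \<subseteq> {..<dim_col A}"
  shows "\<exists>c. (\<forall>x. (\<forall>d\<in>minors k A. x dvd d) \<longrightarrow> (\<forall>l<k. \<forall>i<dim_row A. x dvd c l i)) \<and>
    (\<forall>i<dim_row A. \<forall>j<dim_col A. fminor A (Suc k) (f(k := i)) (g(k := j)) =
       fminor A k f g * A $$ (i, j) + (\<Sum>l<k. c l i * A $$ (f l, j)))"
proof -
  \<comment> \<open>\<open>skip l\<close> enumerates the indices other than \<open>l\<close>.\<close>
  define skip where "skip l x = (if x < l then x else Suc x)" for l x :: nat
  define c where "c l i = (- 1) ^ (l + k) * fminor A k (f(k := i) \<circ> skip l) g" for l i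
  have fl: "f y < dim_row A" if "y < k" for y using f that by auto
  have "x dvd c l i"
    if "\<And>d. d \<in> minors k A \<Longrightarrow> x dvd d" "l < k" "i < dim_row A" for x l i
    unfolding c_def
  proof (intro dvd_mult dvd_fminor that(1) g)
    show "(f(k := i) \<circ> skip l) ` {..<k} \<subseteq> {..<dim_row A}" 
    proof (rule image_subsetI)
      fix y assume "y \<in> {..<k}"
      then have "skip l y \<le> k" by (simp add: skip_def)
      then consider "skip l y = k" | "skip l y < k" by linarith
      then show "(f(k := i) \<circ> skip l) y \<in> {..<dim_row A}"
        using fl[of "skip l y"] that(3) by cases auto
    qed
  qed
  moreover have "fminor A (Suc k) (f(k := i)) (g(k := j)) =
       fminor A k f g * A $$ (i, j) + (\<Sum>l<k. c l i * A $$ (f l, j))"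
    if "i < dim_row A" "j < dim_col A" for i j
  proof -
    define M where "M = mat (Suc k) (Suc k) (\<lambda>(x, y). A $$ ((f(k := i)) x, (g(k := j)) y))"
    have "mat_delete M l k = mat k k (\<lambda>(x, y). A $$ ((f(k := i) \<circ> skip l) x, g y))" if "l < Suc k" for l
      unfolding mat_delete_def M_def using that by (intro eq_matI) (auto simp: skip_def)
    then have cof: "cofactor M l k = c l i" if "l < Suc k" for l
      using that by (simp add: cofactor_def c_def fminor_def)
    have last: "c k i = fminor A k f g"
    proof -
      have "fminor A k (f(k := i) \<circ> skip k) g = fminor A k f g"
        by (rule fminor_cong) (auto simp: skip_def)
      then show ?thesis by (simp add: c_def)
    qed
    have "det M = (\<Sum>l<Suc k. M $$ (l, k) * cofactor M l k)"
      by (rule laplace_expansion_column) (auto simp: M_def)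
    also have "\<dots> = (\<Sum>l<Suc k. M $$ (l, k) * c l i)" using cof by (intro sum.cong) auto
    also have "\<dots> = fminor A k f g * A $$ (i, j) + (\<Sum>l<k. c l i * A $$ (f l, j))"
      using last by (simp add: M_def mult.commute)
    finally show ?thesis by (simp add: fminor_def M_def)
  qed
  ultimately show ?thesis by (intro exI[of _ c] conjI) blast+
qed

lemma normal_rank_props:
  fixes A :: "'a::comm_ring_1 poly mat"
  shows "\<exists>d\<in>minors (normal_rank A) A. d \<noteq> 0"
    and "normal_rank A < k \<Longrightarrow> d \<in> minors k A \<Longrightarrow> d = 0"
    and "normal_rank A \<le> dim_col A"
proof -
  define S where "S = {k. \<exists>d\<in>minors k A. d \<noteq> 0}"
  have bound: "k \<le> dim_col A" if d: "d \<in> minors k A" for k d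
  proof -
    obtain I J where "J \<subseteq> {..<dim_col A}" "card J = k"
      using d by (rule minorsE)
    then show ?thesis using card_mono[of "{..<dim_col A}" J] by simp
  qed
  then have "S \<subseteq> {..dim_col A}" by (auto simp: S_def)
  then have fin: "finite S" using finite_subset by blast
  have "det (submatrix A {} {}) \<in> minors 0 A" by (auto simp: minors_def intro!: exI[of _ "{}"])
  moreover have "det (submatrix A {} {}) = 1" by (intro det_dim_zero) (auto simp: submatrix_def)
  ultimately have "0 \<in> S" unfolding S_def by force
  then have M: "normal_rank A \<in> S" "\<And>k. k \<in> S \<Longrightarrow> k \<le> normal_rank A"
    unfolding normal_rank_def S_def[symmetric] using fin by (auto intro: Max_in)
  show 1: "\<exists>d\<in>minors (normal_rank A) A. d \<noteq> 0" using M(1) by (simp add: S_def)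
  show "normal_rank A < k \<Longrightarrow> d \<in> minors k A \<Longrightarrow> d = 0" using M(2)[of k] by (force simp: S_def)
  show "normal_rank A \<le> dim_col A" using 1 bound by auto
qed

lemma minors_transpose: "minors k (transpose_mat A) = minors k A"
proof -
  have *: "det (submatrix (transpose_mat A) J I) = det (submatrix A I J)"
    if "I \<subseteq> {..<dim_row A}" "J \<subseteq> {..<dim_col A}" "card I = k" "card J = k" for I J
  proof -
    have "finite I" "finite J" using that finite_subset by auto
    then have "pick I i < dim_row A" "pick J i < dim_col A" if "i < k" for i
      using that \<open>card I = k\<close> \<open>card J = k\<close> pick_in_set_le[of i I] pick_in_set_le[of i J]
        \<open>I \<subseteq> _\<close> \<open>J \<subseteq> _\<close> by auto
    then show ?thesis
      using that fminor_transpose[of k "pick I" A "pick J"]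
      by (simp add: submatrix_pick fminor_def)
  qed
  show ?thesis unfolding minors_def using * by (simp, metis (no_types, lifting))
qed

lemma normal_rank_transpose: "normal_rank (transpose_mat A) = normal_rank A"
  by (simp add: normal_rank_def minors_transpose)

section \<open>Rank and nullity of a polynomial matrix\<close>

definition row_fun :: "'b mat \<Rightarrow> nat \<Rightarrow> nat \<Rightarrow> 'b" where
  "row_fun A i j = A $$ (i, j)"

definition poly_kernel :: "'a::field poly mat \<Rightarrow> (nat \<Rightarrow> 'a poly) set" where
  "poly_kernel A = {x. (\<forall>j\<ge>dim_col A. x j = 0) \<and> (\<forall>i<dim_row A. lin_form (dim_col A) (row_fun A i) x = 0)}"

definition frac_kernel :: "'a::field poly mat \<Rightarrow> (nat \<Rightarrow> 'a poly fract) set" where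
  "frac_kernel A = {y. (\<forall>j\<ge>dim_col A. y j = 0) \<and>
     (\<forall>i<dim_row A. lin_form (dim_col A) (embed (row_fun A i)) y = 0)}"

lemma embed_in_frac_kernel: "embed x \<in> frac_kernel A \<longleftrightarrow> x \<in> poly_kernel A"
  by (simp add: poly_kernel_def frac_kernel_def lin_form_emb) (simp add: embed_def)

lemma subspace_frac_kernel: "vs.subspace (frac_kernel A)"
  by (auto simp: vs.subspace_def frac_kernel_def lin_form_add lin_form_scale_fun)
    (auto simp: scale_fun_def lin_form_def)

lemma clear_denominators:
  assumes "\<And>j. j \<ge> n \<Longrightarrow> y j = (0 :: 'a::field poly fract)"
  obtains d x where "d \<noteq> 0" "embed x = scale_fun (to_fract d) y" "\<And>j. j \<ge> n \<Longrightarrow> x j = 0"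
proof -
  obtain d g where d: "d \<noteq> 0" "\<forall>j\<in>{..<n}. to_fract d * y j = to_fract (g j)"
    using common_denominator[of "{..<n}" y] by blast
  define x where "x j = (if j < n then g j else 0)" for j
  have "embed x = scale_fun (to_fract d) y"
    using d assms by (auto simp: embed_def scale_fun_def x_def fun_eq_iff)
  then show ?thesis using d that[of d x] by (simp add: x_def)
qed

lemma frac_kernel_subset_span:
  assumes "\<And>x. x \<in> poly_kernel A \<Longrightarrow> embed x \<in> vs.span S"
  shows "frac_kernel A \<subseteq> vs.span S"
proof
  fix y assume y: "y \<in> frac_kernel A"
  then have "\<And>j. j \<ge> dim_col A \<Longrightarrow> y j = 0" by (simp add: frac_kernel_def)
  then obtain d x where d: "d \<noteq> 0" "embed x = scale_fun (to_fract d) y"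
    using clear_denominators[of "dim_col A" y] by metis
  have "embed x \<in> frac_kernel A" unfolding d(2) using vs.subspace_scale[OF subspace_frac_kernel y] .
  then have "scale_fun (1 / to_fract d) (embed x) \<in> vs.span S"
    unfolding embed_in_frac_kernel by (intro vs.span_scale assms)
  moreover have "scale_fun (1 / to_fract d) (embed x) = y"
    using d(1) unfolding d(2) by (simp add: scale_fun_def)
  ultimately show "y \<in> vs.span S" by simp
qed

text \<open>
  Let \<open>k\<close> be the rank. The bordered minors of a nonzero minor of order \<open>k\<close> vanish, so all rows depend on the
  \<open>k\<close> rows of the minor, whence the kernel has codimension at most \<open>k\<close>. A kernel vector that is zero
  outside the \<open>k\<close> columns of the minor is zero, so the kernel has dimension at most \<open>n - k\<close>.
\<close>
lemma nullity:
  fixes A :: "'a::field poly mat"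
  assumes B: "B \<subseteq> poly_kernel A" "vs.independent (embed ` B)" "finite B"
    and span: "\<And>x. x \<in> poly_kernel A \<Longrightarrow> embed x \<in> vs.span (embed ` B)"
  shows "card B + normal_rank A = dim_col A"
proof -
  define n where "n = dim_col A"
  define k where "k = normal_rank A"
  obtain d where "d \<in> minors k A" "d \<noteq> 0" using normal_rank_props(1)[of A] unfolding k_def by blast
  then obtain f g where fg: "fminor A k f g \<noteq> 0" "f ` {..<k} \<subseteq> {..<dim_row A}" "g ` {..<k} \<subseteq> {..<n}"
    "inj_on f {..<k}" "inj_on g {..<k}" by (auto elim!: minor_obtains simp: n_def)
  obtain c where c: "\<forall>i<dim_row A. \<forall>j<n. fminor A (Suc k) (f(k := i)) (g(k := j)) =
       fminor A k f g * A $$ (i, j) + (\<Sum>l<k. c l i * A $$ (f l, j))"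
    using bordered_minor[OF fg(2) fg(3)[unfolded n_def]] unfolding n_def by (elim exE conjE)
  have big0: "fminor A (Suc k) f' g' = 0"
    if "f' ` {..<Suc k} \<subseteq> {..<dim_row A}" "g' ` {..<Suc k} \<subseteq> {..<dim_col A}" for f' g'
  proof -
    have "0 dvd fminor A (Suc k) f' g'"
      using normal_rank_props(2)[of A "Suc k"] by (intro dvd_fminor that) (simp add: k_def)
    then show ?thesis by simp
  qed
  have dep: "fminor A k f g * A $$ (i, j) = - (\<Sum>l<k. c l i * A $$ (f l, j))"
    if "i < dim_row A" "j < n" for i j
  proof -
    have "fminor A (Suc k) (f(k := i)) (g(k := j)) = 0"
      using fg(2,3) that by (intro big0) (auto simp: lessThan_Suc n_def)
    then show ?thesis using c that by (simp add: eq_neg_iff_add_eq_0)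
  qed
  have fl: "f l < dim_row A" if "l < k" for l using fg(2) that by auto
  define U where "U = {y :: nat \<Rightarrow> 'a poly fract. \<forall>j\<ge>n. y j = 0}"
  have subU: "vs.subspace U" by (auto simp: U_def vs.subspace_def scale_fun_def)
  have rows: "{y \<in> U. \<forall>l\<in>{..<k}. lin_form n (embed (row_fun A (f l))) y = 0} \<subseteq> frac_kernel A"
  proof
    fix y assume y: "y \<in> {y \<in> U. \<forall>l\<in>{..<k}. lin_form n (embed (row_fun A (f l))) y = 0}"
    have "lin_form n (embed (row_fun A i)) y = 0" if i: "i < dim_row A" for i
    proof -
      have "to_fract (fminor A k f g) * lin_form n (embed (row_fun A i)) y =
          (\<Sum>j<n. to_fract (fminor A k f g * A $$ (i, j)) * y j)"
        by (simp add: lin_form_def sum_distrib_left embed_def row_fun_def to_fract_mult mult.assoc)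
      also have "\<dots> = (\<Sum>j<n. \<Sum>l<k. - to_fract (c l i) * (to_fract (A $$ (f l, j)) * y j))"
        using dep[OF i] by (intro sum.cong refl)
          (simp add: to_fract_uminus sum_negf sum_distrib_right mult.assoc)
      also have "\<dots> = (\<Sum>l<k. \<Sum>j<n. - to_fract (c l i) * (to_fract (A $$ (f l, j)) * y j))"
        by (rule sum.swap)
      also have "\<dots> = (\<Sum>l<k. - to_fract (c l i) * lin_form n (embed (row_fun A (f l))) y)"
        by (simp add: lin_form_def sum_distrib_left embed_def row_fun_def)
      also have "\<dots> = 0" using y by simp
      finally show ?thesis using fg(1) by simp
    qed
    then show "y \<in> frac_kernel A" using y by (simp add: frac_kernel_def U_def n_def)
  qed
  have finB: "finite (embed ` B)" using B by simp
  have KB: "frac_kernel A \<subseteq> vs.span (embed ` B)" by (rule frac_kernel_subset_span[OF span])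
  have "n \<le> card B + k"
  proof -
    have "\<exists>D. finite D \<and> card D \<le> card {..<k} \<and> U \<subseteq> vs.span (embed ` B \<union> D)"
    proof (rule vs.span_of_common_kernel[where f = "\<lambda>l. lin_form n (embed (row_fun A (f l)))"])
      show "{y \<in> U. \<forall>l\<in>{..<k}. lin_form n (embed (row_fun A (f l))) y = 0} \<subseteq> vs.span (embed ` B)"
        using rows KB by (rule order_trans)
    qed (use subU in \<open>simp_all add: lin_form_add lin_form_scale_fun\<close>)
    then obtain D where D: "finite D" "card D \<le> k" "U \<subseteq> vs.span (embed ` B \<union> D)" by auto
    define e :: "nat \<Rightarrow> nat \<Rightarrow> 'a poly fract" where "e j = (\<lambda>i. if i = j then 1 else 0)" for j
    have "\<forall>p\<in>{..<n}. u p = 0" if "(\<Sum>p\<in>{..<n}. scale_fun (u p) (e p)) = 0" for u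
    proof
      fix p assume p: "p \<in> {..<n}"
      have "(\<Sum>q\<in>{..<n}. if p = q then u q else 0) = 0"
        using fun_cong[OF that, of p] by (simp add: sum_fun_apply scale_fun_def e_def if_distrib cong: if_cong)
      then show "u p = 0" using p by simp
    qed
    then have e: "inj_on e {..<n}" "vs.independent (e ` {..<n})"
      using vs.independent_family[of "{..<n}" e] by blast+
    have "e ` {..<n} \<subseteq> vs.span (embed ` B \<union> D)" using D(3) by (auto simp: U_def e_def)
    then have "card (e ` {..<n}) \<le> card (embed ` B \<union> D)"
      using vs.independent_span_bound[OF _ e(2)] finB D(1) by blast
    also have "\<dots> \<le> card B + k" using card_Un_le[of "embed ` B" D] D(2) by (simp add: card_emb)
    finally show ?thesis by (simp add: card_image[OF e(1)])
  qed
  moreover have "card B \<le> n - k"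
  proof -
    have "\<exists>D. finite D \<and> card D \<le> card ({..<n} - g ` {..<k}) \<and> frac_kernel A \<subseteq> vs.span ({} \<union> D)"
    proof (rule vs.span_of_common_kernel[where f = "\<lambda>l y. y l"])
      show "{y \<in> frac_kernel A. \<forall>l\<in>{..<n} - g ` {..<k}. y l = 0} \<subseteq> vs.span {}"
      proof
        fix y assume "y \<in> {y \<in> frac_kernel A. \<forall>l\<in>{..<n} - g ` {..<k}. y l = 0}"
        then have y: "y \<in> frac_kernel A" "\<And>l. l < n \<Longrightarrow> l \<notin> g ` {..<k} \<Longrightarrow> y l = 0"
          "\<And>j. j \<ge> n \<Longrightarrow> y j = 0"
          by (auto simp: frac_kernel_def n_def)
        obtain d x where d: "d \<noteq> 0" "embed x = scale_fun (to_fract d) y"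
          using clear_denominators[of n y] y(3) by metis
        have "embed x \<in> frac_kernel A" unfolding d(2) by (rule vs.subspace_scale[OF subspace_frac_kernel y(1)])
        then have x: "x \<in> poly_kernel A" by (simp add: embed_in_frac_kernel)
        have x0: "x l = 0" if "l \<notin> g ` {..<k}" for l
        proof -
          have "y l = 0" using y that by (cases "l < n") auto
          then have "to_fract (x l) = 0" using fun_cong[OF d(2), of l] by (simp add: embed_def scale_fun_def)
          then show ?thesis by simp
        qed
        define M where "M = mat k k (\<lambda>(i, j). A $$ (f i, g j))"
        define z where "z = vec k (x \<circ> g)"
        have "M *\<^sub>v z = 0\<^sub>v k"
        proof (rule eq_vecI)
          fix i assume "i < dim_vec (0\<^sub>v k :: 'a poly vec)"
          then have i: "i < k" by simp
          have "(M *\<^sub>v z) $ i = (\<Sum>l<k. A $$ (f i, g l) * x (g l))"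
            using i by (simp add: M_def z_def scalar_prod_def atLeast0LessThan)
          also have "\<dots> = (\<Sum>j\<in>g ` {..<k}. A $$ (f i, j) * x j)" by (simp add: sum.reindex[OF fg(5)])
          also have "\<dots> = (\<Sum>j<n. A $$ (f i, j) * x j)"
            using fg(3) x0 by (intro sum.mono_neutral_left) auto
          also have "\<dots> = 0" using x fl[OF i] by (simp add: poly_kernel_def lin_form_def row_fun_def n_def)
          finally show "(M *\<^sub>v z) $ i = 0\<^sub>v k $ i" using i by simp
        qed (simp add: M_def)
        moreover have "det M \<noteq> 0" using fg(1) by (simp add: M_def fminor_def)
        moreover have "M \<in> carrier_mat k k" "z \<in> carrier_vec k" by (simp_all add: M_def z_def)
        ultimately have "z = 0\<^sub>v k" using det_0_iff_vec_prod_zero[of M k] by blast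
        then have "x (g l) = 0" if "l < k" for l using that by (auto simp: z_def vec_eq_iff)
        then have "x l = 0" for l using x0[of l] by (cases "l \<in> g ` {..<k}") auto
        then have "x = (\<lambda>_. 0)" by (rule ext)
        then have "scale_fun (to_fract d) y = 0" using d(2) by (simp add: embed_def zero_fun_def)
        then have "y = 0" using d(1) by (metis vs.scale_eq_0_iff to_fract_eq_0_iff)
        then show "y \<in> vs.span {}" by simp
      qed
    qed (use subspace_frac_kernel in \<open>simp_all add: scale_fun_def\<close>)
    then obtain D where D: "finite D" "card D \<le> card ({..<n} - g ` {..<k})" "frac_kernel A \<subseteq> vs.span D"
      by auto
    have "embed ` B \<subseteq> vs.span D" using B(1) D(3) embed_in_frac_kernel by blast
    then have "card B \<le> card D" using vs.independent_span_bound[OF D(1) B(2)] by (simp add: card_emb)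
    also have "\<dots> \<le> n - k" using D(2) fg(3,5) by (simp add: card_Diff_subset card_image)
    finally show ?thesis .
  qed
  moreover have "k \<le> n" unfolding k_def n_def by (rule normal_rank_props)
  ultimately show ?thesis by (simp add: n_def k_def)
qed

section \<open>Null bases as sets of functions\<close>

definition fun_of_vec :: "'b::zero vec \<Rightarrow> nat \<Rightarrow> 'b" where
  "fun_of_vec v j = (if j < dim_vec v then v $ j else 0)"

lemma fun_of_vec_inj: "v \<in> carrier_vec n \<Longrightarrow> w \<in> carrier_vec n \<Longrightarrow> fun_of_vec v = fun_of_vec w \<Longrightarrow> v = w"
  by (intro eq_vecI) (auto simp: fun_of_vec_def fun_eq_iff split: if_splits)

lemma fun_of_vec_map_vec: "fun_of_vec (map_vec to_fract b) = embed (fun_of_vec b)"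
  by (auto simp: fun_of_vec_def embed_def fun_eq_iff)

lemma mat_kernel_iff:
  assumes A: "A \<in> carrier_mat m n" and v: "v \<in> carrier_vec n"
  shows "v \<in> mat_kernel (map_mat to_fract A) \<longleftrightarrow> fun_of_vec v \<in> frac_kernel A"
proof -
  have "(map_mat to_fract A *\<^sub>v v) $ i = lin_form n (embed (row_fun A i)) (fun_of_vec v)" if "i < m" for i
    using A v that
    by (auto simp: scalar_prod_def lin_form_def embed_def row_fun_def fun_of_vec_def atLeast0LessThan intro!: sum.cong)
  then have "map_mat to_fract A *\<^sub>v v = 0\<^sub>v m \<longleftrightarrow> (\<forall>i<m. lin_form n (embed (row_fun A i)) (fun_of_vec v) = 0)"
    using A by (auto simp: vec_eq_iff)
  then show ?thesis using A v by (auto simp: mat_kernel_def frac_kernel_def fun_of_vec_def)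
qed

lemma null_basis_iff:
  fixes A :: "'a::field poly mat"
  assumes A: "A \<in> carrier_mat m n"
  shows "polynomial_null_basis A B \<longleftrightarrow> B \<subseteq> carrier_vec n \<and> fun_of_vec ` B \<subseteq> poly_kernel A \<and>
     vs.independent (embed ` fun_of_vec ` B) \<and> (\<forall>x\<in>poly_kernel A. embed x \<in> vs.span (embed ` fun_of_vec ` B))"
proof -
  define A' where "A' = map_mat to_fract A"
  define S where "S = map_vec to_fract ` B"
  have A': "A' \<in> carrier_mat m n" using A by (simp add: A'_def)
  interpret K: kernel m n A' by unfold_locales (rule A')
  have kerD: "v \<in> carrier_vec n" if "v \<in> mat_kernel A'" for v
    using that A' by (auto simp: mat_kernel_def)
  have SB: "fun_of_vec ` S = embed ` fun_of_vec ` B" by (auto simp: S_def image_image fun_of_vec_map_vec)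
  have comb: "fun_of_vec (K.lincomb a T) = (\<Sum>v\<in>T. scale_fun (a v) (fun_of_vec v))"
    if "T \<subseteq> mat_kernel A'" "finite T" for a T
  proof
    fix j
    have closed: "K.lincomb a T \<in> mat_kernel A'" using K.Ker.lincomb_closed that by auto
    have dim: "dim_vec v = n" if "v \<in> mat_kernel A'" for v using kerD that by auto
    have dimT: "dim_vec v = n" if "v \<in> T" for v using dim \<open>T \<subseteq> _\<close> that by blast
    show "fun_of_vec (K.lincomb a T) j = (\<Sum>v\<in>T. scale_fun (a v) (fun_of_vec v)) j"
    proof (cases "j < n")
      case True
      then show ?thesis using K.lincomb_index[OF True that(1), of a] dim[OF closed] dimT
        by (simp add: fun_of_vec_def sum_fun_apply scale_fun_def)
    next
      case False
      then show ?thesis using dim[OF closed] dimT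
        by (simp add: fun_of_vec_def sum_fun_apply scale_fun_def)
    qed
  qed
  have inj: "inj_on fun_of_vec T" if "T \<subseteq> mat_kernel A'" for T
    using that kerD fun_of_vec_inj by (intro inj_onI) blast
  have dep: "K.lin_dep S \<longleftrightarrow> vs.dependent (fun_of_vec ` S)" if S: "S \<subseteq> mat_kernel A'"
  proof
    assume "K.lin_dep S"
    then obtain T a v where T: "finite T" "T \<subseteq> S" "K.lincomb a T = 0\<^sub>v n" "v \<in> T" "a v \<noteq> 0"
      unfolding K.Ker.lin_dep_def by auto
    then have T': "T \<subseteq> mat_kernel A'" using S by blast
    define u where "u y = a (the_inv_into T fun_of_vec y)" for y
    have u: "u (fun_of_vec v) = a v" if "v \<in> T" for v
      using that by (simp add: u_def the_inv_into_f_f[OF inj[OF T']])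
    have "(\<Sum>y\<in>fun_of_vec ` T. scale_fun (u y) y) = fun_of_vec (K.lincomb a T)"
      unfolding comb[OF T' T(1)] using u by (simp add: sum.reindex[OF inj[OF T']])
    also have "\<dots> = 0" unfolding T(3) by (auto simp: fun_of_vec_def)
    finally have "(\<Sum>y\<in>fun_of_vec ` T. scale_fun (u y) y) = 0" .
    moreover have "fun_of_vec v \<in> fun_of_vec ` T" "u (fun_of_vec v) \<noteq> 0" using T u by auto
    ultimately have "vs.dependent (fun_of_vec ` T)"
      unfolding vs.dependent_finite[OF finite_imageI[OF T(1)]] by blast
    then show "vs.dependent (fun_of_vec ` S)" using vs.dependent_mono T(2) by blast
  next
    assume "vs.dependent (fun_of_vec ` S)"
    then obtain Y u y where Y: "finite Y" "Y \<subseteq> fun_of_vec ` S" "(\<Sum>y\<in>Y. scale_fun (u y) y) = 0" "y \<in> Y" "u y \<noteq> 0"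
      unfolding vs.dependent_explicit by auto
    from finite_subset_image[OF Y(1,2)] obtain T where T: "T \<subseteq> S" "finite T" "Y = fun_of_vec ` T" by blast
    then have T': "T \<subseteq> mat_kernel A'" using S by blast
    have "fun_of_vec (K.lincomb (u \<circ> fun_of_vec) T) = 0"
      unfolding comb[OF T' T(2)] using Y(3) T(3) by (simp add: sum.reindex[OF inj[OF T']])
    moreover have "fun_of_vec (0\<^sub>v n :: 'a poly fract vec) = 0" by (auto simp: fun_of_vec_def)
    moreover have "K.lincomb (u \<circ> fun_of_vec) T \<in> carrier_vec n"
      using K.Ker.lincomb_closed T' by (intro kerD) auto
    ultimately have "K.lincomb (u \<circ> fun_of_vec) T = 0\<^sub>v n" by (intro fun_of_vec_inj[of _ n]) auto
    moreover obtain v where "v \<in> T" "y = fun_of_vec v" using Y(4) T(3) by blast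
    ultimately show "K.lin_dep S"
      unfolding K.Ker.lin_dep_def using T Y(5)
      by (intro exI[of _ T] exI[of _ "u \<circ> fun_of_vec"] exI[of _ v]) auto
  qed
  have spanS: "v \<in> K.span S \<longleftrightarrow> fun_of_vec v \<in> vs.span (fun_of_vec ` S)"
    if S: "S \<subseteq> mat_kernel A'" and v: "v \<in> carrier_vec n" for v
  proof
    assume "v \<in> K.span S"
    then obtain T a where T: "finite T" "T \<subseteq> S" "v = K.lincomb a T" unfolding K.Ker.span_def by auto
    show "fun_of_vec v \<in> vs.span (fun_of_vec ` S)"
      unfolding T(3) comb[OF order_trans[OF T(2) S] T(1)]
      using T(2) by (intro vs.span_sum vs.span_scale vs.span_base) auto
  next
    assume "fun_of_vec v \<in> vs.span (fun_of_vec ` S)"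
    then obtain Y u where Y: "finite Y" "Y \<subseteq> fun_of_vec ` S" "fun_of_vec v = (\<Sum>y\<in>Y. scale_fun (u y) y)"
      unfolding vs.span_explicit by auto
    from finite_subset_image[OF Y(1,2)] obtain T where T: "T \<subseteq> S" "finite T" "Y = fun_of_vec ` T" by blast
    then have T': "T \<subseteq> mat_kernel A'" using S by blast
    have "fun_of_vec (K.lincomb (u \<circ> fun_of_vec) T) = fun_of_vec v"
      unfolding comb[OF T' T(2)] using Y(3) T(3) by (simp add: sum.reindex[OF inj[OF T']])
    moreover have "K.lincomb (u \<circ> fun_of_vec) T \<in> carrier_vec n"
      using K.Ker.lincomb_closed T' by (intro kerD) auto
    ultimately have "v = K.lincomb (u \<circ> fun_of_vec) T" using v by (intro fun_of_vec_inj[of _ n]) auto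
    then show "v \<in> K.span S" unfolding K.Ker.span_def using T by auto
  qed
  have sub: "S \<subseteq> mat_kernel A' \<longleftrightarrow> B \<subseteq> carrier_vec n \<and> fun_of_vec ` B \<subseteq> poly_kernel A"
  proof -
    have "map_vec to_fract b \<in> mat_kernel A' \<longleftrightarrow> b \<in> carrier_vec n \<and> fun_of_vec b \<in> poly_kernel A" for b
    proof (cases "b \<in> carrier_vec n")
      case True
      then show ?thesis
        using mat_kernel_iff[OF A, of "map_vec to_fract b"]
        by (simp add: A'_def fun_of_vec_map_vec embed_in_frac_kernel)
    next
      case False
      then show ?thesis using kerD[of "map_vec to_fract b"] by auto
    qed
    then show ?thesis unfolding S_def by blast
  qed
  have gen: "K.gen_set S \<longleftrightarrow> (\<forall>x\<in>poly_kernel A. embed x \<in> vs.span (fun_of_vec ` S))"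
    if S: "S \<subseteq> mat_kernel A'"
  proof
    assume g: "K.gen_set S"
    show "\<forall>x\<in>poly_kernel A. embed x \<in> vs.span (fun_of_vec ` S)"
    proof
      fix x assume x: "x \<in> poly_kernel A"
      have v: "fun_of_vec (vec n (embed x)) = embed x"
        using x A by (auto simp: fun_of_vec_def embed_def poly_kernel_def fun_eq_iff)
      have "vec n (embed x) \<in> mat_kernel A'"
        using x mat_kernel_iff[OF A, of "vec n (embed x)"] unfolding A'_def v embed_in_frac_kernel by simp
      then have "vec n (embed x) \<in> K.span S" using g by simp
      then show "embed x \<in> vs.span (fun_of_vec ` S)" using spanS[OF S, of "vec n (embed x)"] v by simp
    qed
  next
    assume all: "\<forall>x\<in>poly_kernel A. embed x \<in> vs.span (fun_of_vec ` S)"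
    have "K.span S \<subseteq> mat_kernel A'"
      unfolding K.Ker.span_def using K.Ker.lincomb_closed S by auto
    moreover have "mat_kernel A' \<subseteq> K.span S"
    proof
      fix v assume v: "v \<in> mat_kernel A'"
      then have "fun_of_vec v \<in> frac_kernel A" using mat_kernel_iff[OF A kerD[OF v]] by (simp add: A'_def)
      then have "fun_of_vec v \<in> vs.span (fun_of_vec ` S)" using frac_kernel_subset_span[of A "fun_of_vec ` S"] all by blast
      then show "v \<in> K.span S" using spanS[OF S kerD[OF v]] by simp
    qed
    ultimately show "K.gen_set S" by simp
  qed
  have "polynomial_null_basis A B \<longleftrightarrow> K.basis S"
    using A by (simp add: polynomial_null_basis_def S_def A'_def)
  also have "\<dots> \<longleftrightarrow> S \<subseteq> mat_kernel A' \<and> \<not> K.lin_dep S \<and> K.gen_set S"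
    unfolding K.Ker.basis_def by auto
  also have "\<dots> \<longleftrightarrow> S \<subseteq> mat_kernel A' \<and> vs.independent (fun_of_vec ` S) \<and>
      (\<forall>x\<in>poly_kernel A. embed x \<in> vs.span (fun_of_vec ` S))"
    using dep gen by blast
  finally show ?thesis unfolding sub SB by blast
qed

section \<open>Minimal indices and the Brunovsky partition\<close>

lemma fun_of_vec_of_vec: "(\<And>j. j \<ge> n \<Longrightarrow> x j = 0) \<Longrightarrow> fun_of_vec (vec n x) = x"
  by (auto simp: fun_of_vec_def fun_eq_iff)

lemma poly_kernel_support: "x \<in> poly_kernel A \<Longrightarrow> j \<ge> dim_col A \<Longrightarrow> x j = 0"
  by (simp add: poly_kernel_def)

lemma poly_kernel_scale: "x \<in> poly_kernel A \<Longrightarrow> (\<lambda>j. c * x j) \<in> poly_kernel A"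
  by (auto simp: poly_kernel_def lin_form_def sum_distrib_left[symmetric] mult.left_commute[of _ c])

lemma subspace_poly_kernel: "pvs.subspace (poly_kernel A)"
  by (auto simp: pvs.subspace_def poly_kernel_def lin_form_add lin_form_scale_poly_fun)
    (auto simp: scale_poly_fun_def lin_form_def)

lemma finite_null_basis:
  fixes A :: "'a::field poly mat"
  assumes A: "A \<in> carrier_mat m n" and B: "polynomial_null_basis A B"
  shows "finite B"
proof -
  define U where "U = {y :: nat \<Rightarrow> 'a poly fract. \<forall>j\<ge>n. y j = 0}"
  have "\<exists>D. finite D \<and> card D \<le> card {..<n} \<and> U \<subseteq> vs.span ({} \<union> D)"
  proof (rule vs.span_of_common_kernel[where f = "\<lambda>l y. y l"])
    show "{x \<in> U. \<forall>l\<in>{..<n}. x l = 0} \<subseteq> vs.span {}"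
    proof clarify
      fix y assume "y \<in> U" "\<forall>l\<in>{..<n}. y l = 0"
      then have "y j = 0" for j by (cases "j < n") (auto simp: U_def)
      then have "y = 0" by (intro ext) simp
      then show "y \<in> vs.span {}" by simp
    qed
  qed (auto simp: U_def vs.subspace_def scale_fun_def)
  then obtain D where D: "finite D" "U \<subseteq> vs.span D" by auto
  have "embed ` fun_of_vec ` B \<subseteq> U"
    using B A poly_kernel_support[of _ A] unfolding null_basis_iff[OF A] U_def by (auto simp: embed_def)
  then have "finite (embed ` fun_of_vec ` B)"
    using vs.independent_span_bound[OF D(1), of "embed ` fun_of_vec ` B"] D(2) B unfolding null_basis_iff[OF A] by blast
  then have "finite (fun_of_vec ` B)" using embed_inj by (rule finite_imageD[OF _ inj_on_subset]) simp
  moreover have "inj_on fun_of_vec B"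
    using B fun_of_vec_inj unfolding null_basis_iff[OF A] by (intro inj_onI) blast
  ultimately show ?thesis by (rule finite_imageD)
qed

text \<open>
  A maximal independent set of polynomial null vectors spans the null space, since every null vector is a
  scalar multiple of a polynomial one.
\<close>
lemma minimal_null_basis_exists:
  fixes A :: "'a::field poly mat"
  assumes A: "A \<in> carrier_mat m n"
  shows "\<exists>B. minimal_null_basis A B"
proof -
  obtain C where C: "C \<subseteq> embed ` poly_kernel A" "vs.independent C" "embed ` poly_kernel A \<subseteq> vs.span C"
    by (rule vs.maximal_independent_subset)
  obtain X where X: "X \<subseteq> poly_kernel A" "C = embed ` X" using C(1) by (auto simp: subset_image_iff)
  have "fun_of_vec (vec n x) = x" if "x \<in> X" for x
    using A X(1) that poly_kernel_support[of x A] by (intro fun_of_vec_of_vec) auto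
  then have "fun_of_vec ` vec n ` X = X" by (force simp: image_image)
  then have "polynomial_null_basis A (vec n ` X)"
    unfolding null_basis_iff[OF A] using X C by auto
  from ex_has_least_nat[of "polynomial_null_basis A", OF this, of "\<lambda>B. \<Sum>b\<in>B. vec_degree b"]
  show ?thesis by (auto simp: minimal_null_basis_def is_arg_min_def not_less)
qed

lemma vec_degree_le_iff: "vec_degree (b :: 'a::zero poly vec) \<le> i \<longleftrightarrow> degree_below (Suc i) (fun_of_vec b)"
proof -
  have "vec_degree b \<le> i \<longleftrightarrow> (\<forall>j<dim_vec b. degree (b $ j) \<le> i)"
    unfolding vec_degree_def by (subst Max_le_iff) auto
  also have "\<dots> \<longleftrightarrow> (\<forall>j<dim_vec b. \<forall>l\<ge>Suc i. coeff (b $ j) l = 0)"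
  proof -
    have "degree p \<le> i \<longleftrightarrow> (\<forall>l\<ge>Suc i. coeff p l = 0)" for p :: "'a poly"
      by (auto simp: Suc_le_eq intro: degree_le coeff_eq_0)
    then show ?thesis by simp
  qed
  also have "\<dots> \<longleftrightarrow> degree_below (Suc i) (fun_of_vec b)" by (auto simp: degree_below_def fun_of_vec_def)
  finally show ?thesis .
qed

text \<open>
  Exchange argument. Otherwise the combination that represents \<open>x\<close> involves a basis vector \<open>b\<close> of degree
  greater than \<open>i\<close>, and replacing \<open>b\<close> by \<open>x\<close> gives a polynomial basis of smaller order.
\<close>
lemma minimal_null_basis_span:
  fixes A :: "'a::field poly mat"
  assumes A: "A \<in> carrier_mat m n" and B: "minimal_null_basis A B"
    and x: "x \<in> poly_kernel A" "degree_below (Suc i) x"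
  shows "embed x \<in> vs.span (embed ` {b \<in> fun_of_vec ` B. degree_below (Suc i) b})"
proof (rule ccontr)
  define G where "G = {b \<in> fun_of_vec ` B. degree_below (Suc i) b}"
  assume "embed x \<notin> vs.span (embed ` {b \<in> fun_of_vec ` B. degree_below (Suc i) b})"
  then have nG: "embed x \<notin> vs.span (embed ` G)" by (simp add: G_def)
  have pB: "polynomial_null_basis A B"
    and least: "\<And>B'. polynomial_null_basis A B' \<Longrightarrow> (\<Sum>b\<in>B. vec_degree b) \<le> (\<Sum>b\<in>B'. vec_degree b)"
    using B by (auto simp: minimal_null_basis_def is_arg_min_def not_less)
  have finB: "finite B" by (rule finite_null_basis[OF A pB])
  note nb = pB[unfolded null_basis_iff[OF A]]
  define F where "F = fun_of_vec ` B"
  have F: "finite F" "F \<subseteq> poly_kernel A" "vs.independent (embed ` F)"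
    "\<And>z. z \<in> poly_kernel A \<Longrightarrow> embed z \<in> vs.span (embed ` F)"
    using finB nb by (auto simp: F_def)
  \<comment> \<open>A smallest set between \<open>G\<close> and the basis whose span contains \<open>x\<close> exceeds \<open>G\<close>, and any of its elements
    outside \<open>G\<close> can be exchanged for \<open>x\<close>.\<close>
  define good where "good S \<longleftrightarrow> G \<subseteq> S \<and> S \<subseteq> F \<and> embed x \<in> vs.span (embed ` S)" for S
  have "good F" using F(4)[OF x(1)] by (auto simp: good_def G_def F_def)
  from ex_has_least_nat[of good, OF this, of card]
  obtain S where S: "good S" "\<And>T. good T \<Longrightarrow> card S \<le> card T" by blast
  have finS: "finite S" using S(1) F(1) finite_subset by (auto simp: good_def)
  have "S \<noteq> G" using S(1) nG by (auto simp: good_def)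
  then obtain b where b: "b \<in> S" "b \<notin> G" using S(1) by (auto simp: good_def)
  have bF: "b \<in> F" using b S(1) by (auto simp: good_def)
  define R where "R = F - {b}"
  have "\<not> good (S - {b})"
    using S(2)[of "S - {b}"] b(1) finS card_Diff1_less[of S b] by fastforce
  then have nS: "embed x \<notin> vs.span (embed ` (S - {b}))" using S(1) b(2) by (auto simp: good_def)
  have "embed x \<in> vs.span (insert (embed b) (embed ` (S - {b})))"
  proof -
    have "embed ` S = insert (embed b) (embed ` (S - {b}))" using b(1) by auto
    then show ?thesis using S(1) by (simp add: good_def)
  qed
  then have "embed b \<in> vs.span (insert (embed x) (embed ` (S - {b})))"
    using nS by (rule vs.in_span_insert)
  moreover have "insert (embed x) (embed ` (S - {b})) \<subseteq> insert (embed x) (embed ` R)"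
    using S(1) by (auto simp: good_def R_def)
  ultimately have bx: "embed b \<in> vs.span (insert (embed x) (embed ` R))"
    using vs.span_mono by blast
  have FR: "embed ` F = insert (embed b) (embed ` R)" using bF by (auto simp: R_def)
  have "embed b \<notin> embed ` R" using injD[OF embed_inj] by (auto simp: R_def)
  then have nb: "embed b \<notin> vs.span (embed ` R)" and indR: "vs.independent (embed ` R)"
    using F(3) unfolding FR vs.independent_insert by simp_all
  have nx: "embed x \<notin> vs.span (embed ` R)"
  proof
    assume "embed x \<in> vs.span (embed ` R)"
    then have "vs.span (insert (embed x) (embed ` R)) = vs.span (embed ` R)" by (rule vs.span_redundant)
    then show False using bx nb by simp
  qed
  obtain v where v: "v \<in> B" "fun_of_vec v = b" using bF by (auto simp: F_def)
  define B' where "B' = insert (vec n x) (B - {v})"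
  have vx: "fun_of_vec (vec n x) = x" using A x(1) poly_kernel_support[of x A] by (intro fun_of_vec_of_vec) auto
  have carB: "B \<subseteq> carrier_vec n" using pB[unfolded null_basis_iff[OF A]] by blast
  have imR: "fun_of_vec ` (B - {v}) = R"
  proof
    show "R \<subseteq> fun_of_vec ` (B - {v})" using v by (auto simp: R_def F_def)
    show "fun_of_vec ` (B - {v}) \<subseteq> R" using v fun_of_vec_inj carB unfolding R_def F_def by blast
  qed
  have im: "fun_of_vec ` B' = insert x R" by (simp add: B'_def vx imR)
  have "polynomial_null_basis A B'"
    unfolding null_basis_iff[OF A] im
  proof (intro conjI ballI)
    show "B' \<subseteq> carrier_vec n" using carB by (auto simp: B'_def)
    show "insert x R \<subseteq> poly_kernel A" using x(1) F(2) by (auto simp: R_def)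
    show "vs.independent (embed ` insert x R)"
      using nx indR by (simp add: vs.independent_insertI)
    have "embed ` F \<subseteq> vs.span (embed ` insert x R)"
      using bx unfolding FR by (auto intro: vs.span_base)
    then have "vs.span (embed ` F) \<subseteq> vs.span (embed ` insert x R)"
      by (rule vs.span_minimal[OF _ vs.subspace_span])
    then show "embed z \<in> vs.span (embed ` insert x R)" if "z \<in> poly_kernel A" for z
      using F(4)[OF that] by blast
  qed
  then have "(\<Sum>b\<in>B. vec_degree b) \<le> (\<Sum>b\<in>B'. vec_degree b)" by (rule least)
  moreover have "vec n x \<notin> B - {v}"
  proof
    assume "vec n x \<in> B - {v}"
    then have "fun_of_vec (vec n x) \<in> R" unfolding imR[symmetric] by (rule imageI)
    then have "embed x \<in> vs.span (embed ` R)" unfolding vx by (intro vs.span_base imageI)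
    then show False using nx by blast
  qed
  then have "(\<Sum>b\<in>B'. vec_degree b) = vec_degree (vec n x) + (\<Sum>b\<in>B - {v}. vec_degree b)"
    using finB by (simp add: B'_def)
  moreover have "(\<Sum>b\<in>B. vec_degree b) = vec_degree v + (\<Sum>b\<in>B - {v}. vec_degree b)"
    using finB v(1) by (rule sum.remove)
  moreover have "vec_degree (vec n x) \<le> i" using x(2) by (simp add: vec_degree_le_iff vx)
  moreover have "\<not> vec_degree v \<le> i"
    using b(2) bF v(2) by (simp add: vec_degree_le_iff G_def F_def)
  ultimately show False by linarith
qed

lemma minimal_basis_of_minimal:
  fixes A :: "'a::field poly mat"
  assumes A: "A \<in> carrier_mat m n" and B: "minimal_null_basis A B"
  shows "minimal_basis (poly_kernel A) (fun_of_vec ` B)"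
proof -
  have pB: "polynomial_null_basis A B"
    using B by (auto simp: minimal_null_basis_def is_arg_min_def)
  note nb = pB[unfolded null_basis_iff[OF A]]
  have low: "embed x \<in> vs.span (embed ` {b \<in> fun_of_vec ` B. degree_below k b})" if "x \<in> poly_kernel A" "degree_below k x" for k x
  proof (cases k)
    case 0
    then have "x = (\<lambda>_. 0)" using that(2) by (auto simp: degree_below_def fun_eq_iff poly_eq_iff)
    then have "embed x = 0" by (simp add: embed_def zero_fun_def)
    then show ?thesis by (simp add: vs.span_zero)
  next
    case (Suc i)
    then show ?thesis using minimal_null_basis_span[OF A B that(1), of i] that(2) by simp
  qed
  have "\<exists>k. degree_below k b" if "b \<in> fun_of_vec ` B" for b
    using that vec_degree_le_iff by blast
  then show ?thesis
    unfolding minimal_basis_def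
    using nb finite_null_basis[OF A pB]
    by (intro conjI allI ballI impI subspace_poly_kernel poly_kernel_scale low) simp_all
qed

lemma conjugate_partition_degrees:
  assumes "finite B"
  shows "conjugate_partition (rev (sorted_list_of_multiset (image_mset vec_degree (mset_set B)))) k =
    card {b \<in> B. k \<le> vec_degree b}"
proof -
  define c where "c = rev (sorted_list_of_multiset (image_mset vec_degree (mset_set B)))"
  have "conjugate_partition c k = length (filter (\<lambda>d. k \<le> d) c)"
    by (simp add: conjugate_partition_def length_filter_conv_card)
  also have "\<dots> = size (filter_mset (\<lambda>d. k \<le> d) (mset c))"
    by (simp flip: size_mset mset_filter)
  also have "\<dots> = size (filter_mset (\<lambda>b. k \<le> vec_degree b) (mset_set B))"
    by (simp add: c_def filter_mset_image_mset)
  also have "\<dots> = card {b \<in> B. k \<le> vec_degree b}" using assms by simp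
  finally show ?thesis by (simp add: c_def)
qed

lemma column_brunovsky_min_basis:
  fixes A :: "'a::field poly mat"
  assumes A: "A \<in> carrier_mat m n"
  obtains B where "minimal_basis (poly_kernel A) B" "card B + normal_rank A = n"
    "column_brunovsky A = brunovsky_of (card B) (count_below B)"
proof -
  define B where "B = (SOME B. minimal_null_basis A B)"
  have B: "minimal_null_basis A B"
    unfolding B_def using minimal_null_basis_exists[OF A] by (rule someI_ex)
  then have pB: "polynomial_null_basis A B" by (auto simp: minimal_null_basis_def is_arg_min_def)
  have finB: "finite B" by (rule finite_null_basis[OF A pB])
  have mb: "minimal_basis (poly_kernel A) (fun_of_vec ` B)" by (rule minimal_basis_of_minimal[OF A B])
  have card: "card (fun_of_vec ` B) + normal_rank A = n"
    using nullity[of "fun_of_vec ` B" A] minimal_basisD[OF mb] A by simp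
  have inj: "inj_on fun_of_vec B"
    using pB fun_of_vec_inj unfolding null_basis_iff[OF A] by (intro inj_onI) blast
  have "conjugate_partition (column_minimal_indices A) (Suc i) =
      card (fun_of_vec ` B) - count_below (fun_of_vec ` B) i" for i
  proof -
    have "{b \<in> fun_of_vec ` B. degree_below (Suc i) b} = fun_of_vec ` {b \<in> B. vec_degree b \<le> i}"
      by (auto simp: vec_degree_le_iff)
    then have cb: "count_below (fun_of_vec ` B) i = card {b \<in> B. vec_degree b \<le> i}"
      unfolding count_below_def using card_image[OF inj_on_subset[OF inj]] by simp
    have "{b \<in> B. Suc i \<le> vec_degree b} = B - {b \<in> B. vec_degree b \<le> i}" by auto
    then have "card {b \<in> B. Suc i \<le> vec_degree b} = card B - card {b \<in> B. vec_degree b \<le> i}"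
      using finB by (simp add: card_Diff_subset)
    then show ?thesis
      unfolding column_minimal_indices_def B_def[symmetric] conjugate_partition_degrees[OF finB]
      by (simp add: cb card_image[OF inj])
  qed
  then have "column_brunovsky A i = brunovsky_of (card (fun_of_vec ` B)) (count_below (fun_of_vec ` B)) i" for i
    using A card by (cases i) (auto simp: column_brunovsky_def brunovsky_of_def)
  then show ?thesis using that[OF mb card] by blast
qed

section \<open>Null modules under a rank one perturbation\<close>

text \<open>
  If \<open>u\<close> is nonzero at \<open>i0\<close>, the null vectors of this matrix are the \<open>x\<close> for which \<open>H x\<close> is a multiple of
  \<open>u\<close>, written as the vanishing of two by two determinants.
\<close>
definition eliminate_row :: "'a::field poly mat \<Rightarrow> 'a mat \<Rightarrow> nat \<Rightarrow> 'a poly mat" where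
  "eliminate_row H u i0 = mat (dim_row H) (dim_col H)
     (\<lambda>(i, j). smult (u $$ (i0, 0)) (H $$ (i, j)) - smult (u $$ (i, 0)) (H $$ (i0, j)))"

lemma poly_kernel_eliminate_row:
  assumes i0: "i0 < dim_row H" "u $$ (i0, 0) \<noteq> 0"
  shows "poly_kernel H = {x \<in> poly_kernel (eliminate_row H u i0). lin_form (dim_col H) (row_fun H i0) x = 0}"
proof -
  define n where "n = dim_col H"
  have "lin_form n (row_fun (eliminate_row H u i0) i) x =
      smult (u $$ (i0, 0)) (lin_form n (row_fun H i) x) - smult (u $$ (i, 0)) (lin_form n (row_fun H i0) x)"
    if "i < dim_row H" for i x
    using that i0 by (intro poly_eqI)
      (simp add: lin_form_def row_fun_def eliminate_row_def n_def coeff_sum left_diff_distrib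
        sum_subtractf sum_distrib_left)
  then show ?thesis
    using i0 unfolding poly_kernel_def n_def[symmetric]
    by (auto simp: eliminate_row_def n_def[symmetric])
qed

definition append_row :: "'a::field poly mat \<Rightarrow> 'a mat \<Rightarrow> 'a poly mat" where
  "append_row G u = mat (Suc (dim_row G)) (dim_col G)
     (\<lambda>(i, j). if i < dim_row G then G $$ (i, j) else [:u $$ (j, 0):])"

lemma poly_kernel_append_row:
  "poly_kernel (append_row G u) =
     {x \<in> poly_kernel G. lin_form (dim_col G) (\<lambda>j. [:u $$ (j, 0):]) x = 0}"
proof -
  define n where "n = dim_col G"
  have "lin_form n (row_fun (append_row G u) i) x =
      (if i < dim_row G then lin_form n (row_fun G i) x else lin_form n (\<lambda>j. [:u $$ (j, 0):]) x)"
    if "i < Suc (dim_row G)" for i x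
    using that by (auto simp: lin_form_def row_fun_def append_row_def n_def)
  then show ?thesis
    unfolding poly_kernel_def n_def[symmetric]
    by (auto simp: append_row_def n_def[symmetric] less_Suc_eq)
qed

locale rank_one_perturbation =
  fixes m n :: nat and H P :: "'a::field poly mat" and u :: "'a mat" and v :: "'a poly mat"
  assumes H: "H \<in> carrier_mat m n" and pencilH: "matrix_pencil H"
    and u: "u \<in> carrier_mat m 1" and v: "v \<in> carrier_mat n 1"
    and P: "P = map_mat (\<lambda>c. [:c:]) u * transpose_mat v" and pencilP: "matrix_pencil P"
begin

lemma P_carrier: "P \<in> carrier_mat m n"
  using u v by (auto simp: P)

lemma P_index: "i < m \<Longrightarrow> j < n \<Longrightarrow> P $$ (i, j) = smult (u $$ (i, 0)) (v $$ (j, 0))"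
  using u v by (simp add: P scalar_prod_def)

lemma HP: "H + P \<in> carrier_mat m n"
  using H P_carrier by simp

lemma HP_index: "i < m \<Longrightarrow> j < n \<Longrightarrow> (H + P) $$ (i, j) = H $$ (i, j) + smult (u $$ (i, 0)) (v $$ (j, 0))"
  using H P_carrier by (simp add: P_index)

lemma pencilHP: "matrix_pencil (H + P)"
proof -
  have "degree (H $$ (i, j) + P $$ (i, j)) \<le> 1" if "i < m" "j < n" for i j
    using pencilH pencilP H P_carrier that by (intro degree_add_le) (auto simp: matrix_pencil_def)
  then show ?thesis using H P_carrier by (auto simp: matrix_pencil_def)
qed

lemma pencil_row_coeff:
  assumes "A \<in> carrier_mat m n" "matrix_pencil A" "i < m" "degree_below k x" "k + 1 \<le> l"
  shows "coeff (lin_form n (row_fun A i) x) l = 0"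
proof -
  have "coeff (A $$ (i, j) * x j) l = 0" if "j < n" for j
  proof -
    have "degree (A $$ (i, j)) \<le> 1" using assms that by (auto simp: matrix_pencil_def)
    have "coeff (A $$ (i, j)) h * coeff (x j) (l - h) = 0" if "h \<le> l" for h
    proof (cases "h \<le> 1")
      case True
      then have "k \<le> l - h" using assms(5) by linarith
      then show ?thesis using assms(4) by (simp add: degree_below_def)
    next
      case False
      then show ?thesis using \<open>degree (A $$ (i, j)) \<le> 1\<close> by (simp add: coeff_eq_0)
    qed
    then show ?thesis by (simp add: coeff_mult)
  qed
  then show ?thesis by (simp add: lin_form_def row_fun_def coeff_sum)
qed

text \<open>
  The common module consists of the \<open>x\<close> with \<open>H x\<close> parallel to \<open>u\<close>. Adding \<open>u v\<^sup>T\<close> to \<open>H\<close> does not change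
  it. The functional is the entry of \<open>H x\<close>, respectively of \<open>(H + P) x\<close>, at a position where \<open>u\<close> is nonzero; it raises
  degrees by at most one because the matrix is a pencil.
\<close>
lemma column_counts:
  "\<exists>q Q p R p' R'. nested_counts 1 q Q p R \<and> nested_counts 1 q Q p' R' \<and>
     p + normal_rank H = n \<and> p' + normal_rank (H + P) = n \<and>
     column_brunovsky H = brunovsky_of p R \<and> column_brunovsky (H + P) = brunovsky_of p' R'"
proof -
  obtain B where B: "minimal_basis (poly_kernel H) B" "card B + normal_rank H = n"
    "column_brunovsky H = brunovsky_of (card B) (count_below B)"
    by (rule column_brunovsky_min_basis[OF H])
  obtain B' where B': "minimal_basis (poly_kernel (H + P)) B'" "card B' + normal_rank (H + P) = n"
    "column_brunovsky (H + P) = brunovsky_of (card B') (count_below B')"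
    by (rule column_brunovsky_min_basis[OF HP])
  have "\<exists>C :: (nat \<Rightarrow> 'a poly) set. nested_counts 1 (card C) (count_below C) (card B) (count_below B) \<and>
      nested_counts 1 (card C) (count_below C) (card B') (count_below B')"
  \<comment> \<open>For \<open>u = 0\<close> there is no position to read off the functional, but then the two pencils are equal.\<close>
  proof (cases "\<forall>i<m. u $$ (i, 0) = 0")
    case True
    then have "H + P = H" using H P_carrier by (intro eq_matI) (auto simp: P_index)
    then have ker: "poly_kernel (H + P) = poly_kernel H" by simp
    have *: "poly_kernel H = {x \<in> poly_kernel H. lin_form 0 (\<lambda>_. 0) x = 0}" by (simp add: lin_form_def)
    have deg: "coeff (lin_form 0 (\<lambda>_. 0) x) l = 0" for x :: "nat \<Rightarrow> 'a poly" and l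
      by (simp add: lin_form_def)
    show ?thesis
    proof (intro exI[of _ B] conjI)
      show "nested_counts 1 (card B) (count_below B) (card B) (count_below B)"
        by (rule nested_counts_of_kernels[OF B(1) B(1) * deg])
      show "nested_counts 1 (card B) (count_below B) (card B') (count_below B')"
        by (rule nested_counts_of_kernels[OF B(1) B'(1)[unfolded ker] * deg])
    qed
  next
    case False
    then obtain i0 where i0: "i0 < m" "u $$ (i0, 0) \<noteq> 0" by blast
    define K where "K = eliminate_row H u i0"
    have K: "K \<in> carrier_mat m n" using H by (simp add: K_def eliminate_row_def)
    have K': "K = eliminate_row (H + P) u i0"
      unfolding K_def eliminate_row_def using H P_carrier i0
      by (intro eq_matI) (auto simp: P_index smult_add_right mult.commute)
    obtain C where C: "minimal_basis (poly_kernel K) C"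
      by (rule column_brunovsky_min_basis[OF K])
    have ker: "poly_kernel H = {x \<in> poly_kernel K. lin_form n (row_fun H i0) x = 0}"
      using poly_kernel_eliminate_row[of i0 H u] i0 H by (simp add: K_def)
    have ker': "poly_kernel (H + P) = {x \<in> poly_kernel K. lin_form n (row_fun (H + P) i0) x = 0}"
      using poly_kernel_eliminate_row[of i0 "H + P" u] i0 carrier_matD[OF HP] by (simp add: K' del: index_add_mat)
    have "nested_counts 1 (card C) (count_below C) (card B) (count_below B)"
      by (rule nested_counts_of_kernels[OF C B(1) ker]) (rule pencil_row_coeff[OF H pencilH i0(1)])
    moreover have "nested_counts 1 (card C) (count_below C) (card B') (count_below B')"
      by (rule nested_counts_of_kernels[OF C B'(1) ker']) (rule pencil_row_coeff[OF HP pencilHP i0(1)])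
    ultimately show ?thesis by blast
  qed
  then show ?thesis using B(2,3) B'(2,3) by blast
qed

text \<open>
  The common module consists of the left null vectors \<open>y\<close> of \<open>H\<close> with \<open>y\<^sup>T u = 0\<close>, which are also the left
  null vectors of \<open>H + P\<close> with this property. The functional has constant coefficients.
\<close>
lemma row_counts:
  "\<exists>q Q p R p' R'. nested_counts 0 p R q Q \<and> nested_counts 0 p' R' q Q \<and>
     p + normal_rank H = m \<and> p' + normal_rank (H + P) = m \<and>
     row_brunovsky H = brunovsky_of p R \<and> row_brunovsky (H + P) = brunovsky_of p' R'"
proof -
  have row_col: "row_brunovsky A = column_brunovsky (transpose_mat A)" for A :: "'a poly mat"
    by (simp add: row_brunovsky_def column_brunovsky_def row_minimal_indices_def
        normal_rank_transpose fun_eq_iff)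
  define G where "G = transpose_mat H"
  define G' where "G' = transpose_mat (H + P)"
  have G: "G \<in> carrier_mat n m" and G': "G' \<in> carrier_mat n m" using H HP by (simp_all add: G_def G'_def)
  obtain B where B: "minimal_basis (poly_kernel G) B" "card B + normal_rank G = m"
    "column_brunovsky G = brunovsky_of (card B) (count_below B)"
    by (rule column_brunovsky_min_basis[OF G])
  obtain B' where B': "minimal_basis (poly_kernel G') B'" "card B' + normal_rank G' = m"
    "column_brunovsky G' = brunovsky_of (card B') (count_below B')"
    by (rule column_brunovsky_min_basis[OF G'])
  define K where "K = append_row G u"
  have K: "K \<in> carrier_mat (Suc n) m" using G by (simp add: K_def append_row_def)
  obtain C where C: "minimal_basis (poly_kernel K) C"
    by (rule column_brunovsky_min_basis[OF K])
  define a where "a j = [:u $$ (j, 0):]" for j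
  have ker: "poly_kernel K = {x \<in> poly_kernel G. lin_form m a x = 0}"
    using poly_kernel_append_row[of G u] G by (simp add: K_def a_def[abs_def])
  have "lin_form m (row_fun G' i) x = lin_form m (row_fun G i) x + v $$ (i, 0) * lin_form m a x"
    if "i < n" for i x
  proof -
    have "G' $$ (i, j) * x j = G $$ (i, j) * x j + v $$ (i, 0) * (a j * x j)" if "j < m" for j
    proof -
      have "G' $$ (i, j) = G $$ (i, j) + smult (u $$ (j, 0)) (v $$ (i, 0))"
        using that \<open>i < n\<close> H HP HP_index[of j i] unfolding G_def G'_def by (simp only: index_transpose_mat carrier_matD)
      then show ?thesis by (simp add: a_def algebra_simps)
    qed
    then show ?thesis
      by (simp add: lin_form_def row_fun_def sum.distrib sum_distrib_left)
  qed
  then have ker': "poly_kernel K = {x \<in> poly_kernel G'. lin_form m a x = 0}"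
    unfolding ker using G G' by (auto simp: poly_kernel_def)
  have deg: "coeff (lin_form m a x) l = 0" if "degree_below k x" "k + 0 \<le> l" for k l x
    using that by (simp add: lin_form_def a_def coeff_sum degree_below_def)
  have "nested_counts 0 (card B) (count_below B) (card C) (count_below C)"
    using nested_counts_of_kernels[OF B(1) C ker deg] .
  moreover have "nested_counts 0 (card B') (count_below B') (card C) (count_below C)"
    using nested_counts_of_kernels[OF B'(1) C ker' deg] .
  ultimately show ?thesis
    using B(2,3) B'(2,3) unfolding row_col G_def G'_def normal_rank_transpose by blast
qed

end

section \<open>Invariant factors and approximation by matrices of low rank\<close>

text \<open>
  A prime element with its order of divisibility. Passing to the local ring at \<open>p\<close> is replaced by
  multiplication with elements that \<open>p\<close> does not divide.
\<close>
locale valuation_prime =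
  fixes p :: "'b::idom"
  assumes prime: "prime_elem p"
    and bounded: "x \<noteq> 0 \<Longrightarrow> \<exists>k. \<not> p ^ k dvd x"
begin

lemma factor_out:
  assumes "x \<noteq> 0"
  obtains d q where "x = p ^ d * q" "\<not> p dvd q"
proof -
  define k where "k = (LEAST k. \<not> p ^ k dvd x)"
  have k: "\<not> p ^ k dvd x" unfolding k_def using bounded[OF assms] by (rule LeastI_ex)
  then obtain d where d: "k = Suc d" by (cases k) auto
  then have "p ^ d dvd x" using not_less_Least[of d "\<lambda>k. \<not> p ^ k dvd x"] by (auto simp: k_def)
  then obtain q where q: "x = p ^ d * q" by (auto elim: dvdE)
  moreover have "\<not> p dvd q" using k by (auto simp: q d)
  ultimately show ?thesis by (rule that)
qed

lemma power_dvd_cancel: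
  assumes "\<not> p dvd q"
  shows "p ^ i dvd q * y \<longleftrightarrow> p ^ i dvd y"
proof
  assume "p ^ i dvd q * y"
  then show "p ^ i dvd y"
  proof (induction i)
    case (Suc i)
    then have "p ^ i dvd q * y" using dvd_trans le_imp_power_dvd by (metis le_SucI order_refl)
    then obtain z where z: "y = p ^ i * z" using Suc.IH by (auto elim: dvdE)
    then have "p ^ i * p dvd p ^ i * (q * z)" using Suc.prems by (simp add: algebra_simps)
    then have "p dvd q * z" using prime by (simp add: prime_elem_def)
    then have "p dvd z" using assms prime by (auto simp: prime_elem_dvd_mult_iff)
    then show ?case by (simp add: z mult_dvd_mono mult.commute)
  qed simp
qed simp

lemma le_exponent_in_iff:
  assumes "x \<noteq> 0"
  shows "i \<le> exponent_in p x \<longleftrightarrow> p ^ i dvd x"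
proof -
  obtain k where k: "\<not> p ^ k dvd x" using bounded[OF assms] by blast
  define S where "S = {k. p ^ k dvd x}"
  have down: "p ^ j dvd x" if "p ^ i dvd x" "j \<le> i" for i j
    using that le_imp_power_dvd dvd_trans by blast
  have "i < k" if "p ^ i dvd x" for i
  proof (rule ccontr)
    assume "\<not> i < k"
    then show False using down[OF that, of k] k by simp
  qed
  then have "S \<subseteq> {..<k}" by (auto simp: S_def)
  then have fin: "finite S" using finite_subset by blast
  have "0 \<in> S" by (simp add: S_def)
  then have "Max S \<in> S" using fin by (intro Max_in) auto
  then have max: "p ^ Max S dvd x" by (simp add: S_def)
  have "i \<le> Max S \<longleftrightarrow> p ^ i dvd x"
  proof
    assume "i \<le> Max S"
    then show "p ^ i dvd x" by (rule down[OF max])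
  next
    assume "p ^ i dvd x"
    then have "i \<in> S" by (simp add: S_def)
    then show "i \<le> Max S" using fin by (intro Max_ge)
  qed
  then show ?thesis by (simp only: exponent_in_def S_def)
qed

text \<open>
  In the local ring at \<open>p\<close>, the matrix is congruent modulo \<open>p\<^sup>i\<close> to a product through dimension \<open>a\<close>.
\<close>
definition approximable :: "'b mat \<Rightarrow> nat \<Rightarrow> nat \<Rightarrow> bool" where
  "approximable A i a \<longleftrightarrow> (\<exists>g X Y Z. \<not> p dvd g \<and> (\<forall>r<dim_row A. \<forall>c<dim_col A.
     g * A $$ (r, c) = (\<Sum>l<a. X r l * Y l c) + p ^ i * Z r c))"

lemma approximable_rank_one_update:
  assumes "approximable A i a" and dim: "dim_row A' = dim_row A" "dim_col A' = dim_col A"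
    and A': "\<And>r c. r < dim_row A \<Longrightarrow> c < dim_col A \<Longrightarrow> A' $$ (r, c) = A $$ (r, c) + U r * W c"
  shows "approximable A' i (Suc a)"
proof -
  obtain g X Y Z where g: "\<not> p dvd g" and eq: "\<forall>r<dim_row A. \<forall>c<dim_col A.
     g * A $$ (r, c) = (\<Sum>l<a. X r l * Y l c) + p ^ i * Z r c"
    using assms(1) unfolding approximable_def by (elim exE conjE)
  define X' where "X' r l = (if l < a then X r l else g * U r)" for r l
  define Y' where "Y' l c = (if l < a then Y l c else W c)" for l c
  have "g * A' $$ (r, c) = (\<Sum>l<Suc a. X' r l * Y' l c) + p ^ i * Z r c"
    if "r < dim_row A" "c < dim_col A" for r c
    using eq that A'[OF that] by (simp add: X'_def Y'_def algebra_simps)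
  then show ?thesis unfolding approximable_def dim using g by blast
qed

text \<open>
  The factor \<open>X\<close>, restricted to \<open>k + 1\<close> rows, has at most \<open>k\<close> columns, hence a left null vector \<open>z\<close>, which can
  be chosen such that \<open>p\<close> does not divide it. Applied to the rows of the minor, \<open>z\<close> yields multiples of
  \<open>p\<^sup>i\<close>. By Cramer's rule the minor times an entry \<open>z j\<close> prime to \<open>p\<close> is then a combination of minors of
  order \<open>k\<close> with coefficients divisible by \<open>p\<^sup>i\<close>, up to the factor \<open>g\<close>.
\<close>
lemma minor_divisibility:
  assumes appr: "approximable A i a" and ak: "a \<le> k"
    and dvd: "\<And>x. x \<in> minors k A \<Longrightarrow> p ^ d dvd x" and x: "x \<in> minors (Suc k) A"
  shows "p ^ (d + i) dvd x"
proof -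
  note sum.lessThan_Suc [simp del]
  obtain g X Y Z where g: "\<not> p dvd g" and eq: "\<forall>r<dim_row A. \<forall>c<dim_col A.
     g * A $$ (r, c) = (\<Sum>l<a. X r l * Y l c) + p ^ i * Z r c"
    using appr unfolding approximable_def by (elim exE conjE)
  obtain f h where fh: "x = fminor A (Suc k) f h" "f ` {..<Suc k} \<subseteq> {..<dim_row A}"
    "h ` {..<Suc k} \<subseteq> {..<dim_col A}" using x by (rule minor_obtains)
  have fl: "f r < dim_row A" and hl: "h r < dim_col A" if "r < Suc k" for r
    using fh(2,3) that by auto
  define M where "M = mat (Suc k) (Suc k) (\<lambda>(r, c). A $$ (f r, h c))"
  have M: "M \<in> carrier_mat (Suc k) (Suc k)" and xM: "x = det M" by (simp_all add: M_def fh(1) fminor_def)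
  \<comment> \<open>The transpose of \<open>X\<close> on the selected rows, filled up by zero rows; row \<open>k\<close> is zero as \<open>a \<le> k\<close>.\<close>
  define N where "N = mat (Suc k) (Suc k) (\<lambda>(l, r). if l < a then X (f r) l else 0)"
  have N: "N \<in> carrier_mat (Suc k) (Suc k)" by (simp add: N_def)
  have "det N = (\<Sum>j<Suc k. N $$ (k, j) * cofactor N k j)"
    using N by (intro laplace_expansion_row) auto
  also have "\<dots> = 0" using ak by (simp add: N_def)
  finally obtain y where y: "y \<in> carrier_vec (Suc k)" "y \<noteq> 0\<^sub>v (Suc k)" "N *\<^sub>v y = 0\<^sub>v (Suc k)"
    using det_0_iff_vec_prod_zero[OF N] by blast
  obtain j0 where j0: "j0 < Suc k" "y $ j0 \<noteq> 0" using y(1,2) by (auto simp: vec_eq_iff)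
  \<comment> \<open>Dividing by the highest power of \<open>p\<close> that divides all entries makes the null vector primitive.\<close>
  define e where "e = (LEAST e. \<not> (\<forall>j<Suc k. p ^ e dvd y $ j))"
  have "\<exists>e. \<not> (\<forall>j<Suc k. p ^ e dvd y $ j)" using bounded[OF j0(2)] j0(1) by blast
  then have e: "\<not> (\<forall>j<Suc k. p ^ e dvd y $ j)" unfolding e_def by (rule LeastI_ex)
  then obtain e' where e': "e = Suc e'" by (cases e) auto
  have "\<forall>j<Suc k. p ^ e' dvd y $ j"
    using not_less_Least[of e' "\<lambda>e. \<not> (\<forall>j<Suc k. p ^ e dvd y $ j)"] e' by (simp add: e_def)
  then have "\<forall>j. \<exists>z. j < Suc k \<longrightarrow> y $ j = p ^ e' * z" by (auto elim: dvdE)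
  then obtain z where z: "\<And>j. j < Suc k \<Longrightarrow> y $ j = p ^ e' * z j" by metis
  obtain j where j: "j < Suc k" "\<not> p dvd z j"
  proof -
    from e obtain j where "j < Suc k" "\<not> p ^ e dvd y $ j" by blast
    then show ?thesis using that z[of j] by (auto simp: e' mult.commute)
  qed
  have p0: "p ^ e' \<noteq> 0" using prime by (simp add: prime_elem_def)
  have zX: "(\<Sum>r<Suc k. X (f r) l * z r) = 0" if "l < a" for l
  proof -
    have "p ^ e' * (\<Sum>r<Suc k. X (f r) l * z r) = (\<Sum>r<Suc k. X (f r) l * y $ r)"
      using z by (simp add: sum_distrib_left mult.left_commute)
    also have "\<dots> = (N *\<^sub>v y) $ l"
      using that ak y(1) by (simp add: N_def scalar_prod_def atLeast0LessThan)
    also have "\<dots> = 0" using that ak by (simp add: y(3))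
    finally show ?thesis using p0 mult_eq_0_iff by blast
  qed
  define w where "w c = (\<Sum>r<Suc k. z r * Z (f r) (h c))" for c
  have zM: "g * (\<Sum>r<Suc k. z r * M $$ (r, c)) = p ^ i * w c" if c: "c < Suc k" for c
  proof -
    have "g * (\<Sum>r<Suc k. z r * M $$ (r, c)) = (\<Sum>r<Suc k. z r * (g * A $$ (f r, h c)))"
      using c by (simp add: M_def sum_distrib_left mult.left_commute)
    also have "\<dots> = (\<Sum>r<Suc k. z r * ((\<Sum>l<a. X (f r) l * Y l (h c)) + p ^ i * Z (f r) (h c)))"
      using eq fl hl[OF c] by (intro sum.cong) auto
    also have "\<dots> = (\<Sum>r<Suc k. \<Sum>l<a. Y l (h c) * (X (f r) l * z r)) + p ^ i * w c"
      by (simp only: distrib_left sum.distrib w_def sum_distrib_left)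
        (simp add: mult.commute mult.left_commute)
    also have "(\<Sum>r<Suc k. \<Sum>l<a. Y l (h c) * (X (f r) l * z r)) =
        (\<Sum>l<a. \<Sum>r<Suc k. Y l (h c) * (X (f r) l * z r))" by (rule sum.swap)
    also have "\<dots> = 0" using zX by (simp only: sum_distrib_left[symmetric]) simp
    finally show ?thesis by simp
  qed
  have adj: "(\<Sum>c<Suc k. M $$ (r, c) * cofactor M j c) = (if r = j then det M else 0)" if "r < Suc k" for r
  proof -
    have "(M * adj_mat M) $$ (r, j) = (\<Sum>c<Suc k. M $$ (r, c) * cofactor M j c)"
      using that j M adj_mat(1)[OF M]
      by (simp add: scalar_prod_def atLeast0LessThan adj_mat_def)
    then show ?thesis using adj_mat(2)[OF M] that j by (auto simp: eq_commute[of "det M"])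
  qed
  have "g * (z j * x) = g * (\<Sum>r<Suc k. z r * (if r = j then det M else 0))"
    using j by (simp add: xM if_distrib[of "\<lambda>t. _ * t"] cong: if_cong)
  also have "\<dots> = g * (\<Sum>r<Suc k. z r * (\<Sum>c<Suc k. M $$ (r, c) * cofactor M j c))"
    using adj by (intro arg_cong2[where f = "(*)"] sum.cong) auto
  also have "\<dots> = (\<Sum>r<Suc k. \<Sum>c<Suc k. g * (z r * M $$ (r, c)) * cofactor M j c)"
    by (simp add: sum_distrib_left mult.assoc)
  also have "\<dots> = (\<Sum>c<Suc k. \<Sum>r<Suc k. g * (z r * M $$ (r, c)) * cofactor M j c)"
    by (rule sum.swap)
  also have "\<dots> = (\<Sum>c<Suc k. p ^ i * w c * cofactor M j c)"
    using zM by (intro sum.cong refl) (simp only: sum_distrib_left[symmetric] sum_distrib_right[symmetric] lessThan_iff)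
  finally have sum: "(g * z j) * x = (\<Sum>c<Suc k. p ^ i * w c * cofactor M j c)" by (simp add: mult.assoc)
  have "p ^ d dvd cofactor M j c" if c: "c < Suc k" for c
  proof -
    define skip where "skip l x = (if x < l then x else Suc x)" for l x :: nat
    have skip: "skip l x < Suc k" if "x < k" for l x using that by (simp add: skip_def)
    have "mat_delete M j c = mat k k (\<lambda>(r, s). A $$ ((f \<circ> skip j) r, (h \<circ> skip c) s))"
      unfolding mat_delete_def M_def using j c by (intro eq_matI) (auto simp: skip_def)
    then have "cofactor M j c = (- 1) ^ (j + c) * fminor A k (f \<circ> skip j) (h \<circ> skip c)"
      by (simp add: cofactor_def fminor_def)
    moreover have "p ^ d dvd fminor A k (f \<circ> skip j) (h \<circ> skip c)"
      using skip fl hl by (intro dvd_fminor dvd) auto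
    ultimately show ?thesis by simp
  qed
  then have "p ^ (d + i) dvd (g * z j) * x"
    unfolding sum power_add by (intro dvd_sum) (simp add: mult_dvd_mono dvd_mult2 mult.commute)
  moreover have "\<not> p dvd g * z j" using g j prime by (simp add: prime_elem_dvd_mult_iff)
  ultimately show ?thesis by (simp add: power_dvd_cancel)
qed

end

text \<open>
  The list \<open>ps\<close> has the length of the rank, and the product of its first \<open>k\<close> entries is the determinantal
  divisor of order \<open>k\<close>.
\<close>
locale invariant_factor_chain = valuation_prime p for p :: "'b::idom" +
  fixes A :: "'b mat" and ps :: "'b list"
  assumes gcds: "k \<le> length ps \<Longrightarrow> is_gcd_of (minors k A) (prod_list (take k ps))"
    and nonzero: "\<exists>x\<in>minors (length ps) A. x \<noteq> 0"
    and vanish: "x \<in> minors (Suc (length ps)) A \<Longrightarrow> x = 0"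
begin

lemma prod_take_nonzero: "prod_list (take k ps) \<noteq> 0"
proof -
  have "prod_list ps \<noteq> 0"
  proof
    assume zero: "prod_list ps = 0"
    obtain x where "x \<in> minors (length ps) A" "x \<noteq> 0" using nonzero by blast
    moreover have "\<forall>x\<in>minors (length ps) A. prod_list (take (length ps) ps) dvd x"
      using gcds[of "length ps"] unfolding is_gcd_of_def by blast
    ultimately have "prod_list ps dvd x" by simp
    then show False unfolding zero using \<open>x \<noteq> 0\<close> by simp
  qed
  moreover have "prod_list ps = prod_list (take k ps) * prod_list (drop k ps)"
    by (metis append_take_drop_id prod_list.append)
  ultimately show ?thesis by auto
qed

lemma factor_nonzero: "k < length ps \<Longrightarrow> ps ! k \<noteq> 0"
  using prod_take_nonzero[of "Suc k"] by (simp add: take_Suc_conv_app_nth)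

lemma power_dvd_minors_iff:
  "k \<le> length ps \<Longrightarrow> (\<forall>x\<in>minors k A. e dvd x) \<longleftrightarrow> e dvd prod_list (take k ps)"
  using gcds[of k] dvd_trans unfolding is_gcd_of_def by blast

text \<open>
  Take a minor of order \<open>k\<close> of least \<open>p\<close>-order \<open>d\<close> and divide the expansion of its bordered minors by \<open>p\<^sup>d\<close>.
  The minors of order \<open>k\<close> in the expansion are divisible by \<open>p\<^sup>d\<close>, the bordered minors by \<open>p\<close> to
  the power \<open>d + i\<close>, and the given minor becomes the factor \<open>g\<close> prime to \<open>p\<close>.
\<close>
lemma approximable_of_dvd:
  assumes k: "k \<le> length ps" and dvd: "k < length ps \<Longrightarrow> p ^ i dvd ps ! k"
  shows "approximable A i k"
proof -
  obtain d q where dq: "prod_list (take k ps) = p ^ d * q" "\<not> p dvd q"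
    by (rule factor_out[OF prod_take_nonzero[of k]])
  have "\<not> p ^ Suc d dvd prod_list (take k ps)"
    using dq prime by (auto simp: prime_elem_def)
  then obtain x where x: "x \<in> minors k A" "\<not> p ^ Suc d dvd x"
    using power_dvd_minors_iff[OF k, of "p ^ Suc d"] by blast
  have pd: "\<forall>x\<in>minors k A. p ^ d dvd x" using power_dvd_minors_iff[OF k] dq by simp
  then obtain q' where q': "x = p ^ d * q'" using x(1) by (auto elim: dvdE)
  have nq': "\<not> p dvd q'" using x(2) by (auto simp: q')
  obtain f h where fh: "x = fminor A k f h" "f ` {..<k} \<subseteq> {..<dim_row A}" "h ` {..<k} \<subseteq> {..<dim_col A}"
    using x(1) by (rule minor_obtains)
  obtain b where b: "\<forall>x. (\<forall>d\<in>minors k A. x dvd d) \<longrightarrow> (\<forall>l<k. \<forall>i<dim_row A. x dvd b l i)"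
    and bord: "\<forall>i<dim_row A. \<forall>j<dim_col A. fminor A (Suc k) (f(k := i)) (h(k := j)) =
       fminor A k f h * A $$ (i, j) + (\<Sum>l<k. b l i * A $$ (f l, j))"
    using bordered_minor[OF fh(2,3)] by (elim exE conjE)
  have "\<forall>l i. \<exists>t. l < k \<longrightarrow> i < dim_row A \<longrightarrow> b l i = p ^ d * t"
  proof (intro allI)
    fix l i show "\<exists>t. l < k \<longrightarrow> i < dim_row A \<longrightarrow> b l i = p ^ d * t"
    proof (cases "l < k \<and> i < dim_row A")
      case True
      then have "p ^ d dvd b l i" using spec[OF b, of "p ^ d"] pd by blast
      then show ?thesis by (auto elim: dvdE)
    qed blast
  qed
  then obtain t where t: "\<And>l i. l < k \<Longrightarrow> i < dim_row A \<Longrightarrow> b l i = p ^ d * t l i" by metis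
  have big: "\<forall>x\<in>minors (Suc k) A. p ^ (d + i) dvd x"
  proof (cases "k < length ps")
    case True
    have "p ^ (d + i) dvd prod_list (take (Suc k) ps)"
      using dvd[OF True] True dq(1)
      by (simp add: take_Suc_conv_app_nth power_add)
    then show ?thesis using power_dvd_minors_iff[of "Suc k"] True by simp
  qed (use k vanish in auto)
  have "\<exists>Z. q' * A $$ (r, c) = (\<Sum>l<k. - t l r * A $$ (f l, c)) + p ^ i * Z"
    if rc: "r < dim_row A" "c < dim_col A" for r c
  proof -
    have "p ^ (d + i) dvd fminor A (Suc k) (f(k := r)) (h(k := c))"
      using big fh(2,3) rc by (intro dvd_fminor) (auto simp: lessThan_Suc)
    then obtain Z where "fminor A (Suc k) (f(k := r)) (h(k := c)) = p ^ (d + i) * Z" by (auto elim: dvdE)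
    then have "p ^ d * (p ^ i * Z) = x * A $$ (r, c) + (\<Sum>l<k. b l r * A $$ (f l, c))"
      using bord rc fh(1) by (simp add: power_add mult.assoc)
    also have "\<dots> = p ^ d * (q' * A $$ (r, c) + (\<Sum>l<k. t l r * A $$ (f l, c)))"
      using t[OF _ rc(1)] by (simp add: q' distrib_left sum_distrib_left mult.assoc)
    finally have "p ^ d * (p ^ i * Z) = p ^ d * (q' * A $$ (r, c) + (\<Sum>l<k. t l r * A $$ (f l, c)))" .
    then have "p ^ i * Z = q' * A $$ (r, c) + (\<Sum>l<k. t l r * A $$ (f l, c))"
      using prime by (simp add: prime_elem_def)
    then show ?thesis by (intro exI[of _ Z]) (simp add: sum_negf)
  qed
  note ex = this
  define Z where "Z r c = (SOME Z. q' * A $$ (r, c) = (\<Sum>l<k. - t l r * A $$ (f l, c)) + p ^ i * Z)" for r c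
  have "q' * A $$ (r, c) = (\<Sum>l<k. - t l r * A $$ (f l, c)) + p ^ i * Z r c"
    if "r < dim_row A" "c < dim_col A" for r c
    unfolding Z_def using ex[OF that] by (rule someI_ex)
  then show ?thesis unfolding approximable_def using nq'
    by (intro exI[of _ q'] exI[of _ "\<lambda>r l. - t l r"] exI[of _ "\<lambda>l c. A $$ (f l, c)"] exI[of _ Z]) simp
qed

lemma dvd_of_approximable:
  assumes appr: "approximable A i a" "a \<le> k" and k: "k < length ps"
  shows "p ^ i dvd ps ! k"
proof -
  obtain d q where dq: "prod_list (take k ps) = p ^ d * q" "\<not> p dvd q"
    by (rule factor_out[OF prod_take_nonzero[of k]])
  have "p ^ d dvd x" if "x \<in> minors k A" for x
    using power_dvd_minors_iff[of k "p ^ d"] k dq that by simp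
  then have "\<forall>x\<in>minors (Suc k) A. p ^ (d + i) dvd x"
    using minor_divisibility[OF appr] by blast
  then have "p ^ (d + i) dvd prod_list (take (Suc k) ps)"
    using power_dvd_minors_iff[of "Suc k"] k by simp
  then have "p ^ d * p ^ i dvd p ^ d * (q * ps ! k)"
    using k dq(1) by (simp add: take_Suc_conv_app_nth power_add mult.assoc)
  then have "p ^ i dvd q * ps ! k" using prime by (simp add: prime_elem_def)
  then show ?thesis using dq(2) by (simp add: power_dvd_cancel)
qed

definition approx_rank :: "nat \<Rightarrow> nat" where
  "approx_rank i = (LEAST a. approximable A i a)"

lemma approx_rank: "approximable A i (approx_rank i)" "approx_rank i \<le> length ps"
proof -
  have "approximable A i (length ps)" by (rule approximable_of_dvd) auto
  then show "approximable A i (approx_rank i)" "approx_rank i \<le> length ps"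
    unfolding approx_rank_def by (rule LeastI, rule Least_le)
qed

lemma approx_rank_le: "approximable A i a \<Longrightarrow> approx_rank i \<le> a"
  unfolding approx_rank_def by (rule Least_le)

text \<open>
  By the two preceding directions, \<open>p\<^sup>i\<close> divides the entry with index \<open>k\<close> exactly if \<open>k \<ge> approx_rank i\<close>.
\<close>
lemma weyr_count:
  "conjugate_partition (map (exponent_in p) (rev ps)) i + approx_rank i = length ps"
proof -
  have "conjugate_partition (map (exponent_in p) (rev ps)) i =
      length (filter (\<lambda>d. i \<le> d) (rev (map (exponent_in p) ps)))"
    by (simp add: conjugate_partition_def length_filter_conv_card rev_map)
  also have "\<dots> = length (filter (\<lambda>d. i \<le> d) (map (exponent_in p) ps))"
    by (simp flip: rev_filter)
  also have "\<dots> = card {k. k < length ps \<and> i \<le> exponent_in p (ps ! k)}"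
    unfolding length_filter_conv_card by (intro arg_cong[where f = card]) auto
  also have "{k. k < length ps \<and> i \<le> exponent_in p (ps ! k)} = {approx_rank i..<length ps}"
  proof (intro equalityI subsetI)
    fix k assume "k \<in> {k. k < length ps \<and> i \<le> exponent_in p (ps ! k)}"
    then have k: "k < length ps" "p ^ i dvd ps ! k" using le_exponent_in_iff factor_nonzero by auto
    then have "approximable A i k" by (intro approximable_of_dvd) auto
    then show "k \<in> {approx_rank i..<length ps}" using approx_rank_le k by simp
  next
    fix k assume "k \<in> {approx_rank i..<length ps}"
    then show "k \<in> {k. k < length ps \<and> i \<le> exponent_in p (ps ! k)}"
      using dvd_of_approximable[OF approx_rank(1), of i k] le_exponent_in_iff factor_nonzero by simp
  qed
  finally show ?thesis using approx_rank(2)[of i] by simp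
qed

end

section \<open>Homogeneous invariant factors of a pencil\<close>

text \<open>
  The homogenization of degree \<open>k\<close> of a polynomial in \<open>s\<close> of degree at most \<open>k\<close>; the outer variable is \<open>s\<close>,
  the inner one \<open>t\<close>.
\<close>
definition hom_poly :: "nat \<Rightarrow> 'a::comm_ring_1 poly \<Rightarrow> 'a poly poly" where
  "hom_poly k f = (\<Sum>j\<le>k. monom (monom (coeff f j) (k - j)) j)"

lemma coeff_hom_poly:
  "degree f \<le> k \<Longrightarrow> coeff (hom_poly k f) j = monom (coeff f j) (k - j)"
  by (cases "j \<le> k") (auto simp: hom_poly_def coeff_sum coeff_eq_0)

lemma hom_poly_mult:
  assumes "degree f \<le> k" "degree g \<le> l"
  shows "hom_poly (k + l) (f * g) = hom_poly k f * hom_poly l g"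
proof (rule poly_eqI)
  fix n
  have "degree (f * g) \<le> k + l" using degree_mult_le[of f g] assms by linarith
  then have "coeff (hom_poly (k + l) (f * g)) n = monom (coeff (f * g) n) (k + l - n)"
    by (rule coeff_hom_poly)
  also have "\<dots> = (\<Sum>i\<le>n. monom (coeff f i * coeff g (n - i)) (k + l - n))"
    by (intro poly_eqI) (simp add: coeff_mult coeff_sum)
  also have "\<dots> = (\<Sum>i\<le>n. monom (coeff f i) (k - i) * monom (coeff g (n - i)) (l - (n - i)))"
  proof (rule sum.cong[OF refl])
    fix i assume i: "i \<in> {..n}"
    show "monom (coeff f i * coeff g (n - i)) (k + l - n) =
        monom (coeff f i) (k - i) * monom (coeff g (n - i)) (l - (n - i))"
    proof (cases "i \<le> k \<and> n - i \<le> l")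
      case True
      then have "(k - i) + (l - (n - i)) = k + l - n" using i by auto
      then show ?thesis by (simp add: mult_monom)
    next
      case False
      then have "k < i \<or> l < n - i" by auto
      then have "coeff f i = 0 \<or> coeff g (n - i) = 0"
        using assms coeff_eq_0[of f i] coeff_eq_0[of g "n - i"] by auto
      then show ?thesis by auto
    qed
  qed
  also have "\<dots> = coeff (hom_poly k f * hom_poly l g) n"
    using assms by (simp add: coeff_mult coeff_hom_poly)
  finally show "coeff (hom_poly (k + l) (f * g)) n = coeff (hom_poly k f * hom_poly l g) n" .
qed

lemma hom_poly_sum: "hom_poly k (\<Sum>x\<in>S. f x) = (\<Sum>x\<in>S. hom_poly k (f x))"
proof -
  have add: "monom (coeff (\<Sum>x\<in>S. f x) j) i = (\<Sum>x\<in>S. monom (coeff (f x) j) i)" for i j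
    by (intro poly_eqI) (simp add: coeff_sum)
  have "monom (\<Sum>x\<in>S. h x) j = (\<Sum>x\<in>S. monom (h x) j)" for h :: "_ \<Rightarrow> 'a poly" and j
    by (intro poly_eqI) (simp add: coeff_sum)
  then show ?thesis unfolding hom_poly_def add by (simp add: sum.swap[of _ S])
qed

lemma hom_poly_uminus: "hom_poly k (- f) = - hom_poly k f"
  unfolding hom_poly_def by (simp add: minus_monom[symmetric] sum_negf)

lemma hom_poly_eq_0_iff:
  assumes "degree f \<le> k"
  shows "hom_poly k f = 0 \<longleftrightarrow> f = 0"
  by (simp add: poly_eq_iff[of _ 0] coeff_hom_poly[OF assms] monom_eq_0_iff)

lemma hom_poly_1: "hom_poly (Suc 0) f = [:[:0, coeff f 0:], [:coeff f 1:]:]"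
  by (simp add: hom_poly_def monom_altdef monom_0 monom_Suc)

lemma hom_poly_prod:
  assumes "\<And>i. i < (n::nat) \<Longrightarrow> degree (f i) \<le> 1"
  shows "hom_poly n (\<Prod>i = 0..<n. f i) = (\<Prod>i = 0..<n. hom_poly 1 (f i))"
  using assms
proof (induction n)
  case 0
  then show ?case by (simp add: hom_poly_def monom_0 one_pCons)
next
  case (Suc n)
  have "degree (\<Prod>i = 0..<n. f i) \<le> (\<Sum>i = 0..<n. degree (f i))" using degree_prod_sum_le[of "{0..<n}" f] by (simp add: comp_def)
  also have "\<dots> \<le> n" using Suc.prems sum_mono[of "{0..<n}" "\<lambda>i. degree (f i)" "\<lambda>_. 1"] by simp
  finally have "degree (\<Prod>i = 0..<n. f i) \<le> n" .
  then have "hom_poly (n + 1) ((\<Prod>i = 0..<n. f i) * f n) = hom_poly n (\<Prod>i = 0..<n. f i) * hom_poly 1 (f n)"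
    using Suc.prems by (intro hom_poly_mult) auto
  then show ?case using Suc by simp
qed

lemma det_hom_poly:
  assumes M: "M \<in> carrier_mat k k" and deg: "\<And>i j. i < k \<Longrightarrow> j < k \<Longrightarrow> degree (M $$ (i, j)) \<le> 1"
  shows "det (map_mat (hom_poly 1) M) = hom_poly k (det M)"
proof -
  have sgn: "hom_poly k (signof p * x) = signof p * hom_poly k x" for p x
    by (simp add: sign_def hom_poly_uminus)
  have "det (map_mat (hom_poly 1) M) =
      (\<Sum>p | p permutes {0..<k}. signof p * (\<Prod>i = 0..<k. map_mat (hom_poly 1) M $$ (i, p i)))"
    using M by (intro det_def') simp
  also have "\<dots> = (\<Sum>p | p permutes {0..<k}. hom_poly k (signof p * (\<Prod>i = 0..<k. M $$ (i, p i))))"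
  proof (rule sum.cong[OF refl])
    fix p assume "p \<in> {p. p permutes {0..<k}}"
    then have p: "i < k \<Longrightarrow> p i < k" for i using permutes_in_image[of p "{0..<k}" i] by simp
    have "(\<Prod>i = 0..<k. map_mat (hom_poly 1) M $$ (i, p i)) = (\<Prod>i = 0..<k. hom_poly 1 (M $$ (i, p i)))"
      using M p by (intro prod.cong) auto
    also have "\<dots> = hom_poly k (\<Prod>i = 0..<k. M $$ (i, p i))"
      using deg p by (intro hom_poly_prod[symmetric]) auto
    finally show "signof p * (\<Prod>i = 0..<k. map_mat (hom_poly 1) M $$ (i, p i)) =
        hom_poly k (signof p * (\<Prod>i = 0..<k. M $$ (i, p i)))" by (simp only: sgn)
  qed
  also have "\<dots> = hom_poly k (det M)" unfolding det_def'[OF M] hom_poly_sum ..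
  finally show ?thesis .
qed

lemma minors_homogenize:
  assumes H: "matrix_pencil H"
  shows "minors k (homogenize H) = hom_poly k ` minors k H"
    and "x \<in> minors k H \<Longrightarrow> degree x \<le> k"
proof -
  have *: "det (submatrix (homogenize H) I J) = hom_poly k (det (submatrix H I J)) \<and>
      degree (det (submatrix H I J)) \<le> k"
    if IJ: "I \<subseteq> {..<dim_row H}" "J \<subseteq> {..<dim_col H}" "card I = k" "card J = k" for I J
  proof -
    have fin: "finite I" "finite J" using IJ finite_subset by auto
    then have pick: "pick I i < dim_row H" "pick J i < dim_col H" if "i < k" for i
      using IJ pick_in_set_le[of i I] pick_in_set_le[of i J] that by auto
    define M where "M = mat k k (\<lambda>(i, j). H $$ (pick I i, pick J j))"
    have M: "M \<in> carrier_mat k k" "submatrix H I J = M" using IJ by (simp_all add: M_def submatrix_pick)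
    have deg: "degree (M $$ (i, j)) \<le> 1" if "i < k" "j < k" for i j
      using H pick that by (simp add: M_def matrix_pencil_def)
    have "submatrix (homogenize H) I J = mat k k (\<lambda>(i, j). homogenize H $$ (pick I i, pick J j))"
      using IJ by (intro submatrix_pick) (simp_all add: homogenize_def)
    also have "\<dots> = map_mat (hom_poly 1) M"
      using pick by (intro eq_matI) (auto simp: M_def homogenize_def hom_poly_1)
    finally show ?thesis
      using det_hom_poly[OF M(1) deg] degree_det_le[of k M 1] deg M by simp
  qed
  have hd: "dim_row (homogenize H) = dim_row H" "dim_col (homogenize H) = dim_col H"
    by (simp_all add: homogenize_def)
  show "minors k (homogenize H) = hom_poly k ` minors k H"
  proof (intro equalityI subsetI)
    fix x assume "x \<in> minors k (homogenize H)"
    then obtain I J where IJ: "x = det (submatrix (homogenize H) I J)" "I \<subseteq> {..<dim_row H}"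
      "J \<subseteq> {..<dim_col H}" "card I = k" "card J = k" by (auto simp: minors_def hd)
    then have "det (submatrix H I J) \<in> minors k H" by (auto simp: minors_def)
    then show "x \<in> hom_poly k ` minors k H" using *[OF IJ(2-5)] IJ(1) by (intro image_eqI) auto
  next
    fix x assume "x \<in> hom_poly k ` minors k H"
    then obtain I J where IJ: "x = hom_poly k (det (submatrix H I J))" "I \<subseteq> {..<dim_row H}"
      "J \<subseteq> {..<dim_col H}" "card I = k" "card J = k" by (auto simp: minors_def)
    then have "det (submatrix (homogenize H) I J) \<in> minors k (homogenize H)"
      by (auto simp: minors_def hd)
    then show "x \<in> minors k (homogenize H)" using *[OF IJ(2-5)] IJ(1) by simp
  qed
  show "degree x \<le> k" if x: "x \<in> minors k H"
  proof -
    obtain I J where IJ: "x = det (submatrix H I J)" "I \<subseteq> {..<dim_row H}"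
      "J \<subseteq> {..<dim_col H}" "card I = k" "card J = k" using x by (rule minorsE)
    then show ?thesis using *[OF IJ(2-5)] by simp
  qed
qed

lemma normal_rank_homogenize:
  assumes "matrix_pencil H"
  shows "normal_rank (homogenize H) = normal_rank H"
proof -
  have "(\<exists>d\<in>minors k (homogenize H). d \<noteq> 0) \<longleftrightarrow> (\<exists>d\<in>minors k H. d \<noteq> 0)" for k
    unfolding minors_homogenize(1)[OF assms]
    by (auto simp: hom_poly_eq_0_iff minors_homogenize(2)[OF assms])
  then show ?thesis by (simp add: normal_rank_def)
qed

lemma poly_linear_form_Finite: "linear_form (Finite x) dvd f \<longleftrightarrow> poly f [:0, x:] = 0"
  using poly_eq_0_iff_dvd[of f "[:0, x:]"] by simp

lemma prime_elem_X: "prime_elem ([:0, 1:] :: 'a::field poly)"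
  by (rule prime_elem_linear_field_poly) simp

lemma prime_elem_linear_form: "prime_elem (linear_form (l :: 'a::field extended))"
proof (cases l)
  case (Finite x)
  show ?thesis
    unfolding Finite
  proof (rule prime_elemI)
    show "linear_form (Finite x) \<noteq> 0" by simp
    show "\<not> linear_form (Finite x) dvd 1" unfolding poly_linear_form_Finite by simp
    show "linear_form (Finite x) dvd a * b \<Longrightarrow> linear_form (Finite x) dvd a \<or> linear_form (Finite x) dvd b"
      for a b unfolding poly_linear_form_Finite by simp
  qed
next
  case Infinity
  then show ?thesis using lift_prime_elem_poly[OF prime_elem_X[where ?'a = 'a]] by simp
qed

lemma linear_form_power_bounded:
  fixes f :: "'a::field poly poly"
  assumes "f \<noteq> 0"
  shows "\<exists>k. \<not> linear_form l ^ k dvd f"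
proof (cases l)
  case (Finite x)
  have "\<not> linear_form (Finite x) ^ Suc (degree f) dvd f"
  proof
    assume "linear_form (Finite x) ^ Suc (degree f) dvd f"
    then have "degree (linear_form (Finite x) ^ Suc (degree f)) \<le> degree f"
      using assms by (rule dvd_imp_degree_le)
    moreover have "degree (linear_form (Finite x) ^ Suc (degree f)) = Suc (degree f)"
      by (subst degree_power_eq) simp_all
    ultimately show False by linarith
  qed
  then show ?thesis using Finite by blast
next
  case Infinity
  define c where "c = lead_coeff f"
  have c: "c \<noteq> 0" using assms by (simp add: c_def)
  have "\<not> linear_form Infinity ^ Suc (degree c) dvd f"
  proof
    assume "linear_form Infinity ^ Suc (degree c) dvd f"
    then have "[:[:0, 1:] ^ Suc (degree c):] dvd f" by (simp only: linear_form.simps poly_const_pow)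
    then have "[:0, 1:] ^ Suc (degree c) dvd c" unfolding c_def const_poly_dvd_iff by blast
    then have "degree ([:0, 1:] ^ Suc (degree c) :: 'a poly) \<le> degree c" using c by (rule dvd_imp_degree_le)
    then show False by (subst (asm) degree_power_eq) simp_all
  qed
  then show ?thesis using Infinity by blast
qed

lemma linear_form_dvd_imp_eq:
  assumes "linear_form l dvd linear_form (l' :: 'a::field extended)"
  shows "l = l'"
proof (cases l)
  case (Finite x)
  then have "poly (linear_form l') [:0, x:] = 0" using assms by (simp only: poly_linear_form_Finite)
  then show ?thesis using Finite by (cases l') auto
next
  case Infinity
  have "\<not> ([:0, 1:] :: 'a poly) dvd 1" using prime_elem_X unfolding prime_elem_def by blast
  then have "\<not> [:[:0, 1 :: 'a:]:] dvd [:[:0, - y:], 1:]" for y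
    unfolding const_poly_dvd_iff by (metis coeff_pCons_0 coeff_pCons_Suc)
  then show ?thesis using assms Infinity by (cases l') auto
qed

text \<open>
  Products of primes factor uniquely in every integral domain: a prime of the product divides either \<open>e\<close> or the
  complementary factor.
\<close>
lemma dvd_prime_prod:
  fixes f :: "'c \<Rightarrow> 'b::idom"
  assumes prime: "\<And>l. prime_elem (f l)"
  shows "e dvd u * (\<Prod>l\<in>#M. f l) \<Longrightarrow> u dvd 1 \<Longrightarrow> \<exists>E w. E \<subseteq># M \<and> w dvd 1 \<and> e = w * (\<Prod>l\<in>#E. f l)"
proof (induction M arbitrary: e)
  case empty
  then have "e dvd 1" using dvd_trans by auto
  then show ?case by (intro exI[of _ "{#}"] exI[of _ e]) simp
next
  case (add l M)
  show ?case
  proof (cases "f l dvd e")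
    case True
    then obtain e' where e': "e = f l * e'" by (rule dvdE)
    have "f l * e' dvd f l * (u * (\<Prod>l\<in>#M. f l))" using add.prems(1) by (simp add: e' mult.left_commute)
    then have "e' dvd u * (\<Prod>l\<in>#M. f l)" using prime[of l] by (simp add: prime_elem_def)
    then obtain E w where "E \<subseteq># M" "w dvd 1" "e' = w * (\<Prod>l\<in>#E. f l)" using add.IH add.prems(2) by blast
    then show ?thesis by (intro exI[of _ "add_mset l E"] exI[of _ w]) (simp add: e' mult.left_commute)
  next
    case False
    obtain z where z: "u * (\<Prod>l\<in>#add_mset l M. f l) = e * z" using add.prems(1) by (rule dvdE)
    then have "f l dvd e * z" by (metis dvd_triv_left image_mset_add_mset mult.left_commute prod_mset.add_mset)
    then have "f l dvd z" using False prime by (auto simp: prime_elem_dvd_mult_iff)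
    then obtain z' where "z = f l * z'" by (rule dvdE)
    then have "f l * (u * (\<Prod>l\<in>#M. f l)) = f l * (e * z')" using z by (simp add: mult.left_commute)
    then have "u * (\<Prod>l\<in>#M. f l) = e * z'" using prime[of l] by (simp add: prime_elem_def)
    then have "e dvd u * (\<Prod>l\<in>#M. f l)" by simp
    then obtain E w where "E \<subseteq># M" "w dvd 1" "e = w * (\<Prod>l\<in>#E. f l)" using add.IH add.prems(2) by blast
    then show ?thesis
      by (intro exI[of _ E] exI[of _ w]) (auto intro: subset_mset.order_trans)
  qed
qed

lemma prime_prod_dvd_imp_subset:
  fixes f :: "'c \<Rightarrow> 'b::idom"
  assumes prime: "\<And>l. prime_elem (f l)" and inj: "\<And>l l'. f l dvd f l' \<Longrightarrow> l = l'"
  shows "(\<Prod>l\<in>#E. f l) dvd u * (\<Prod>l\<in>#M. f l) \<Longrightarrow> u dvd 1 \<Longrightarrow> E \<subseteq># M"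
proof (induction E arbitrary: M)
  case (add l E)
  have "f l dvd u * (\<Prod>l\<in>#M. f l)" using add.prems(1) dvd_mult_left by auto
  moreover have "\<not> f l dvd u"
    using add.prems(2) prime[of l] dvd_trans unfolding prime_elem_def by blast
  ultimately have "f l dvd (\<Prod>l\<in>#M. f l)" using prime by (simp add: prime_elem_dvd_mult_iff)
  then have "l \<in># M"
  proof (induction M)
    case empty
    then show ?case using prime[of l] by (simp add: prime_elem_def)
  next
    case (add l' M)
    then show ?case using prime[of l] inj[of l l'] by (auto simp: prime_elem_dvd_mult_iff)
  qed
  then obtain M' where M': "M = add_mset l M'" by (metis mset_add)
  have "f l * (\<Prod>l\<in>#E. f l) dvd f l * (u * (\<Prod>l\<in>#M'. f l))"
    using add.prems(1) by (simp add: M' mult.left_commute)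
  then have "(\<Prod>l\<in>#E. f l) dvd u * (\<Prod>l\<in>#M'. f l)" using prime[of l] by (simp add: prime_elem_def)
  then have "E \<subseteq># M'" using add.IH add.prems(2) by blast
  then show ?case by (simp add: M')
qed simp

text \<open>
  The greatest common divisor belongs to the infimum of the multisets of prime factors. Elements that are
  zero do not contribute to this infimum; one nonzero element makes it an infimum over a nonempty set.
\<close>
lemma gcd_exists_of_prime_products:
  fixes f :: "'c \<Rightarrow> 'b::idom"
  assumes prime: "\<And>l. prime_elem (f l)" and inj: "\<And>l l'. f l dvd f l' \<Longrightarrow> l = l'"
    and factors: "\<And>a. a \<in> S \<Longrightarrow> a \<noteq> 0 \<Longrightarrow> \<exists>u M. u dvd 1 \<and> a = u * (\<Prod>l\<in>#M. f l)"
    and nonzero: "a0 \<in> S" "a0 \<noteq> 0"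
  shows "\<exists>d. is_gcd_of S d"
proof -
  have "\<forall>a. \<exists>u M. a \<in> S \<longrightarrow> a \<noteq> 0 \<longrightarrow> u dvd 1 \<and> u * (\<Prod>l\<in>#M. f l) = a"
  proof (intro allI)
    fix a show "\<exists>u M. a \<in> S \<longrightarrow> a \<noteq> 0 \<longrightarrow> u dvd 1 \<and> u * (\<Prod>l\<in>#M. f l) = a"
      using factors[of a] by (cases "a \<in> S \<and> a \<noteq> 0") auto
  qed
  then obtain U M where UM: "\<And>a. a \<in> S \<Longrightarrow> a \<noteq> 0 \<Longrightarrow> U a dvd 1 \<and> U a * (\<Prod>l\<in>#M a. f l) = a"
    by metis
  define T where "T = M ` {a \<in> S. a \<noteq> 0}"
  have "is_gcd_of S (\<Prod>l\<in>#Inf T. f l)"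
    unfolding is_gcd_of_def
  proof (intro conjI ballI allI impI)
    fix a assume a: "a \<in> S"
    show "(\<Prod>l\<in>#Inf T. f l) dvd a"
    proof (cases "a = 0")
      case False
      then have "Inf T \<subseteq># M a" using a by (intro subset_mset.cInf_lower) (auto simp: T_def)
      then obtain R where "M a = Inf T + R" by (metis subset_mset.le_iff_add)
      then have "(\<Prod>l\<in>#M a. f l) = (\<Prod>l\<in>#Inf T. f l) * (\<Prod>l\<in>#R. f l)" by simp
      then have "(\<Prod>l\<in>#Inf T. f l) dvd U a * (\<Prod>l\<in>#M a. f l)" by simp
      then show ?thesis using UM[OF a False] by simp
    qed simp
  next
    fix e assume e: "\<forall>a\<in>S. e dvd a"
    have "e dvd U a0 * (\<Prod>l\<in>#M a0. f l)" "U a0 dvd 1" using UM[OF nonzero] e nonzero(1) by auto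
    then have "\<exists>E w. E \<subseteq># M a0 \<and> w dvd 1 \<and> e = w * (\<Prod>l\<in>#E. f l)"
      by (rule dvd_prime_prod[of f, OF prime])
    then obtain E w where "E \<subseteq># M a0" and E: "w dvd 1" "e = w * (\<Prod>l\<in>#E. f l)"
      by (elim exE conjE)
    have "E \<subseteq># N" if "N \<in> T" for N
    proof -
      obtain a where a: "a \<in> S" "a \<noteq> 0" "N = M a" using \<open>N \<in> T\<close> by (auto simp: T_def)
      have "(\<Prod>l\<in>#E. f l) dvd a" using bspec[OF e a(1)] unfolding E(2) by (rule dvd_mult_right)
      then have "(\<Prod>l\<in>#E. f l) dvd U a * (\<Prod>l\<in>#M a. f l)" using UM[OF a(1,2)] by simp
      moreover have "U a dvd 1" using UM[OF a(1,2)] by simp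
      ultimately show ?thesis unfolding a(3)
        by (intro prime_prod_dvd_imp_subset[of f, OF prime _ _ _] inj)
    qed
    then have "E \<subseteq># Inf T" using nonzero by (intro subset_mset.cInf_greatest) (auto simp: T_def)
    then obtain R where "Inf T = E + R" by (metis subset_mset.le_iff_add)
    then have "(\<Prod>l\<in>#Inf T. f l) = (\<Prod>l\<in>#E. f l) * (\<Prod>l\<in>#R. f l)" by simp
    moreover obtain w' where "1 = w * w'" using E(1) by (rule dvdE)
    then have "e * w' = (\<Prod>l\<in>#E. f l)" unfolding E(2) by (simp add: mult.commute mult.left_commute)
    ultimately have "(\<Prod>l\<in>#Inf T. f l) = e * (w' * (\<Prod>l\<in>#R. f l))"
      by (simp flip: mult.assoc)
    then show "e dvd (\<Prod>l\<in>#Inf T. f l)" by simp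
  qed
  then show ?thesis by blast
qed

text \<open>
  Split the polynomial into linear factors; the missing degree becomes a power of \<open>t\<close>, the linear form at
  infinity.
\<close>
lemma hom_poly_factorization:
  fixes f :: "'a::alg_closed_field poly"
  assumes f: "f \<noteq> 0" "degree f \<le> k"
  shows "\<exists>u M. u dvd 1 \<and> hom_poly k f = u * (\<Prod>l\<in>#M. linear_form l)"
proof -
  obtain A where A: "size A = degree f" "f = smult (lead_coeff f) (\<Prod>x\<in>#A. [:- x, 1:])"
    using alg_closed_imp_factorization[OF f(1)] by blast
  have prod: "hom_poly (size A) (\<Prod>x\<in>#A. [:- x, 1:]) = (\<Prod>x\<in>#A. linear_form (Finite x)) \<and>
      degree (\<Prod>x\<in>#A. [:- x, 1:]) \<le> size A" for A :: "'a multiset"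
  proof (induction A)
    case empty
    then show ?case by (simp add: hom_poly_def monom_0 one_pCons)
  next
    case (add x A)
    have "hom_poly (1 + size A) ([:- x, 1:] * (\<Prod>x\<in>#A. [:- x, 1:])) =
        hom_poly 1 [:- x, 1:] * hom_poly (size A) (\<Prod>x\<in>#A. [:- x, 1:])"
      using add by (intro hom_poly_mult) auto
    moreover have "hom_poly 1 [:- x, 1:] = linear_form (Finite x)" by (simp add: hom_poly_1)
    moreover have "degree ([:- x, 1:] * (\<Prod>x\<in>#A. [:- x, 1:])) \<le> 1 + size A"
      using degree_mult_le[of "[:- x, 1:]" "\<Prod>x\<in>#A. [:- x, 1:]"] add by simp
    ultimately show ?case using add by simp
  qed
  define c where "c = lead_coeff f"
  have c: "c \<noteq> 0" using f by (simp add: c_def)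
  define r where "r = k - degree f"
  have k: "k = r + size A" using f(2) A(1) by (simp add: r_def)
  have "hom_poly (r + size A) ([:c:] * (\<Prod>x\<in>#A. [:- x, 1:])) =
      hom_poly r [:c:] * hom_poly (size A) (\<Prod>x\<in>#A. [:- x, 1:])"
    using prod by (intro hom_poly_mult) auto
  moreover have "hom_poly r [:c:] = [:[:c:]:] * linear_form Infinity ^ r"
  proof -
    have "hom_poly r [:c:] = [:monom c r:]"
      by (intro poly_eqI) (auto simp: coeff_hom_poly coeff_pCons split: nat.splits)
    then show ?thesis by (simp add: poly_const_pow monom_altdef)
  qed
  ultimately have "hom_poly k f = [:[:c:]:] * (linear_form Infinity ^ r * (\<Prod>x\<in>#A. linear_form (Finite x)))"
    using A(2) prod[of A] by (simp add: k c_def mult.assoc)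
  also have "linear_form Infinity ^ r * (\<Prod>x\<in>#A. linear_form (Finite x)) =
      (\<Prod>l\<in>#replicate_mset r Infinity + image_mset Finite A. linear_form l)"
    by (simp add: image_mset.compositionality comp_def)
  finally have "hom_poly k f = [:[:c:]:] * (\<Prod>l\<in>#replicate_mset r Infinity + image_mset Finite A. linear_form l)" .
  moreover have "[:[:c:]:] dvd 1"
    using c by (intro dvdI[of _ _ "[:[:inverse c:]:]"]) (simp add: one_pCons)
  ultimately show ?thesis by blast
qed

text \<open>
  A minor of order \<open>k + 1\<close> is the bordered minor of one of its own minors of order \<open>k\<close>.
\<close>
lemma common_divisor_of_larger_minors:
  assumes dvd: "\<And>x. x \<in> minors k A \<Longrightarrow> e dvd x" and x: "x \<in> minors (Suc k) A"
  shows "e dvd x"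
proof -
  obtain f g where fg: "x = fminor A (Suc k) f g" "f ` {..<Suc k} \<subseteq> {..<dim_row A}"
    "g ` {..<Suc k} \<subseteq> {..<dim_col A}" using x by (rule minor_obtains)
  have f: "f ` {..<k} \<subseteq> {..<dim_row A}" "f k < dim_row A" and g: "g ` {..<k} \<subseteq> {..<dim_col A}" "g k < dim_col A"
    using fg(2,3) by (auto simp: lessThan_Suc)
  obtain c where c: "\<forall>x. (\<forall>d\<in>minors k A. x dvd d) \<longrightarrow> (\<forall>l<k. \<forall>i<dim_row A. x dvd c l i)"
    and eq: "\<forall>i<dim_row A. \<forall>j<dim_col A. fminor A (Suc k) (f(k := i)) (g(k := j)) =
       fminor A k f g * A $$ (i, j) + (\<Sum>l<k. c l i * A $$ (f l, j))"
    using bordered_minor[OF f(1) g(1)] by (elim exE conjE)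
  have "x = fminor A k f g * A $$ (f k, g k) + (\<Sum>l<k. c l (f k) * A $$ (f l, g k))"
    using eq[rule_format, OF f(2) g(2)] fg(1) by simp
  moreover have "e dvd fminor A k f g" by (rule dvd_fminor[OF dvd f(1) g(1)])
  moreover have "e dvd c l (f k)" if "l < k" for l using c dvd f(2) that by blast
  ultimately show ?thesis by (auto intro!: dvd_add dvd_sum dvd_mult2)
qed

text \<open>
  The list of quotients of consecutive determinantal divisors \<open>D k\<close> has the property by which the
  definition selects a list, since each divisor divides the next one.
\<close>
lemma homogeneous_invariant_factors_props:
  fixes H :: "'a::alg_closed_field poly mat"
  assumes H: "matrix_pencil H"
  defines "ps \<equiv> homogeneous_invariant_factors H"
  shows "length ps = normal_rank H"
    and "k \<le> normal_rank H \<Longrightarrow> is_gcd_of (minors k (homogenize H)) (prod_list (take k ps))"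
proof -
  define A where "A = homogenize H"
  define r where "r = normal_rank H"
  have rA: "r = normal_rank A" by (simp add: r_def A_def normal_rank_homogenize[OF H])
  have nz: "\<exists>x\<in>minors k A. x \<noteq> 0" if "k \<le> r" for k
  proof (rule ccontr)
    assume "\<not> (\<exists>x\<in>minors k A. x \<noteq> 0)"
    then have zero: "\<forall>x\<in>minors k A. 0 dvd x" by simp
    have "\<forall>x\<in>minors (k + j) A. 0 dvd x" for j
    proof (induction j)
      case (Suc j)
      then show ?case using common_divisor_of_larger_minors[of "k + j" A 0] by auto
    qed (use zero in simp)
    from this[of "r - k"] that show False using normal_rank_props(1)[of A] by (auto simp: rA)
  qed
  have "\<exists>d. is_gcd_of (minors k A) d" if k: "k \<le> r" for k
  proof -
    obtain a0 where a0: "a0 \<in> minors k A" "a0 \<noteq> 0" using nz[OF k] by blast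
    have "\<exists>u M. u dvd 1 \<and> a = u * (\<Prod>l\<in>#M. linear_form l)" if a: "a \<in> minors k A" "a \<noteq> 0" for a
    proof -
      obtain x where x: "x \<in> minors k H" "a = hom_poly k x"
        using a(1) unfolding A_def minors_homogenize(1)[OF H] by auto
      have "degree x \<le> k" by (rule minors_homogenize(2)[OF H x(1)])
      moreover have "x \<noteq> 0" using a(2) x(2) by (auto simp: hom_poly_def)
      ultimately show ?thesis using hom_poly_factorization[of x k] x(2) by simp
    qed
    then show ?thesis
      using gcd_exists_of_prime_products[of linear_form "minors k A" a0]
        prime_elem_linear_form linear_form_dvd_imp_eq a0 by blast
  qed
  then obtain D' where D': "\<And>k. k \<le> r \<Longrightarrow> is_gcd_of (minors k A) (D' k)" by metis
  \<comment> \<open>The empty product of invariant factors is one, so the divisor of order zero has to be one itself.\<close>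
  define D where "D k = (if k = 0 then 1 else D' k)" for k
  have minors0: "minors 0 A = {1}"
  proof -
    have "minors 0 A = {det (submatrix A {} {})}"
      by (auto simp: minors_def card_eq_0_iff dest: finite_subset) 
    then show ?thesis by (simp add: submatrix_def det_dim_zero)
  qed
  have D: "is_gcd_of (minors k A) (D k)" if "k \<le> r" for k
    using D'[OF that] by (cases "k = 0") (auto simp: D_def minors0 is_gcd_of_def)
  have "D k dvd D (Suc k)" if "k < r" for k
    using D[of k] D[of "Suc k"] that common_divisor_of_larger_minors[of k A "D k"]
    unfolding is_gcd_of_def by auto
  then have "\<forall>k. \<exists>q. k < r \<longrightarrow> D (Suc k) = D k * q" by (auto elim: dvdE)
  then obtain q where q: "\<And>k. k < r \<Longrightarrow> D (Suc k) = D k * q k" by metis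
  define qs where "qs = map q [0..<r]"
  have "prod_list (take k qs) = D k" if "k \<le> r" for k
    using that
  proof (induction k)
    case 0
    show ?case by (simp add: D_def)
  next
    case (Suc k)
    then show ?case using q[of k] by (simp add: qs_def take_Suc_conv_app_nth)
  qed
  then have "length qs = r \<and> (\<forall>k\<le>r. is_gcd_of (minors k A) (prod_list (take k qs)))"
    using D by (simp add: qs_def)
  then have "length ps = r \<and> (\<forall>k\<le>r. is_gcd_of (minors k A) (prod_list (take k ps)))"
    unfolding ps_def homogeneous_invariant_factors_def A_def r_def by (rule someI)
  then show "length ps = normal_rank H"
    and "k \<le> normal_rank H \<Longrightarrow> is_gcd_of (minors k (homogenize H)) (prod_list (take k ps))"
    by (simp_all add: r_def A_def)
qed

section \<open>Weyr characteristics under a rank one perturbation\<close>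

text \<open>
  The linear form at any point is one of the primes to which the counting of \<open>weyr_count\<close> applies.
\<close>
lemma linear_form_chain:
  fixes H :: "'a::alg_closed_field poly mat"
  assumes H: "matrix_pencil H"
  shows "invariant_factor_chain (linear_form l) (homogenize H) (homogeneous_invariant_factors H)"
proof
  note props = homogeneous_invariant_factors_props[OF H]
  have rank: "length (homogeneous_invariant_factors H) = normal_rank (homogenize H)"
    by (simp add: props(1) normal_rank_homogenize[OF H])
  show "prime_elem (linear_form l)" by (rule prime_elem_linear_form)
  show "\<exists>k. \<not> linear_form l ^ k dvd f" if "f \<noteq> 0" for f using that by (rule linear_form_power_bounded)
  show "is_gcd_of (minors k (homogenize H)) (prod_list (take k (homogeneous_invariant_factors H)))"
    if "k \<le> length (homogeneous_invariant_factors H)" for k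
    using that by (intro props(2)) (simp add: props(1))
  show "\<exists>x\<in>minors (length (homogeneous_invariant_factors H)) (homogenize H). x \<noteq> 0"
    unfolding rank by (rule normal_rank_props(1))
  show "x = 0" if "x \<in> minors (Suc (length (homogeneous_invariant_factors H))) (homogenize H)" for x
    using that unfolding rank by (intro normal_rank_props(2)[of "homogenize H"]) simp_all
qed

text \<open>
  The perturbation and its negative both have rank at most one, so the approximation rank changes by at most one in
  either direction.
\<close>
lemma weyr_regular_rank_one:
  fixes H :: "'a::alg_closed_field poly mat"
  assumes "rank_one_perturbation m n H P u v"
  shows "\<exists>b b'. weyr_regular H l i + b = normal_rank H \<and>
    weyr_regular (H + P) l i + b' = normal_rank (H + P) \<and> b \<le> Suc b' \<and> b' \<le> Suc b"
proof -
  interpret rank_one_perturbation m n H P u v by fact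
  interpret A: invariant_factor_chain "linear_form l" "homogenize H" "homogeneous_invariant_factors H"
    by (rule linear_form_chain[OF pencilH])
  interpret B: invariant_factor_chain "linear_form l" "homogenize (H + P)" "homogeneous_invariant_factors (H + P)"
    by (rule linear_form_chain[OF pencilHP])
  define U :: "nat \<Rightarrow> 'a poly poly" where "U r = [:[:u $$ (r, 0):]:]" for r
  define W where "W c = [:[:0, coeff (v $$ (c, 0)) 0:], [:coeff (v $$ (c, 0)) 1:]:]" for c
  have dims: "dim_row (homogenize H) = m" "dim_col (homogenize H) = n"
    "dim_row (homogenize (H + P)) = m" "dim_col (homogenize (H + P)) = n"
    using H HP carrier_matD[OF P_carrier] by (simp_all add: homogenize_def)
  have entry: "homogenize (H + P) $$ (r, c) = homogenize H $$ (r, c) + U r * W c"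
    if "r < m" "c < n" for r c
  proof -
    have "homogenize (H + P) $$ (r, c) = [:[:0, coeff ((H + P) $$ (r, c)) 0:], [:coeff ((H + P) $$ (r, c)) 1:]:]"
      unfolding homogenize_def using HP that by (intro index_map_mat(1)[THEN trans]) auto
    then show ?thesis
      using H that unfolding HP_index[OF that] by (simp add: homogenize_def U_def W_def)
  qed
  have "A.approximable (homogenize (H + P)) i (Suc (A.approx_rank i))"
    by (rule A.approximable_rank_one_update[OF A.approx_rank(1)]) (use entry in \<open>simp_all add: dims\<close>)
  then have "B.approx_rank i \<le> Suc (A.approx_rank i)" by (rule B.approx_rank_le)
  moreover have "A.approximable (homogenize H) i (Suc (B.approx_rank i))"
    by (rule A.approximable_rank_one_update[OF B.approx_rank(1), where U = "\<lambda>r. - U r" and W = W])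
      (use entry in \<open>simp_all add: dims\<close>)
  then have "A.approx_rank i \<le> Suc (B.approx_rank i)" by (rule A.approx_rank_le)
  moreover have "weyr_regular H l i + A.approx_rank i = normal_rank H"
    using A.weyr_count[of i] homogeneous_invariant_factors_props(1)[OF pencilH]
    by (simp add: weyr_regular_def partial_multiplicities_def)
  moreover have "weyr_regular (H + P) l i + B.approx_rank i = normal_rank (H + P)"
    using B.weyr_count[of i] homogeneous_invariant_factors_props(1)[OF pencilHP]
    by (simp add: weyr_regular_def partial_multiplicities_def)
  ultimately show ?thesis by blast
qed

theorem theorem3p4:
  fixes H P :: "'a::alg_closed_field poly mat"
    and u :: "'a mat" and v :: "'a poly mat"
    and m n :: nat
    and w w' :: "'a extended \<Rightarrow> nat \<Rightarrow> nat"
    and r r' s s' :: "nat \<Rightarrow> nat"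
  assumes "H \<in> carrier_mat m n" and "matrix_pencil H"
    and "weyr_characteristic H = (w, r, s)"
    and "u \<in> carrier_mat m 1" and "v \<in> carrier_mat n 1"
    and "P = map_mat (\<lambda>c. [:c:]) u * transpose_mat v" and "matrix_pencil P"
    and "weyr_characteristic (H + P) = (w', r', s')"
  shows
    "(normal_rank (H + P) = normal_rank H \<longrightarrow>
        (\<forall>i \<ge> 1. \<forall>l. -1 \<le> int (w' l i) - int (w l i) \<and> int (w' l i) - int (w l i) \<le> 1) \<and>
        (unstar r = (\<lambda>_. 0) \<longrightarrow>
          (\<forall>i. 0 \<le> int (r' i) - int (r i) \<and> int (r' i) - int (r i) \<le> 2)) \<and>
        (unstar r \<noteq> (\<lambda>_. 0) \<longrightarrow>
          (\<forall>i. - \<lfloor>sqrt (real (partition_size (unstar r)))\<rfloor> - 1 \<le> int (r' i) - int (r i) \<and>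
               int (r' i) - int (r i) \<le> \<lfloor>sqrt (real (partition_size (unstar r)) - 1)\<rfloor> + 2)) \<and>
        (unstar s = (\<lambda>_. 0) \<longrightarrow>
          (\<forall>i. 0 \<le> int (s' i) - int (s i) \<and> int (s' i) - int (s i) \<le> 1)) \<and>
        (unstar s \<noteq> (\<lambda>_. 0) \<longrightarrow>
          (\<forall>i. - \<lfloor>sqrt (real (partition_size s))\<rfloor> \<le> int (s' i) - int (s i) \<and>
               int (s' i) - int (s i) \<le> \<lfloor>sqrt (real (partition_size s))\<rfloor>))) \<and>
     (int (normal_rank (H + P)) = int (normal_rank H) - 1 \<longrightarrow>
        (\<forall>i \<ge> 1. \<forall>l. -2 \<le> int (w' l i) - int (w l i) \<and> int (w' l i) - int (w l i) \<le> 0) \<and>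
        (\<forall>i. - \<lfloor>sqrt (real (partition_size (unstar r)))\<rfloor> \<le> int (r' i) - int (r i) \<and>
             int (r' i) - int (r i) \<le> 1) \<and>
        (\<forall>i. 1 - \<lfloor>sqrt (real (partition_size s) + 1)\<rfloor> \<le> int (s' i) - int (s i) \<and>
             int (s' i) - int (s i) \<le> 1)) \<and>
     (normal_rank (H + P) = normal_rank H + 1 \<longrightarrow>
        (\<forall>i \<ge> 1. \<forall>l. 0 \<le> int (w' l i) - int (w l i) \<and> int (w' l i) - int (w l i) \<le> 2) \<and>
        (\<forall>i. -1 \<le> int (r' i) - int (r i) \<and>
             int (r' i) - int (r i) \<le> \<lfloor>sqrt (real (partition_size (unstar r)) + 1)\<rfloor>) \<and>
        (\<forall>i. -1 \<le> int (s' i) - int (s i) \<and>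
             int (s' i) - int (s i) \<le> -1 + \<lfloor>sqrt (real (partition_size s))\<rfloor>))"
proof -
  have pert: "rank_one_perturbation m n H P u v"
    by (rule rank_one_perturbation.intro) (fact assms)+
  interpret rank_one_perturbation m n H P u v by (rule pert)
  have w: "w = weyr_regular H" "w' = weyr_regular (H + P)"
    and r: "r = column_brunovsky H" "r' = column_brunovsky (H + P)"
    and s: "s = row_brunovsky H" "s' = row_brunovsky (H + P)"
    using assms(3,8) by (simp_all add: weyr_characteristic_def)
  have weyr: "int (w' l i) - int (w l i) \<le> int (normal_rank (H + P)) - int (normal_rank H) + 1 \<and>
      int (normal_rank (H + P)) - int (normal_rank H) - 1 \<le> int (w' l i) - int (w l i)" for l i
    using weyr_regular_rank_one[OF pert, of l i] unfolding w by (elim exE conjE) linarith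
  obtain q Q p R p' R' where col: "nested_counts 1 q Q p R" "nested_counts 1 q Q p' R'"
    "p + normal_rank H = n" "p' + normal_rank (H + P) = n" "r = brunovsky_of p R" "r' = brunovsky_of p' R'"
    using column_counts unfolding r by (elim exE conjE)
  obtain t T a S a' S' where row: "nested_counts 0 a S t T" "nested_counts 0 a' S' t T"
    "a + normal_rank H = m" "a' + normal_rank (H + P) = m" "s = brunovsky_of a S" "s' = brunovsky_of a' S'"
    using row_counts unfolding s by (elim exE conjE)
  note cb = column_bounds[OF col(1,2,5,6)] and rb = row_bounds[OF row(1,2,5,6)]
  show ?thesis
  proof (intro conjI[of "_ \<longrightarrow> _"] impI)
    assume eq: "normal_rank (H + P) = normal_rank H"
    have p: "p' = p" "a' = a" using col(3,4) row(3,4) eq by linarith+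
    show "(\<forall>i \<ge> 1. \<forall>l. -1 \<le> int (w' l i) - int (w l i) \<and> int (w' l i) - int (w l i) \<le> 1) \<and>
        (unstar r = (\<lambda>_. 0) \<longrightarrow>
          (\<forall>i. 0 \<le> int (r' i) - int (r i) \<and> int (r' i) - int (r i) \<le> 2)) \<and>
        (unstar r \<noteq> (\<lambda>_. 0) \<longrightarrow>
          (\<forall>i. - \<lfloor>sqrt (real (partition_size (unstar r)))\<rfloor> - 1 \<le> int (r' i) - int (r i) \<and>
               int (r' i) - int (r i) \<le> \<lfloor>sqrt (real (partition_size (unstar r)) - 1)\<rfloor> + 2)) \<and>
        (unstar s = (\<lambda>_. 0) \<longrightarrow>
          (\<forall>i. 0 \<le> int (s' i) - int (s i) \<and> int (s' i) - int (s i) \<le> 1)) \<and>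
        (unstar s \<noteq> (\<lambda>_. 0) \<longrightarrow>
          (\<forall>i. - \<lfloor>sqrt (real (partition_size s))\<rfloor> \<le> int (s' i) - int (s i) \<and>
               int (s' i) - int (s i) \<le> \<lfloor>sqrt (real (partition_size s))\<rfloor>))"
      using cb(1,2)[OF p(1)] rb(1,2)[OF p(2)] weyr eq by (intro conjI allI impI) auto
  next
    assume eq: "int (normal_rank (H + P)) = int (normal_rank H) - 1"
    have p: "p' = Suc p" "a' = Suc a" using col(3,4) row(3,4) eq by linarith+
    show "(\<forall>i \<ge> 1. \<forall>l. -2 \<le> int (w' l i) - int (w l i) \<and> int (w' l i) - int (w l i) \<le> 0) \<and>
        (\<forall>i. - \<lfloor>sqrt (real (partition_size (unstar r)))\<rfloor> \<le> int (r' i) - int (r i) \<and>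
             int (r' i) - int (r i) \<le> 1) \<and>
        (\<forall>i. 1 - \<lfloor>sqrt (real (partition_size s) + 1)\<rfloor> \<le> int (s' i) - int (s i) \<and>
             int (s' i) - int (s i) \<le> 1)"
      using cb(3)[OF p(1)] rb(3)[OF p(2)] weyr eq by (intro conjI allI impI) auto
  next
    assume eq: "normal_rank (H + P) = normal_rank H + 1"
    have p: "p = Suc p'" "a = Suc a'" using col(3,4) row(3,4) eq by linarith+
    show "(\<forall>i \<ge> 1. \<forall>l. 0 \<le> int (w' l i) - int (w l i) \<and> int (w' l i) - int (w l i) \<le> 2) \<and>
        (\<forall>i. -1 \<le> int (r' i) - int (r i) \<and>
             int (r' i) - int (r i) \<le> \<lfloor>sqrt (real (partition_size (unstar r)) + 1)\<rfloor>) \<and>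
        (\<forall>i. -1 \<le> int (s' i) - int (s i) \<and>
             int (s' i) - int (s i) \<le> -1 + \<lfloor>sqrt (real (partition_size s))\<rfloor>)"
      using cb(4)[OF p(1)] rb(4)[OF p(2)] weyr eq by (intro conjI allI impI) auto
  qed
qed

end
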